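(* Let $(M,L)$ be a Finsler manifold with Finsler metric $g$, let $D^*$ be its Hashiguchi connection with h-curvature $R^*$ and hv-curvature $P^*$, and let $T$, $S$, $\widehat P$, $\widehat R$ be the (h)hv-torsion, v-curvature, (v)hv-torsion and (v)h-torsion of the Cartan connection. Let $\mathfrak R$ be the curvature of the Barthel connection. Then for all $\pi$-vector fields $X,Y,Z,W$: (a) $R^*(X,Y,Z,W)=-R^*(Y,X,Z,W)$; (b) $R^*(X,Y,Z,W)+R^*(X,Y,W,Z)=2\,\mathfrak U_{X,Y}\{(D^*_{\beta Y}\widehat P)(X,Z,W)\}$; (c) $\widehat{R^*}(X,Y)=\widehat R(X,Y)=-K\,\mathfrak R(\beta X,\beta Y)$; (d) $\mathfrak S_{X,Y,Z}\{R^*(X,Y)Z-T(\widehat R(X,Y),Z)\}=0$; (e) $\mathfrak S_{X,Y,Z}\{(D^*_{\beta X}R^* )(Y,Z,W)+P^*(X,\widehat R(Y,Z))W\}=0$; (f) $(D^*_{\gamma X}R^* )(Y,Z,W)+(D^*_{\beta Y}P^* )(Z,X,W)-(D^*_{\beta Z}P^* )(Y,X,W)+R^*(T(X,Y),Z)W-S(\widehat R(Y,Z),X)W-R^*(T(X,Z),Y)W=0$; (g) $(D^*_{\gamma\eta}R^* )(X,Y,Z)=0$.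
   Context: $M$ is a real paracompact $C^\infty$ manifold of finite dimension, $\mathcal TM\subset TM$ is the set of nonzero tangent vectors, $\pi:\mathcal TM\to M$ the projection, $\pi^{-1}(TM)\to\mathcal TM$ the pullback of $TM$ by $\pi$; everything is $C^\infty$. Sections of $\pi^{-1}(TM)$ are called $\pi$-vector fields. $\eta$ is the $\pi$-vector field $\eta(u)=(u,u)$. $\rho:T(\mathcal TM)\to\pi^{-1}(TM)$ is $\rho(A)=(u,d\pi(A))$ for $A\in T_u(\mathcal TM)$, and $\gamma:\pi^{-1}(TM)\to T(\mathcal TM)$ is the vertical lift $\gamma(u,v)=\frac{d}{dt}|_{t=0}(u+tv)$; $V=\ker\rho=\operatorname{im}\gamma$; $J=\gamma\circ\rho$. $(M,L)$ is a Finsler manifold: $L:TM\to[0,\infty)$ is smooth and positive on $\mathcal TM$, positively homogeneous of degree 1 on fibres, and the fibrewise Hessian of $E=\frac12L^2$ is positive definite on $\mathcal TM$; this Hessian (in coordinates $g_{ij}=\frac12\partial^2L^2/\partial y^i\partial y^j$) is the Finsler metric $g$ on $\pi^{-1}(TM)$. For a linear connection $D$ on $\pi^{-1}(TM)$, put $K(A)=D_A\eta$ and $H=\ker K$. $D$ is regular if $T(\mathcal TM)=V\oplus H$; then $\beta:=(\rho|_H)^{-1}:\pi^{-1}(TM)\to H$. Torsion: $\mathbf T(A,B)=D_A\rho B-D_B\rho A-\rho[A,B]$; curvature (note the sign): $\mathbf K(A,B)\rho C=-D_AD_B\rho C+D_BD_A\rho C+D_{[A,B]}\rho C$. $Q(X,Y)=\mathbf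 T(\beta X,\beta Y)$, $T(X,Y)=\mathbf T(\gamma X,\beta Y)$; h-, hv-, v-curvatures $R(X,Y)Z=\mathbf K(\beta X,\beta Y)Z$, $P(X,Y)Z=\mathbf K(\beta X,\gamma Y)Z$, $S(X,Y)Z=\mathbf K(\gamma X,\gamma Y)Z$; a hat denotes contraction with $\eta$: $\widehat R(X,Y)=R(X,Y)\eta$, $\widehat P(X,Y)=P(X,Y)\eta$. The Cartan connection $\nabla$ is the unique regular connection on $\pi^{-1}(TM)$ with $\nabla g=0$, $Q=0$, and $g(T(X,Y),Z)=g(T(X,Z),Y)$; unadorned $T,S,\widehat P,\widehat R,K,\beta$ refer to $\nabla$. The Hashiguchi connection $D^*$ is the unique regular connection on $\pi^{-1}(TM)$ such that $D^*_{\gamma X}g=0$, $g(T^*(X,Y),Z)=g(T^*(X,Z),Y)$, $Q^*=0$, $\widehat{P^*}=0$, and $D^*_{h^*A}L=0$ for all $A$ (where $h^*=\beta^*\circ\rho$); objects with $^*$ are those of $D^*$. Known facts: $\beta^*=\beta$, $K^*=K$, $T^*=T$, and $D^*_AY=\nabla_AY+\widehat P(\rho A,Y)$. Barthel connection: $\Gamma=[J,G]$, i.e. $\Gamma(A)=[JA,G]-J[A,G]$, where $G$ is the canonical spray defined by $i_G\,dd_JE=-dE$ ($d_JE=dE\circ J$). With $h=\frac12(I+\Gamma)$, $v=\frac12(I-\Gamma)$ its curvature is $\mathfrak R(A,B)=-v[hA,hB]$. Known: $\Gamma=2\beta\circ\rho-I$. Notation: $R^*(X,Y,Z,W):=g(R^*(X,Y)Z,W)$,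 $\widehat P(X,Y,Z):=g(\widehat P(X,Y),Z)$; in (b), $(D^*_A\widehat P)(X,Z,W)$ is the covariant derivative of this scalar-valued trilinear form. For $B\in\{R^*,P^*\}$, $(D^*_AB)(X,Y,Z)$ is the vector-valued covariant derivative of $(X,Y,Z)\mapsto B(X,Y)Z$. $\mathfrak S_{X,Y,Z}$ is the cyclic sum; $\mathfrak U_{X,Y}\{F(X,Y)\}=F(X,Y)-F(Y,X)$. *)

theory Defs
  imports "HOL-Analysis.Analysis" "HOL-Library.Function_Algebras"
begin

text \<open>
  Function_Algebras supplies the pointwise abelian group structure on functions; tangent vectors
  (which are encoded below as functions on charts) and sections also need pointwise scalar
  multiplication.
\<close>

instantiation "fun" :: (type, real_vector) real_vector
begin

definition scaleR_fun :: "real \<Rightarrow> ('a \<Rightarrow> 'b) \<Rightarrow> 'a \<Rightarrow> 'b"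
  where "scaleR_fun r f = (\<lambda>x. r *\<^sub>R f x)"

instance
  by standard (auto simp: scaleR_fun_def fun_eq_iff scaleR_add_right scaleR_add_left)

end

lemma scaleR_fun_apply [simp]: "(r *\<^sub>R f) x = r *\<^sub>R f x"
  by (simp add: scaleR_fun_def)


section \<open>Smooth manifolds given by an atlas\<close>

text \<open>\<open>Ck_on k S f\<close> is meant for open \<open>S\<close> in a Euclidean space: \<open>f\<close> is of class \<open>C\<^sup>k\<close> on \<open>S\<close>.\<close>

primrec Ck_on ::
  "nat \<Rightarrow> 'a::euclidean_space set \<Rightarrow> ('a \<Rightarrow> 'b::real_normed_vector) \<Rightarrow> bool" where
  "Ck_on 0 S f \<longleftrightarrow> continuous_on S f"
| "Ck_on (Suc k) S f \<longleftrightarrow>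
     (\<forall>x\<in>S. f differentiable at x) \<and> (\<forall>v. Ck_on k S (\<lambda>x. frechet_derivative f (at x) v))"

definition smooth_on ::
  "'a::euclidean_space set \<Rightarrow> ('a \<Rightarrow> 'b::real_normed_vector) \<Rightarrow> bool" where
  "smooth_on S f \<longleftrightarrow> (\<forall>k. Ck_on k S f)"

text \<open>A chart is its domain together with its coordinate map (irrelevant off the domain).\<close>

type_synonym ('a, 'e) chart = "'a set \<times> ('a \<Rightarrow> 'e)"

definition chart_inv :: "('a, 'e) chart \<Rightarrow> 'e \<Rightarrow> 'a" where
  "chart_inv c = inv_into (fst c) (snd c)"

definition points :: "('a, 'e) chart set \<Rightarrow> 'a set" where
  "points A = (\<Union>c\<in>A. fst c)"

definition paracompact_space :: "'a topology \<Rightarrow> bool" where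
  "paracompact_space T \<longleftrightarrow>
     (\<forall>\<U>. (\<forall>U\<in>\<U>. openin T U) \<and> \<Union>\<U> = topspace T \<longrightarrow>
       (\<exists>\<V>. (\<forall>V\<in>\<V>. openin T V) \<and> \<Union>\<V> = topspace T \<and>
         (\<forall>V\<in>\<V>. \<exists>U\<in>\<U>. V \<subseteq> U) \<and>
         (\<forall>p\<in>topspace T. \<exists>N. openin T N \<and> p \<in> N \<and> finite {V \<in> \<V>. V \<inter> N \<noteq> {}})))"

definition smooth_manifold :: "'a topology \<Rightarrow> ('a, 'e::euclidean_space) chart set \<Rightarrow> bool" where
  "smooth_manifold T A \<longleftrightarrow>
     Hausdorff_space T \<and> paracompact_space T \<and> points A = topspace T \<and>
     (\<forall>c\<in>A. openin T (fst c) \<and> open (snd c ` fst c) \<and>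
        homeomorphic_map (subtopology T (fst c)) (top_of_set (snd c ` fst c)) (snd c)) \<and>
     (\<forall>c\<in>A. \<forall>d\<in>A. smooth_on (snd c ` (fst c \<inter> fst d)) (snd d \<circ> chart_inv c))"

definition smooth_fun :: "('a, 'e::euclidean_space) chart set \<Rightarrow> ('a \<Rightarrow> real) \<Rightarrow> bool" where
  "smooth_fun A f \<longleftrightarrow> (\<forall>c\<in>A. smooth_on (snd c ` fst c) (f \<circ> chart_inv c))"

text \<open>
  A tangent vector at \<open>p\<close> is the family of its coordinate vectors in all charts around \<open>p\<close>, related
  to each other by the Jacobians of the transition maps. The entries belonging to other charts
  are \<open>0\<close>, so that equality of tangent vectors at \<open>p\<close> is equality of families.
\<close>

type_synonym ('a, 'e) tvec = "('a, 'e) chart \<Rightarrow> 'e"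

definition tangent_space ::
  "('a, 'e::euclidean_space) chart set \<Rightarrow> 'a \<Rightarrow> ('a, 'e) tvec set" where
  "tangent_space A p =
     {v. (\<forall>c. \<not> (c \<in> A \<and> p \<in> fst c) \<longrightarrow> v c = 0) \<and>
         (\<forall>c\<in>A. \<forall>d\<in>A. p \<in> fst c \<and> p \<in> fst d \<longrightarrow>
            v d = frechet_derivative (snd d \<circ> chart_inv c) (at (snd c p)) (v c))}"

definition chart_at :: "('a, 'e) chart set \<Rightarrow> 'a \<Rightarrow> ('a, 'e) chart" where
  "chart_at A p = (SOME c. c \<in> A \<and> p \<in> fst c)"

text \<open>For a tangent vector \<open>a\<close> at \<open>p\<close> the value does not depend on the chart around \<open>p\<close> chosen here.\<close>

definition dir_deriv ::
  "('a, 'e::euclidean_space) chart set \<Rightarrow> 'a \<Rightarrow> ('a, 'e) tvec \<Rightarrow> ('a \<Rightarrow> real) \<Rightarrow> real" where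
  "dir_deriv A p a f =
     (let c = chart_at A p in frechet_derivative (f \<circ> chart_inv c) (at (snd c p)) (a c))"

definition differential ::
  "('a, 'e::euclidean_space) chart set \<Rightarrow> ('b, 'f::euclidean_space) chart set \<Rightarrow>
   ('a \<Rightarrow> 'b) \<Rightarrow> 'a \<Rightarrow> ('a, 'e) tvec \<Rightarrow> ('b, 'f) tvec" where
  "differential A B f p a =
     (\<lambda>d. if d \<in> B \<and> f p \<in> fst d
          then let c = chart_at A p in
            frechet_derivative (snd d \<circ> f \<circ> chart_inv c) (at (snd c p)) (a c)
          else 0)"

definition velocity_at_0 ::
  "('a, 'e::euclidean_space) chart set \<Rightarrow> (real \<Rightarrow> 'a) \<Rightarrow> ('a, 'e) tvec" where
  "velocity_at_0 A \<sigma> =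
     (\<lambda>c. if c \<in> A \<and> \<sigma> 0 \<in> fst c then vector_derivative (snd c \<circ> \<sigma>) (at 0) else 0)"

definition vector_fields ::
  "('a, 'e::euclidean_space) chart set \<Rightarrow> ('a \<Rightarrow> ('a, 'e) tvec) set" where
  "vector_fields A =
     {X. (\<forall>p\<in>points A. X p \<in> tangent_space A p) \<and> (\<forall>p. p \<notin> points A \<longrightarrow> X p = 0) \<and>
         (\<forall>c\<in>A. smooth_on (snd c ` fst c) (\<lambda>z. X (chart_inv c z) c))}"

text \<open>In coordinates \<open>[X,Y]\<^sup>i = X\<^sup>j \<partial>\<^sub>j Y\<^sup>i - Y\<^sup>j \<partial>\<^sub>j X\<^sup>i\<close>.\<close>

definition lie_bracket ::
  "('a, 'e::euclidean_space) chart set \<Rightarrow> ('a \<Rightarrow> ('a, 'e) tvec) \<Rightarrow> ('a \<Rightarrow> ('a, 'e) tvec) \<Rightarrow>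
   'a \<Rightarrow> ('a, 'e) tvec" where
  "lie_bracket A X Y p =
     (\<lambda>c. if c \<in> A \<and> p \<in> fst c
          then frechet_derivative (\<lambda>z. Y (chart_inv c z) c) (at (snd c p)) (X p c)
             - frechet_derivative (\<lambda>z. X (chart_inv c z) c) (at (snd c p)) (Y p c)
          else 0)"


section \<open>The slit tangent bundle and \<pi>-vector fields\<close>

type_synonym ('a, 'e) tm = "'a \<times> ('a, 'e) tvec"

definition tangent_bundle :: "('a, 'e::euclidean_space) chart set \<Rightarrow> ('a, 'e) tm set" where
  "tangent_bundle A = {u. fst u \<in> points A \<and> snd u \<in> tangent_space A (fst u)}"

definition slit :: "('a, 'e::euclidean_space) chart set \<Rightarrow> ('a, 'e) tm set" where
  "slit A = {u \<in> tangent_bundle A. snd u \<noteq> 0}"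

definition slit_chart ::
  "('a, 'e::euclidean_space) chart set \<Rightarrow> ('a, 'e) chart \<Rightarrow> (('a, 'e) tm, 'e \<times> 'e) chart" where
  "slit_chart A c = ({u \<in> slit A. fst u \<in> fst c}, \<lambda>u. (snd c (fst u), snd u c))"

definition slit_atlas ::
  "('a, 'e::euclidean_space) chart set \<Rightarrow> (('a, 'e) tm, 'e \<times> 'e) chart set" where
  "slit_atlas A = slit_chart A ` A"

text \<open>
  The element \<open>(u, x)\<close> of the pullback bundle \<open>\<pi>\<^sup>-\<^sup>1(TM)\<close> is represented by its component \<open>x\<close>, the
  base point \<open>u\<close> being carried along separately. All sections, of the pullback bundle as well as
  of the tangent bundle of the slit tangent bundle, are \<open>0\<close> off the slit tangent bundle.
\<close>

type_synonym ('a, 'e) ttm = "(('a, 'e) tm, 'e \<times> 'e) tvec"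
type_synonym ('a, 'e) pi_field = "('a, 'e) tm \<Rightarrow> ('a, 'e) tvec"
type_synonym ('a, 'e) tm_field = "('a, 'e) tm \<Rightarrow> ('a, 'e) ttm"

definition on_slit ::
  "('a, 'e::euclidean_space) chart set \<Rightarrow> (('a, 'e) tm \<Rightarrow> 'b::zero) \<Rightarrow> ('a, 'e) tm \<Rightarrow> 'b" where
  "on_slit A F = (\<lambda>u. if u \<in> slit A then F u else 0)"

definition pi_fields :: "('a, 'e::euclidean_space) chart set \<Rightarrow> ('a, 'e) pi_field set" where
  "pi_fields A =
     {X. (\<forall>u\<in>slit A. X u \<in> tangent_space A (fst u)) \<and> (\<forall>u. u \<notin> slit A \<longrightarrow> X u = 0) \<and>
         (\<forall>c\<in>A. smooth_on (snd (slit_chart A c) ` fst (slit_chart A c))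
                  (\<lambda>z. X (chart_inv (slit_chart A c) z) c))}"

abbreviation tm_fields :: "('a, 'e::euclidean_space) chart set \<Rightarrow> ('a, 'e) tm_field set" where
  "tm_fields A \<equiv> vector_fields (slit_atlas A)"

abbreviation bracket ::
  "('a, 'e::euclidean_space) chart set \<Rightarrow> ('a, 'e) tm_field \<Rightarrow> ('a, 'e) tm_field \<Rightarrow>
   ('a, 'e) tm_field" where
  "bracket A \<equiv> lie_bracket (slit_atlas A)"

definition deriv_along ::
  "('a, 'e::euclidean_space) chart set \<Rightarrow> ('a, 'e) tm_field \<Rightarrow> (('a, 'e) tm \<Rightarrow> real) \<Rightarrow>
   ('a, 'e) tm \<Rightarrow> real" where
  "deriv_along A B f = (\<lambda>u. dir_deriv (slit_atlas A) u (B u) f)"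

definition eta :: "('a, 'e::euclidean_space) chart set \<Rightarrow> ('a, 'e) pi_field" where
  "eta A = on_slit A snd"

definition rho ::
  "('a, 'e::euclidean_space) chart set \<Rightarrow> ('a, 'e) tm \<Rightarrow> ('a, 'e) ttm \<Rightarrow> ('a, 'e) tvec" where
  "rho A u a = differential (slit_atlas A) A fst u a"

definition gamma ::
  "('a, 'e::euclidean_space) chart set \<Rightarrow> ('a, 'e) tm \<Rightarrow> ('a, 'e) tvec \<Rightarrow> ('a, 'e) ttm" where
  "gamma A u x = velocity_at_0 (slit_atlas A) (\<lambda>t. (fst u, snd u + t *\<^sub>R x))"

definition rho_field ::
  "('a, 'e::euclidean_space) chart set \<Rightarrow> ('a, 'e) tm_field \<Rightarrow> ('a, 'e) pi_field" where
  "rho_field A B = on_slit A (\<lambda>u. rho A u (B u))"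

definition gamma_field ::
  "('a, 'e::euclidean_space) chart set \<Rightarrow> ('a, 'e) pi_field \<Rightarrow> ('a, 'e) tm_field" where
  "gamma_field A X = on_slit A (\<lambda>u. gamma A u (X u))"

definition J_field ::
  "('a, 'e::euclidean_space) chart set \<Rightarrow> ('a, 'e) tm_field \<Rightarrow> ('a, 'e) tm_field" where
  "J_field A B = gamma_field A (rho_field A B)"


section \<open>Finsler structures\<close>

definition energy :: "(('a, 'e) tm \<Rightarrow> real) \<Rightarrow> ('a, 'e) tm \<Rightarrow> real" where
  "energy L u = (L u)\<^sup>2 / 2"

text \<open>
  The fibrewise Hessian of the energy:
  \<open>g\<^sub>u(x,y) = \<partial>\<^sup>2/\<partial>s\<partial>t E(u + sx + ty)\<close> at \<open>s = t = 0\<close>.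
\<close>

definition finsler_metric ::
  "(('a, 'e::euclidean_space) tm \<Rightarrow> real) \<Rightarrow> ('a, 'e) tm \<Rightarrow> ('a, 'e) tvec \<Rightarrow> ('a, 'e) tvec \<Rightarrow> real"
  where
  "finsler_metric L u x y =
     deriv (\<lambda>s. deriv (\<lambda>t. energy L (fst u, snd u + s *\<^sub>R x + t *\<^sub>R y)) 0) 0"

definition metric_fun ::
  "(('a, 'e::euclidean_space) tm \<Rightarrow> real) \<Rightarrow> ('a, 'e) pi_field \<Rightarrow> ('a, 'e) pi_field \<Rightarrow>
   ('a, 'e) tm \<Rightarrow> real" where
  "metric_fun L X Y = (\<lambda>u. finsler_metric L u (X u) (Y u))"

definition finsler_manifold ::
  "'a topology \<Rightarrow> ('a, 'e::euclidean_space) chart set \<Rightarrow> (('a, 'e) tm \<Rightarrow> real) \<Rightarrow> bool" where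
  "finsler_manifold T A L \<longleftrightarrow>
     smooth_manifold T A \<and>
     (\<forall>u\<in>tangent_bundle A. L u \<ge> 0) \<and>
     smooth_fun (slit_atlas A) L \<and>
     (\<forall>u\<in>slit A. L u > 0) \<and>
     (\<forall>u\<in>tangent_bundle A. \<forall>r>0. L (fst u, r *\<^sub>R snd u) = r * L u) \<and>
     (\<forall>u\<in>slit A. \<forall>x\<in>tangent_space A (fst u). x \<noteq> 0 \<longrightarrow> finsler_metric L u x x > 0)"


section \<open>Linear connections on the pullback bundle\<close>

text \<open>
  A connection maps a point \<open>u\<close>, a tangent vector \<open>a\<close> at \<open>u\<close> and a section \<open>Y\<close> to \<open>D\<^sub>a Y\<close>.
\<close>

type_synonym ('a, 'e) conn =
  "('a, 'e) tm \<Rightarrow> ('a, 'e) ttm \<Rightarrow> ('a, 'e) pi_field \<Rightarrow> ('a, 'e) tvec"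

definition cov ::
  "('a, 'e::euclidean_space) chart set \<Rightarrow> ('a, 'e) conn \<Rightarrow> ('a, 'e) tm_field \<Rightarrow>
   ('a, 'e) pi_field \<Rightarrow> ('a, 'e) pi_field" where
  "cov A D B Y = on_slit A (\<lambda>u. D u (B u) Y)"

definition linear_connection ::
  "('a, 'e::euclidean_space) chart set \<Rightarrow> ('a, 'e) conn \<Rightarrow> bool" where
  "linear_connection A D \<longleftrightarrow>
     (\<forall>u\<in>slit A. \<forall>a\<in>tangent_space (slit_atlas A) u. \<forall>Y\<in>pi_fields A.
        D u a Y \<in> tangent_space A (fst u) \<and>
        (\<forall>b\<in>tangent_space (slit_atlas A) u. D u (a + b) Y = D u a Y + D u b Y) \<and>
        (\<forall>r. D u (r *\<^sub>R a) Y = r *\<^sub>R D u a Y) \<and>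
        (\<forall>Z\<in>pi_fields A. D u a (Y + Z) = D u a Y + D u a Z) \<and>
        (\<forall>f. smooth_fun (slit_atlas A) f \<longrightarrow>
           D u a (\<lambda>w. f w *\<^sub>R Y w) = dir_deriv (slit_atlas A) u a f *\<^sub>R Y u + f u *\<^sub>R D u a Y)) \<and>
     (\<forall>B\<in>tm_fields A. \<forall>Y\<in>pi_fields A. cov A D B Y \<in> pi_fields A)"

definition K_map ::
  "('a, 'e::euclidean_space) chart set \<Rightarrow> ('a, 'e) conn \<Rightarrow> ('a, 'e) tm \<Rightarrow> ('a, 'e) ttm \<Rightarrow>
   ('a, 'e) tvec" where
  "K_map A D u a = D u a (eta A)"

definition K_field ::
  "('a, 'e::euclidean_space) chart set \<Rightarrow> ('a, 'e) conn \<Rightarrow> ('a, 'e) tm_field \<Rightarrow>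
   ('a, 'e) pi_field" where
  "K_field A D B = on_slit A (\<lambda>u. K_map A D u (B u))"

definition vertical_space ::
  "('a, 'e::euclidean_space) chart set \<Rightarrow> ('a, 'e) tm \<Rightarrow> ('a, 'e) ttm set" where
  "vertical_space A u = {a \<in> tangent_space (slit_atlas A) u. rho A u a = 0}"

definition horizontal_space ::
  "('a, 'e::euclidean_space) chart set \<Rightarrow> ('a, 'e) conn \<Rightarrow> ('a, 'e) tm \<Rightarrow> ('a, 'e) ttm set" where
  "horizontal_space A D u = {a \<in> tangent_space (slit_atlas A) u. K_map A D u a = 0}"

definition regular_connection ::
  "('a, 'e::euclidean_space) chart set \<Rightarrow> ('a, 'e) conn \<Rightarrow> bool" where
  "regular_connection A D \<longleftrightarrow>
     linear_connection A D \<and>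
     (\<forall>u\<in>slit A. \<forall>a\<in>tangent_space (slit_atlas A) u.
        \<exists>!(b, c). b \<in> vertical_space A u \<and> c \<in> horizontal_space A D u \<and> a = b + c)"

definition beta ::
  "('a, 'e::euclidean_space) chart set \<Rightarrow> ('a, 'e) conn \<Rightarrow> ('a, 'e) tm \<Rightarrow> ('a, 'e) tvec \<Rightarrow>
   ('a, 'e) ttm" where
  "beta A D u = inv_into (horizontal_space A D u) (rho A u)"

definition beta_field ::
  "('a, 'e::euclidean_space) chart set \<Rightarrow> ('a, 'e) conn \<Rightarrow> ('a, 'e) pi_field \<Rightarrow>
   ('a, 'e) tm_field" where
  "beta_field A D X = on_slit A (\<lambda>u. beta A D u (X u))"

definition torsion ::
  "('a, 'e::euclidean_space) chart set \<Rightarrow> ('a, 'e) conn \<Rightarrow> ('a, 'e) tm_field \<Rightarrow>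
   ('a, 'e) tm_field \<Rightarrow> ('a, 'e) pi_field" where
  "torsion A D B C =
     cov A D B (rho_field A C) - cov A D C (rho_field A B) - rho_field A (bracket A B C)"

text \<open>The sign is opposite to the more common convention.\<close>

definition curvature ::
  "('a, 'e::euclidean_space) chart set \<Rightarrow> ('a, 'e) conn \<Rightarrow> ('a, 'e) tm_field \<Rightarrow>
   ('a, 'e) tm_field \<Rightarrow> ('a, 'e) pi_field \<Rightarrow> ('a, 'e) pi_field" where
  "curvature A D B C Z =
     - cov A D B (cov A D C Z) + cov A D C (cov A D B Z) + cov A D (bracket A B C) Z"

definition Q_tor ::
  "('a, 'e::euclidean_space) chart set \<Rightarrow> ('a, 'e) conn \<Rightarrow> ('a, 'e) pi_field \<Rightarrow>
   ('a, 'e) pi_field \<Rightarrow> ('a, 'e) pi_field" where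
  "Q_tor A D X Y = torsion A D (beta_field A D X) (beta_field A D Y)"

definition T_tor ::
  "('a, 'e::euclidean_space) chart set \<Rightarrow> ('a, 'e) conn \<Rightarrow> ('a, 'e) pi_field \<Rightarrow>
   ('a, 'e) pi_field \<Rightarrow> ('a, 'e) pi_field" where
  "T_tor A D X Y = torsion A D (gamma_field A X) (beta_field A D Y)"

definition R_curv ::
  "('a, 'e::euclidean_space) chart set \<Rightarrow> ('a, 'e) conn \<Rightarrow> ('a, 'e) pi_field \<Rightarrow>
   ('a, 'e) pi_field \<Rightarrow> ('a, 'e) pi_field \<Rightarrow> ('a, 'e) pi_field" where
  "R_curv A D X Y Z = curvature A D (beta_field A D X) (beta_field A D Y) Z"

definition P_curv ::
  "('a, 'e::euclidean_space) chart set \<Rightarrow> ('a, 'e) conn \<Rightarrow> ('a, 'e) pi_field \<Rightarrow>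
   ('a, 'e) pi_field \<Rightarrow> ('a, 'e) pi_field \<Rightarrow> ('a, 'e) pi_field" where
  "P_curv A D X Y Z = curvature A D (beta_field A D X) (gamma_field A Y) Z"

definition S_curv ::
  "('a, 'e::euclidean_space) chart set \<Rightarrow> ('a, 'e) conn \<Rightarrow> ('a, 'e) pi_field \<Rightarrow>
   ('a, 'e) pi_field \<Rightarrow> ('a, 'e) pi_field \<Rightarrow> ('a, 'e) pi_field" where
  "S_curv A D X Y Z = curvature A D (gamma_field A X) (gamma_field A Y) Z"

definition R_hat ::
  "('a, 'e::euclidean_space) chart set \<Rightarrow> ('a, 'e) conn \<Rightarrow> ('a, 'e) pi_field \<Rightarrow>
   ('a, 'e) pi_field \<Rightarrow> ('a, 'e) pi_field" where
  "R_hat A D X Y = R_curv A D X Y (eta A)"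

definition P_hat ::
  "('a, 'e::euclidean_space) chart set \<Rightarrow> ('a, 'e) conn \<Rightarrow> ('a, 'e) pi_field \<Rightarrow>
   ('a, 'e) pi_field \<Rightarrow> ('a, 'e) pi_field" where
  "P_hat A D X Y = P_curv A D X Y (eta A)"

definition cov_metric ::
  "('a, 'e::euclidean_space) chart set \<Rightarrow> (('a, 'e) tm \<Rightarrow> real) \<Rightarrow> ('a, 'e) conn \<Rightarrow>
   ('a, 'e) tm_field \<Rightarrow> ('a, 'e) pi_field \<Rightarrow> ('a, 'e) pi_field \<Rightarrow> ('a, 'e) tm \<Rightarrow> real" where
  "cov_metric A L D B Y Z = (\<lambda>u.
     deriv_along A B (metric_fun L Y Z) u
     - metric_fun L (cov A D B Y) Z u - metric_fun L Y (cov A D B Z) u)"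

definition cov_scalar3 ::
  "('a, 'e::euclidean_space) chart set \<Rightarrow> ('a, 'e) conn \<Rightarrow> ('a, 'e) tm_field \<Rightarrow>
   (('a, 'e) pi_field \<Rightarrow> ('a, 'e) pi_field \<Rightarrow> ('a, 'e) pi_field \<Rightarrow> ('a, 'e) tm \<Rightarrow> real) \<Rightarrow>
   ('a, 'e) pi_field \<Rightarrow> ('a, 'e) pi_field \<Rightarrow> ('a, 'e) pi_field \<Rightarrow> ('a, 'e) tm \<Rightarrow> real" where
  "cov_scalar3 A D B F X Y Z = (\<lambda>u.
     deriv_along A B (F X Y Z) u
     - F (cov A D B X) Y Z u - F X (cov A D B Y) Z u - F X Y (cov A D B Z) u)"

definition cov_vector3 ::
  "('a, 'e::euclidean_space) chart set \<Rightarrow> ('a, 'e) conn \<Rightarrow> ('a, 'e) tm_field \<Rightarrow>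
   (('a, 'e) pi_field \<Rightarrow> ('a, 'e) pi_field \<Rightarrow> ('a, 'e) pi_field \<Rightarrow> ('a, 'e) pi_field) \<Rightarrow>
   ('a, 'e) pi_field \<Rightarrow> ('a, 'e) pi_field \<Rightarrow> ('a, 'e) pi_field \<Rightarrow> ('a, 'e) pi_field" where
  "cov_vector3 A D B F X Y Z =
     cov A D B (F X Y Z) - F (cov A D B X) Y Z - F X (cov A D B Y) Z - F X Y (cov A D B Z)"

definition T_symmetric ::
  "('a, 'e::euclidean_space) chart set \<Rightarrow> (('a, 'e) tm \<Rightarrow> real) \<Rightarrow> ('a, 'e) conn \<Rightarrow> bool" where
  "T_symmetric A L D \<longleftrightarrow>
     (\<forall>X\<in>pi_fields A. \<forall>Y\<in>pi_fields A. \<forall>Z\<in>pi_fields A. \<forall>u\<in>slit A.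
        metric_fun L (T_tor A D X Y) Z u = metric_fun L (T_tor A D X Z) Y u)"

definition cartan_connection ::
  "('a, 'e::euclidean_space) chart set \<Rightarrow> (('a, 'e) tm \<Rightarrow> real) \<Rightarrow> ('a, 'e) conn \<Rightarrow> bool" where
  "cartan_connection A L D \<longleftrightarrow>
     regular_connection A D \<and>
     (\<forall>B\<in>tm_fields A. \<forall>Y\<in>pi_fields A. \<forall>Z\<in>pi_fields A. \<forall>u\<in>slit A.
        cov_metric A L D B Y Z u = 0) \<and>
     (\<forall>X\<in>pi_fields A. \<forall>Y\<in>pi_fields A. Q_tor A D X Y = 0) \<and>
     T_symmetric A L D"

definition hashiguchi_connection ::
  "('a, 'e::euclidean_space) chart set \<Rightarrow> (('a, 'e) tm \<Rightarrow> real) \<Rightarrow> ('a, 'e) conn \<Rightarrow> bool" where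
  "hashiguchi_connection A L D \<longleftrightarrow>
     regular_connection A D \<and>
     (\<forall>X\<in>pi_fields A. \<forall>Y\<in>pi_fields A. \<forall>Z\<in>pi_fields A. \<forall>u\<in>slit A.
        cov_metric A L D (gamma_field A X) Y Z u = 0) \<and>
     T_symmetric A L D \<and>
     (\<forall>X\<in>pi_fields A. \<forall>Y\<in>pi_fields A. Q_tor A D X Y = 0) \<and>
     (\<forall>X\<in>pi_fields A. \<forall>Y\<in>pi_fields A. P_hat A D X Y = 0) \<and>
     (\<forall>B\<in>tm_fields A. \<forall>u\<in>slit A. deriv_along A (beta_field A D (rho_field A B)) L u = 0)"


section \<open>The Barthel connection\<close>

definition dJ_energy ::
  "('a, 'e::euclidean_space) chart set \<Rightarrow> (('a, 'e) tm \<Rightarrow> real) \<Rightarrow> ('a, 'e) tm_field \<Rightarrow>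
   ('a, 'e) tm \<Rightarrow> real" where
  "dJ_energy A L B = deriv_along A (J_field A B) (energy L)"

text \<open>\<open>d\<theta>(B,C) = B(\<theta>(C)) - C(\<theta>(B)) - \<theta>([B,C])\<close>, without a factor 1/2.\<close>

definition ddJ_energy ::
  "('a, 'e::euclidean_space) chart set \<Rightarrow> (('a, 'e) tm \<Rightarrow> real) \<Rightarrow> ('a, 'e) tm_field \<Rightarrow>
   ('a, 'e) tm_field \<Rightarrow> ('a, 'e) tm \<Rightarrow> real" where
  "ddJ_energy A L B C = (\<lambda>u.
     deriv_along A B (dJ_energy A L C) u - deriv_along A C (dJ_energy A L B) u
     - dJ_energy A L (bracket A B C) u)"

definition canonical_spray ::
  "('a, 'e::euclidean_space) chart set \<Rightarrow> (('a, 'e) tm \<Rightarrow> real) \<Rightarrow> ('a, 'e) tm_field \<Rightarrow> bool" where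
  "canonical_spray A L G \<longleftrightarrow>
     G \<in> tm_fields A \<and>
     (\<forall>B\<in>tm_fields A. \<forall>u\<in>slit A. ddJ_energy A L G B u = - deriv_along A B (energy L) u)"

definition barthel ::
  "('a, 'e::euclidean_space) chart set \<Rightarrow> ('a, 'e) tm_field \<Rightarrow> ('a, 'e) tm_field \<Rightarrow>
   ('a, 'e) tm_field" where
  "barthel A G B = bracket A (J_field A B) G - J_field A (bracket A B G)"

definition barthel_h ::
  "('a, 'e::euclidean_space) chart set \<Rightarrow> ('a, 'e) tm_field \<Rightarrow> ('a, 'e) tm_field \<Rightarrow>
   ('a, 'e) tm_field" where
  "barthel_h A G B = (1/2) *\<^sub>R (B + barthel A G B)"

definition barthel_v ::
  "('a, 'e::euclidean_space) chart set \<Rightarrow> ('a, 'e) tm_field \<Rightarrow> ('a, 'e) tm_field \<Rightarrow>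
   ('a, 'e) tm_field" where
  "barthel_v A G B = (1/2) *\<^sub>R (B - barthel A G B)"

definition barthel_curvature ::
  "('a, 'e::euclidean_space) chart set \<Rightarrow> ('a, 'e) tm_field \<Rightarrow> ('a, 'e) tm_field \<Rightarrow>
   ('a, 'e) tm_field \<Rightarrow> ('a, 'e) tm_field" where
  "barthel_curvature A G B C =
     - barthel_v A G (bracket A (barthel_h A G B) (barthel_h A G C))"


section \<open>Cyclic and alternating sums\<close>

definition cyclic_sum :: "('x \<Rightarrow> 'x \<Rightarrow> 'x \<Rightarrow> 'b::ab_group_add) \<Rightarrow> 'x \<Rightarrow> 'x \<Rightarrow> 'x \<Rightarrow> 'b" where
  "cyclic_sum F X Y Z = F X Y Z + F Y Z X + F Z X Y"

definition alt_sum :: "('x \<Rightarrow> 'x \<Rightarrow> 'b::ab_group_add) \<Rightarrow> 'x \<Rightarrow> 'x \<Rightarrow> 'b" where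
  "alt_sum F X Y = F X Y - F Y X"

end

theory Submission
  imports Defs
begin

text \<open>
  The fibre derivative \<open>\<partial>\<^sub>X Y = \<rho>[\<gamma>X, B]\<close> with \<open>\<rho>B = Y\<close> is flat and torsion-free, and
  \<open>g(X,Y) = \<gamma>X(\<gamma>Y E) - \<gamma>(\<partial>\<^sub>X Y) E\<close>. Vertical metricity and the symmetry of the torsion give
  \<open>2 g(T(X,Y),Z) = (\<partial>\<^sub>X g)(Y,Z)\<close>, which is totally symmetric and vanishes on \<open>\<eta>\<close>; hence \<open>T\<^sup>* = T\<close> and
  \<open>K \<circ> \<gamma> = id\<close>, so every field splits as \<open>B = \<beta>\<rho>B + \<gamma>KB\<close>, and
  \<open>[\<beta>X, \<gamma>Y] = -\<beta>(\<partial>\<^sub>Y X) + \<gamma>(D\<^bsub>\<beta>X\<^esub> Y + Ph(X,Y))\<close>, where \<open>Ph\<close> is the (v)hv-torsion of \<open>D\<close>.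

  Both horizontal lifts preserve \<open>E\<close>, so both send \<open>\<eta>\<close> to the canonical spray. For the Cartan
  connection \<open>Ph(\<eta>,Y) = 0\<close>, by the Bianchi identity paired with \<open>\<eta>\<close> and metricity. Thus both lifts
  are the Barthel one, and the splitting of \<open>[\<beta>X, \<gamma>Y]\<close> yields \<open>D\<^sup>*\<^bsub>\<beta>X\<^esub> Y = \<nabla>\<^bsub>\<beta>X\<^esub> Y + Ph(X,Y)\<close>.
  Moreover \<open>Ph = \<nabla>\<^bsub>\<beta>\<eta>\<^esub> T\<close>, so that \<open>\<nabla>g = 0\<close> turns into \<open>(D\<^sup>*\<^bsub>\<beta>X\<^esub> g)(Y,Z) = -2 g(Ph(X,Y),Z)\<close>,
  from which (b) follows by applying the curvature to \<open>g\<close>. Parts (d) to (f) are Jacobi identities, and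
  (g) is (f) at \<open>X = \<eta>\<close>, where \<open>S(X,\<eta>)\<close> and \<open>P\<^sup>*(X,\<eta>)\<close> vanish by homogeneity.
\<close>

section \<open>Calculus of smooth maps\<close>

text \<open>Two difficulties shape the proof. A connection acts on global smooth sections only, and
  regularity is a pointwise condition, so neither local frames nor smoothness of the horizontal lift
  come for free. Frames are cut off by bump functions, which is where the Hausdorff property enters.
  For smoothness, the lift of X is compared with some smooth field over X: the difference is the
  vertical lift of the solution of a linear system with smooth coefficients. Such a field,
  independent of any connection, is [\<gamma>X, G] with G the canonical spray. That \<beta>\<eta> is
  G follows by writing G = \<beta>\<eta> + \<gamma>Y and evaluating the spray equation on \<beta>Y:
  conservation of energy leaves g(Y,Y) = 0. The Barthel connection is then computed from
  \<beta>\<eta> = G and Ph(\<eta>,Y) = 0 alone. Both connections satisfy these two conditions, the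
  Hashiguchi connection having Ph = 0 by definition, so their lifts agree although nothing is
  assumed to link them.\<close>

abbreviation "fderiv f x \<equiv> frechet_derivative f (at x)"

section \<open>Functions of class C^k and smooth maps on open sets\<close>

lemma Ck_on_cong:
  assumes "open S" "\<And>x. x \<in> S \<Longrightarrow> f x = g x" "Ck_on k S f"
  shows "Ck_on k S g"
  using assms(2,3)
proof (induction k arbitrary: f g)
  case 0
  then show ?case by (simp cong: continuous_on_cong)
next
  case (Suc k)
  have fd: "(f has_derivative fderiv f x) (at x)" if "x \<in> S" for x
    using Suc.prems(2) that by (simp add: frechet_derivative_works)
  have gd: "(g has_derivative fderiv f x) (at x)" if "x \<in> S" for x
    using has_derivative_transform_within_open[OF fd[OF that] assms(1) that] Suc.prems(1) by blast
  have eq: "fderiv f x = fderiv g x" if "x \<in> S" for x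
    using frechet_derivative_at[OF gd[OF that]] .
  have "Ck_on k S (\<lambda>x. fderiv g x v)" for v
    by (rule Suc.IH[of "\<lambda>x. fderiv f x v"]) (use eq Suc.prems in auto)
  then show ?case using gd by (auto simp: differentiable_def)
qed

text \<open>Lets an explicit derivative replace the one that \<open>frechet_derivative\<close> picks
  by choice; the closure proofs below enter the successor case through it.\<close>

lemma Ck_on_SucI:
  assumes "open S" "\<And>x. x \<in> S \<Longrightarrow> (f has_derivative f' x) (at x)" "\<And>v. Ck_on k S (\<lambda>x. f' x v)"
  shows "Ck_on (Suc k) S f"
proof -
  have "Ck_on k S (\<lambda>x. fderiv f x v)" for v
    by (rule Ck_on_cong[OF assms(1) _ assms(3)[of v]])
      (metis frechet_derivative_at[OF assms(2)])
  then show ?thesis using assms(2) by (auto simp: differentiable_def)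
qed

lemma Ck_on_Suc_imp: "Ck_on (Suc k) S f \<Longrightarrow> Ck_on k S f"
proof (induction k arbitrary: f)
  case 0
  then have "f differentiable at x within S" if "x \<in> S" for x
    using that by (simp add: differentiable_at_withinI)
  then show ?case
    by (simp add: continuous_on_eq_continuous_within differentiable_imp_continuous_within)
next
  case (Suc k)
  from Suc.prems have "Ck_on k S (\<lambda>x. fderiv f x v)" for v
    by (intro Suc.IH) simp
  with Suc.prems show ?case by simp
qed

lemma Ck_on_subset: "Ck_on k S f \<Longrightarrow> T \<subseteq> S \<Longrightarrow> Ck_on k T f"
proof (induction k arbitrary: f)
  case 0
  then show ?case using continuous_on_subset by auto
next
  case (Suc k)
  then have "Ck_on k T (\<lambda>x. fderiv f x v)" for v
    by (intro Suc.IH) simp_all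
  with Suc.prems show ?case by auto
qed

lemma Ck_on_local:
  assumes "\<And>x. x \<in> S \<Longrightarrow> \<exists>U. open U \<and> x \<in> U \<and> Ck_on k U f"
  shows "Ck_on k S f"
  using assms
proof (induction k arbitrary: f)
  case 0
  then show ?case
    by (auto simp: continuous_on_eq_continuous_within)
      (metis continuous_on_eq_continuous_at continuous_on_eq_continuous_within continuous_at_imp_continuous_within)
next
  case (Suc k)
  have "f differentiable at x" if "x \<in> S" for x
    using Suc.prems[OF that] by auto
  moreover have "Ck_on k S (\<lambda>x. fderiv f x v)" for v
    by (rule Suc.IH) (use Suc.prems in fastforce)
  ultimately show ?case by auto
qed

lemma Ck_on_const: "Ck_on k S (\<lambda>x. c)"
  by (induction k arbitrary: c) auto

lemma Ck_on_linear:
  assumes "bounded_linear h"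
  shows "Ck_on k S h"
proof (cases k)
  case 0
  then show ?thesis using assms by (simp add: linear_continuous_on)
next
  case (Suc j)
  have "(h has_derivative h) (at x)" for x
    using assms by (rule bounded_linear_imp_has_derivative)
  then have "h differentiable at x" "fderiv h x = h" for x
    by (auto simp: differentiable_def frechet_derivative_at[symmetric])
  then show ?thesis by (simp add: Suc Ck_on_const)
qed

lemma Ck_on_has_derivative:
  "Ck_on (Suc k) S f \<Longrightarrow> x \<in> S \<Longrightarrow> (f has_derivative fderiv f x) (at x)"
  by (simp add: frechet_derivative_works)

lemma Ck_on_linear_compose:
  assumes "open S" "bounded_linear h" "Ck_on k S f"
  shows "Ck_on k S (\<lambda>x. h (f x))"
  using assms(3)
proof (induction k arbitrary: f)
  case 0
  then show ?case using assms(2) by (auto intro: bounded_linear.continuous_on)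
next
  case (Suc k)
  show ?case
    by (rule Ck_on_SucI[OF assms(1), where f' = "\<lambda>x v. h (fderiv f x v)"])
      (use Suc bounded_linear.has_derivative[OF assms(2) Ck_on_has_derivative[OF Suc.prems]] in auto)
qed

lemma Ck_on_add:
  assumes "open S" "Ck_on k S f" "Ck_on k S g"
  shows "Ck_on k S (\<lambda>x. f x + g x)"
  using assms(2,3)
proof (induction k arbitrary: f g)
  case 0
  then show ?case by (auto intro: continuous_on_add)
next
  case (Suc k)
  show ?case
    by (rule Ck_on_SucI[OF assms(1),
          where f' = "\<lambda>x v. fderiv f x v + fderiv g x v"])
      (use Suc in \<open>auto intro!: has_derivative_add simp: frechet_derivative_works[symmetric]\<close>)
qed

lemma Ck_on_sum:
  assumes "open S" "\<And>i. i \<in> I \<Longrightarrow> Ck_on k S (f i)"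
  shows "Ck_on k S (\<lambda>x. \<Sum>i\<in>I. f i x)"
  using assms(2)
  by (induction I rule: infinite_finite_induct) (auto simp: Ck_on_const intro!: Ck_on_add assms(1))

text \<open>Both terms of the product rule are again bilinear expressions in functions of class C^k,
  so the induction has to run over all pairs \<open>f\<close>, \<open>g\<close>.\<close>

lemma Ck_on_bilinear:
  assumes "bounded_bilinear b" "open S" "Ck_on k S f" "Ck_on k S g"
  shows "Ck_on k S (\<lambda>x. b (f x) (g x))"
  using assms(3,4)
proof (induction k arbitrary: f g)
  case 0
  then show ?case using bounded_bilinear.continuous_on[OF assms(1)] by auto
next
  case (Suc k)
  show ?case
  proof (rule Ck_on_SucI[OF assms(2)])
    fix x assume "x \<in> S"
    show "((\<lambda>x. b (f x) (g x)) has_derivative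
        (\<lambda>v. b (f x) (fderiv g x v) + b (fderiv f x v) (g x))) (at x)"
      by (rule bounded_bilinear.FDERIV[OF assms(1)])
        (use Ck_on_has_derivative Suc.prems \<open>x \<in> S\<close> in blast)+
  next
    fix v
    show "Ck_on k S (\<lambda>x. b (f x) (fderiv g x v) + b (fderiv f x v) (g x))"
      using Suc.prems Ck_on_Suc_imp[OF Suc.prems(1)] Ck_on_Suc_imp[OF Suc.prems(2)]
      by (intro Ck_on_add assms(2) Suc.IH) auto
  qed
qed

lemma Ck_on_Pair:
  assumes "open S" "Ck_on k S f" "Ck_on k S g"
  shows "Ck_on k S (\<lambda>x. (f x, g x))"
proof -
  have "Ck_on k S (\<lambda>x. (f x, 0) + (0, g x))"
    by (intro Ck_on_add assms(1) Ck_on_linear_compose[OF _ _ assms(2), where h = "\<lambda>x. (x, 0)"]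
        Ck_on_linear_compose[OF _ _ assms(3), where h = "\<lambda>x. (0, x)"] bounded_linear_Pair
        bounded_linear_ident bounded_linear_zero)
  then show ?thesis by simp
qed

lemma linear_euclidean_sum:
  fixes h :: "'a::euclidean_space \<Rightarrow> 'b::real_vector"
  assumes "linear h"
  shows "h v = (\<Sum>b\<in>Basis. (v \<bullet> b) *\<^sub>R h b)"
proof -
  have "h v = h (\<Sum>b\<in>Basis. (v \<bullet> b) *\<^sub>R b)" by (simp add: euclidean_representation)
  then show ?thesis using assms by (simp add: linear_sum linear_scale)
qed

text \<open>Expanding \<open>g x\<close> in the standard basis leaves finitely many products with
  \<open>F x b\<close> for fixed \<open>b\<close>. This avoids derivatives with values in a space of
  linear maps, since \<open>Ck_on\<close> only speaks about directional derivatives.\<close>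

lemma Ck_on_derivative_apply:
  fixes F :: "'a::euclidean_space \<Rightarrow> 'b::euclidean_space \<Rightarrow> 'c::real_normed_vector"
  assumes "open S" "\<And>x. x \<in> S \<Longrightarrow> linear (F x)" "\<And>b. Ck_on k S (\<lambda>x. F x b)" "Ck_on k S g"
  shows "Ck_on k S (\<lambda>x. F x (g x))"
proof (rule Ck_on_cong[OF assms(1)])
  show "Ck_on k S (\<lambda>x. \<Sum>b\<in>Basis. (g x \<bullet> b) *\<^sub>R F x b)"
    by (intro Ck_on_sum Ck_on_bilinear[OF bounded_bilinear_scaleR] assms
        Ck_on_linear_compose[where h = "\<lambda>y. y \<bullet> _"] bounded_linear_inner_left)
qed (use assms(2) linear_euclidean_sum in metis)

text \<open>The chain rule produces a derivative of \<open>f\<close> in a direction that varies with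
  the point; \<open>Ck_on_derivative_apply\<close> reduces it to fixed directions, where the
  induction hypothesis applies.\<close>

lemma Ck_on_compose:
  fixes f :: "'b::euclidean_space \<Rightarrow> 'c::real_normed_vector" and g :: "'a::euclidean_space \<Rightarrow> 'b"
  assumes "open S" "open T" "Ck_on k T f" "Ck_on k S g" "g ` S \<subseteq> T"
  shows "Ck_on k S (\<lambda>x. f (g x))"
  using assms(3,4)
proof (induction k arbitrary: f)
  case 0
  then show ?case using assms(5) by (auto intro: continuous_on_compose2)
next
  case (Suc k)
  have gT: "g x \<in> T" if "x \<in> S" for x using that assms(5) by auto
  have fd: "(f has_derivative fderiv f (g x)) (at (g x))" if "x \<in> S" for x
    using Ck_on_has_derivative[OF Suc.prems(1) gT[OF that]] .
  show ?case
  proof (rule Ck_on_SucI[OF assms(1)])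
    fix x assume "x \<in> S"
    show "((\<lambda>x. f (g x)) has_derivative
        (\<lambda>v. fderiv f (g x) (fderiv g x v))) (at x)"
      by (rule has_derivative_compose[OF Ck_on_has_derivative[OF Suc.prems(2) \<open>x \<in> S\<close>] fd[OF \<open>x \<in> S\<close>]])
  next
    fix v
    show "Ck_on k S (\<lambda>x. fderiv f (g x) (fderiv g x v))"
    proof (rule Ck_on_derivative_apply[OF assms(1)])
      show "linear (fderiv f (g x))" if "x \<in> S" for x
        using has_derivative_linear[OF fd[OF that]] .
      show "Ck_on k S (\<lambda>x. fderiv f (g x) b)" for b
        by (rule Suc.IH) (use Suc.prems Ck_on_Suc_imp in auto)
      show "Ck_on k S (\<lambda>x. fderiv g x v)"
        using Suc.prems by auto
    qed
  qed
qed

lemma smooth_on_Ck: "smooth_on S f \<Longrightarrow> Ck_on k S f"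
  by (simp add: smooth_on_def)

lemma smooth_on_cong: "open S \<Longrightarrow> (\<And>x. x \<in> S \<Longrightarrow> f x = g x) \<Longrightarrow> smooth_on S f \<Longrightarrow> smooth_on S g"
  unfolding smooth_on_def using Ck_on_cong by blast

lemma smooth_on_subset: "smooth_on S f \<Longrightarrow> T \<subseteq> S \<Longrightarrow> smooth_on T f"
  unfolding smooth_on_def using Ck_on_subset by blast

lemma smooth_on_local:
  assumes "\<And>x. x \<in> S \<Longrightarrow> \<exists>U. open U \<and> x \<in> U \<and> smooth_on U f"
  shows "smooth_on S f"
  unfolding smooth_on_def using assms by (intro allI Ck_on_local) (meson smooth_on_Ck)

lemma smooth_on_const: "smooth_on S (\<lambda>x. c)"
  by (simp add: smooth_on_def Ck_on_const)

lemma smooth_on_linear: "bounded_linear h \<Longrightarrow> smooth_on S h"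
  by (simp add: smooth_on_def Ck_on_linear)

lemma smooth_on_linear_compose:
  "open S \<Longrightarrow> bounded_linear h \<Longrightarrow> smooth_on S f \<Longrightarrow> smooth_on S (\<lambda>x. h (f x))"
  by (simp add: smooth_on_def Ck_on_linear_compose)

lemma smooth_on_add: "open S \<Longrightarrow> smooth_on S f \<Longrightarrow> smooth_on S g \<Longrightarrow> smooth_on S (\<lambda>x. f x + g x)"
  by (simp add: smooth_on_def Ck_on_add)

lemma smooth_on_bilinear:
  "bounded_bilinear b \<Longrightarrow> open S \<Longrightarrow> smooth_on S f \<Longrightarrow> smooth_on S g \<Longrightarrow> smooth_on S (\<lambda>x. b (f x) (g x))"
  by (simp add: smooth_on_def Ck_on_bilinear)

lemma smooth_on_scaleR:
  "open S \<Longrightarrow> smooth_on S f \<Longrightarrow> smooth_on S g \<Longrightarrow> smooth_on S (\<lambda>x. f x *\<^sub>R g x)"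
  by (rule smooth_on_bilinear[OF bounded_bilinear_scaleR])

lemma smooth_on_cscaleR: "open S \<Longrightarrow> smooth_on S f \<Longrightarrow> smooth_on S (\<lambda>x. r *\<^sub>R f x)"
  by (rule smooth_on_linear_compose[OF _ bounded_linear_scaleR_right])

lemma smooth_on_minus: "open S \<Longrightarrow> smooth_on S f \<Longrightarrow> smooth_on S (\<lambda>x. - f x)"
  using smooth_on_cscaleR[of S f "-1"] by simp

lemma smooth_on_diff: "open S \<Longrightarrow> smooth_on S f \<Longrightarrow> smooth_on S g \<Longrightarrow> smooth_on S (\<lambda>x. f x - g x)"
  using smooth_on_add[of S f "\<lambda>x. - g x"] smooth_on_minus[of S g] by simp

lemma smooth_on_Pair: "open S \<Longrightarrow> smooth_on S f \<Longrightarrow> smooth_on S g \<Longrightarrow> smooth_on S (\<lambda>x. (f x, g x))"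
  by (simp add: smooth_on_def Ck_on_Pair)

lemma smooth_on_compose:
  fixes f :: "'b::euclidean_space \<Rightarrow> 'c::real_normed_vector" and g :: "'a::euclidean_space \<Rightarrow> 'b"
  shows "open S \<Longrightarrow> open T \<Longrightarrow> smooth_on T f \<Longrightarrow> smooth_on S g \<Longrightarrow> g ` S \<subseteq> T \<Longrightarrow>
    smooth_on S (\<lambda>x. f (g x))"
  by (simp add: smooth_on_def Ck_on_compose)

lemma smooth_on_has_derivative:
  "smooth_on S f \<Longrightarrow> x \<in> S \<Longrightarrow> (f has_derivative fderiv f x) (at x)"
  using Ck_on_has_derivative smooth_on_Ck by blast

lemma smooth_on_linear_frechet:
  "smooth_on S f \<Longrightarrow> x \<in> S \<Longrightarrow> linear (fderiv f x)"
  using smooth_on_has_derivative has_derivative_linear by blast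

lemma smooth_on_frechet: "smooth_on S f \<Longrightarrow> smooth_on S (\<lambda>x. fderiv f x v)"
  unfolding smooth_on_def
proof
  fix k assume "\<forall>k. Ck_on k S f"
  then have "Ck_on (Suc k) S f" by blast
  then show "Ck_on k S (\<lambda>x. fderiv f x v)" by simp
qed

lemma smooth_on_apply:
  fixes F :: "'a::euclidean_space \<Rightarrow> 'b::euclidean_space \<Rightarrow> 'c::real_normed_vector"
  shows "open S \<Longrightarrow> (\<And>x. x \<in> S \<Longrightarrow> linear (F x)) \<Longrightarrow> (\<And>b. smooth_on S (\<lambda>x. F x b)) \<Longrightarrow>
    smooth_on S g \<Longrightarrow> smooth_on S (\<lambda>x. F x (g x))"
  by (simp add: smooth_on_def Ck_on_derivative_apply)

lemma smooth_on_frechet_apply: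
  fixes f :: "'a::euclidean_space \<Rightarrow> 'b::real_normed_vector"
  assumes "open S" "smooth_on S f" "smooth_on S g"
  shows "smooth_on S (\<lambda>x. fderiv f x (g x))"
  by (rule smooth_on_apply[OF assms(1) _ _ assms(3)])
    (rule smooth_on_linear_frechet[OF assms(2)] smooth_on_frechet[OF assms(2)], assumption?)+

lemma frechet_derivative_cong:
  assumes "open S" "x \<in> S" "\<And>y. y \<in> S \<Longrightarrow> f y = g y" "f differentiable at x"
  shows "fderiv f x = fderiv g x"
proof -
  have "(f has_derivative fderiv f x) (at x)"
    using assms(4) by (simp add: frechet_derivative_works)
  then have "(g has_derivative fderiv f x) (at x)"
    using has_derivative_transform_within_open assms by blast
  then show ?thesis by (rule frechet_derivative_at)
qed

section \<open>Linear systems with smooth coefficients\<close>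

text \<open>Differentiating the system shows that the derivative of \<open>w\<close> solves a system
  with the same matrix and a right side of one class less. Hence the induction on \<open>k\<close>
  for all right sides at once; no formula for the inverse matrix is differentiated.\<close>

lemma Ck_on_inverse_family:
  fixes F :: "'a::euclidean_space \<Rightarrow> 'e::euclidean_space \<Rightarrow> 'e"
  assumes S: "open S" and lin: "\<And>x. x \<in> S \<Longrightarrow> linear (F x)"
    and inj: "\<And>x v. x \<in> S \<Longrightarrow> F x v = 0 \<Longrightarrow> v = 0"
    and smooth: "\<And>b. smooth_on S (\<lambda>x. F x b)"
    and w: "\<And>x. x \<in> S \<Longrightarrow> F x (w x) = y x" and y: "Ck_on k S y"
  shows "Ck_on k S w"
  using w y
proof (induction k arbitrary: w y)
  case 0
  have Fw: "Ck_on 0 S (\<lambda>x. F x (w x))"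
    by (rule Ck_on_cong[OF S _ 0(2)]) (simp add: 0(1))
  show ?case unfolding Ck_on.simps(1) continuous_on_eq_continuous_within
  proof
    fix x0 assume x0: "x0 \<in> S"
    obtain N where N: "linear N" "\<And>v. N (F x0 v) = v"
      using linear_injective_left_inverse[OF lin[OF x0]] inj[OF x0] lin[OF x0]
      by (metis linear_injective_0 comp_apply id_apply)
    have bN: "bounded_linear N" using N(1) by (rule linear_conv_bounded_linear[THEN iffD1])
    \<comment> \<open>A bound for the operator norm of \<open>N \<circ> F x\<close> minus the
      identity, which vanishes at \<open>x0\<close> because \<open>N\<close> inverts
      \<open>F x0\<close>.\<close>
    define r where "r x = (\<Sum>b\<in>Basis. norm (N (F x b - F x0 b)))" for x
    have Fc: "continuous_on S (\<lambda>x. F x b)" for b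
      using smooth_on_Ck[OF smooth, of 0] by simp
    have rc: "continuous_on S r"
      unfolding r_def by (intro continuous_intros bounded_linear.continuous_on[OF bN] Fc)
    have est: "norm (w x - N (F x (w x))) \<le> r x * norm (w x)" if "x \<in> S" for x
    proof -
      have lD: "linear (\<lambda>v. F x v - F x0 v)"
        using lin[OF that] lin[OF x0] by (rule linear_compose_sub)
      have "w x - N (F x (w x)) = - N (F x (w x) - F x0 (w x))"
        using N by (simp add: linear_diff)
      also have "F x (w x) - F x0 (w x) = (\<Sum>b\<in>Basis. (w x \<bullet> b) *\<^sub>R (F x b - F x0 b))"
        using linear_euclidean_sum[OF lD] .
      finally have "norm (w x - N (F x (w x))) = norm (\<Sum>b\<in>Basis. (w x \<bullet> b) *\<^sub>R N (F x b - F x0 b))"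
        using N(1) by (simp add: linear_sum linear_scale)
      also have "\<dots> \<le> (\<Sum>b\<in>Basis. norm (w x) * norm (N (F x b - F x0 b)))"
        by (rule sum_norm_le) (auto intro!: mult_right_mono Basis_le_norm)
      finally show ?thesis by (simp add: r_def sum_distrib_left mult.commute)
    qed
    have "continuous_on S (\<lambda>x. N (F x (w x)))"
      using Fw bounded_linear.continuous_on[OF bN] by simp
    then have "((\<lambda>x. N (F x (w x))) \<longlongrightarrow> N (F x0 (w x0))) (at x0 within S)"
      using x0 unfolding continuous_on_def by blast
    then have NFt: "((\<lambda>x. N (F x (w x))) \<longlongrightarrow> w x0) (at x0 within S)"
      by (simp only: N(2))
    have rt: "(r \<longlongrightarrow> 0) (at x0 within S)"
    proof -
      have "(r \<longlongrightarrow> r x0) (at x0 within S)"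
        using rc x0 unfolding continuous_on_def by blast
      then show ?thesis by (simp add: r_def linear_0[OF N(1)])
    qed
    \<comment> \<open>Below 1/2 the error \<open>r x * norm (w x)\<close> is absorbed into the left
      side. This bounds \<open>w\<close> near \<open>x0\<close>, where no bound is known
      beforehand.\<close>
    have small: "eventually (\<lambda>x. r x < 1/2) (at x0 within S)"
      using rt by (rule order_tendstoD) simp
    have inS: "eventually (\<lambda>x. x \<in> S) (at x0 within S)"
      by (simp add: eventually_at_filter)
    have bd: "eventually (\<lambda>x. norm (w x - N (F x (w x))) \<le> r x * (2 * norm (N (F x (w x))))) (at x0 within S)"
      using small inS
    proof eventually_elim
      case (elim x)
      have r0: "0 \<le> r x" by (simp add: r_def sum_nonneg)
      have "norm (w x) \<le> norm (N (F x (w x))) + norm (w x - N (F x (w x)))"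
        by (metis add.commute diff_add_cancel norm_triangle_ineq)
      also have "\<dots> \<le> norm (N (F x (w x))) + r x * norm (w x)" using est[OF elim(2)] by simp
      also have "r x * norm (w x) \<le> 1/2 * norm (w x)" using elim(1) by (intro mult_right_mono) auto
      finally have "norm (w x) \<le> 2 * norm (N (F x (w x)))" by simp
      then show ?case using est[OF elim(2)] r0 by (meson mult_left_mono order_trans)
    qed
    have "((\<lambda>x. r x * (2 * norm (N (F x (w x))))) \<longlongrightarrow> 0 * (2 * norm (w x0))) (at x0 within S)"
      by (intro tendsto_intros rt NFt)
    then have "((\<lambda>x. w x - N (F x (w x))) \<longlongrightarrow> 0) (at x0 within S)"
      using Lim_null_comparison[OF bd] by simp
    from tendsto_add[OF this NFt] show "continuous (at x0 within S) w"
      by (simp add: continuous_within)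
  qed
next
  case (Suc k)
  have yk: "Ck_on (Suc k) S y" by (rule Suc.prems)
  have wk: "Ck_on k S w" by (rule Suc.IH[OF Suc.prems(1) Ck_on_Suc_imp[OF yk]])
  have w0: "continuous_on S w"
    using wk by (induction k) (auto dest: Ck_on_Suc_imp simp del: Ck_on.simps(2))
  define F' where "F' x v u = (\<Sum>b\<in>Basis. (u \<bullet> b) *\<^sub>R fderiv (\<lambda>x. F x b) x v)" for x v u
  define inv where "inv x = (SOME N. linear N \<and> (\<forall>v. N (F x v) = v) \<and> (\<forall>v. F x (N v) = v))" for x
  have inv: "linear (inv x) \<and> (\<forall>v. inv x (F x v) = v) \<and> (\<forall>v. F x (inv x v) = v)" if x: "x \<in> S" for x
  proof -
    have i: "inj (F x)" using inj[OF x] lin[OF x] by (simp add: linear_injective_0)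
    obtain N where "linear N" "\<And>v. N (F x v) = v" "\<And>v. F x (N v) = v"
      using linear_injective_isomorphism[OF lin[OF x] i] by blast
    then show ?thesis unfolding inv_def by (rule_tac someI[of _ N]) auto
  qed
  have wd: "(w has_derivative (\<lambda>v. inv x0 (fderiv y x0 v - F' x0 v (w x0)))) (at x0)"
    if x0: "x0 \<in> S" for x0
  proof -
    have bl: "bounded_linear (inv x0)" using inv[OF x0] by (simp add: linear_conv_bounded_linear)
    have Fd: "((\<lambda>x. F x b) has_derivative fderiv (\<lambda>x. F x b) x0) (at x0)" for b
      by (rule smooth_on_has_derivative[OF smooth x0])
    have yd: "(y has_derivative fderiv y x0) (at x0)"
      by (rule Ck_on_has_derivative[OF yk x0])
    define q where "q = (\<lambda>x. \<Sum>b\<in>Basis. (w x \<bullet> b) *\<^sub>R (F x b - F x0 b))"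
    \<comment> \<open>Only continuity of \<open>w\<close> is available here. It suffices because the
      second factor vanishes at \<open>x0\<close>: the change of the coefficient is o(1) and is
      multiplied by something of order \<open>norm (x - x0)\<close>.\<close>
    have summand: "((\<lambda>x. (w x \<bullet> b) *\<^sub>R (F x b - F x0 b)) has_derivative
        (\<lambda>v. (w x0 \<bullet> b) *\<^sub>R fderiv (\<lambda>x. F x b) x0 v)) (at x0)" for b
    proof -
      let ?a = "\<lambda>x. w x \<bullet> b" and ?d = "\<lambda>x. F x b - F x0 b"
      have ac: "isCont ?a x0"
        using w0 x0 S by (auto simp: continuous_on_eq_continuous_at intro!: continuous_intros)
      have dd: "(?d has_derivative fderiv (\<lambda>x. F x b) x0) (at x0)"
        using has_derivative_diff[OF Fd has_derivative_const, of b "F x0 b"] by simp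
      have 1: "((\<lambda>x. ?a x0 *\<^sub>R ?d x) has_derivative
         (\<lambda>v. ?a x0 *\<^sub>R fderiv (\<lambda>x. F x b) x0 v)) (at x0)"
        by (rule bounded_linear.has_derivative[OF bounded_linear_scaleR_right dd])
      have 2: "((\<lambda>x. (?a x - ?a x0) *\<^sub>R ?d x) has_derivative (\<lambda>v. 0)) (at x0)"
      proof -
        obtain B where B: "eventually (\<lambda>x. norm (?d x) \<le> B * norm (x - x0)) (at x0)"
        proof -
          let ?D = "fderiv (\<lambda>x. F x b) x0"
          have "((\<lambda>x. norm (?d x - ?D (x - x0)) / norm (x - x0)) \<longlongrightarrow> 0) (at x0)"
            using dd by (simp add: has_derivative_iff_norm)
          then have ev: "eventually (\<lambda>x. norm (?d x - ?D (x - x0)) / norm (x - x0) < 1) (at x0)"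
            by (rule order_tendstoD) simp
          obtain K where K: "\<And>v. norm (?D v) \<le> norm v * K"
            using has_derivative_bounded_linear[OF dd] bounded_linear.bounded by blast
          have ne: "eventually (\<lambda>x. x \<noteq> x0) (at x0)" by (simp add: eventually_at_filter)
          have "eventually (\<lambda>x. norm (?d x) \<le> (1 + K) * norm (x - x0)) (at x0)"
            using ev ne
          proof eventually_elim
            case (elim x)
            then have "norm (?d x - ?D (x - x0)) < norm (x - x0)" by (simp add: field_simps)
            then show ?case
              using K[of "x - x0"] norm_triangle_ineq[of "?d x - ?D (x - x0)" "?D (x - x0)"]
              by (simp add: algebra_simps)
          qed
          then show ?thesis using that by blast
        qed
        have "((\<lambda>x. \<bar>?a x - ?a x0\<bar> * B) \<longlongrightarrow> \<bar>?a x0 - ?a x0\<bar> * B) (at x0)"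
          using ac unfolding isCont_def
          by (rule tendsto_mult_right[OF tendsto_rabs[OF tendsto_diff[OF _ tendsto_const]]])
        then have lim: "((\<lambda>x. \<bar>?a x - ?a x0\<bar> * B) \<longlongrightarrow> 0) (at x0)" by simp
        have ne: "eventually (\<lambda>x. x \<noteq> x0) (at x0)" by (simp add: eventually_at_filter)
        have "eventually (\<lambda>x. norm (norm ((?a x - ?a x0) *\<^sub>R ?d x) / norm (x - x0))
            \<le> \<bar>?a x - ?a x0\<bar> * B) (at x0)"
        proof (rule eventually_mono[OF eventually_conj[OF B ne]])
          fix x assume x: "norm (?d x) \<le> B * norm (x - x0) \<and> x \<noteq> x0"
          then have "\<bar>?a x - ?a x0\<bar> * norm (?d x) \<le> \<bar>?a x - ?a x0\<bar> * (B * norm (x - x0))"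
            by (intro mult_left_mono) auto
          then show "norm (norm ((?a x - ?a x0) *\<^sub>R ?d x) / norm (x - x0)) \<le> \<bar>?a x - ?a x0\<bar> * B"
            using x by (simp add: divide_simps mult.assoc)
        qed
        then have "((\<lambda>x. norm ((?a x - ?a x0) *\<^sub>R ?d x) / norm (x - x0)) \<longlongrightarrow> 0) (at x0)"
          by (rule Lim_null_comparison) (rule lim)
        then show ?thesis
          by (simp add: has_derivative_iff_norm)
      qed
      have "((\<lambda>x. ?a x0 *\<^sub>R ?d x + (?a x - ?a x0) *\<^sub>R ?d x) has_derivative
         (\<lambda>v. ?a x0 *\<^sub>R fderiv (\<lambda>x. F x b) x0 v + 0)) (at x0)"
        by (rule has_derivative_add) (rule 1, rule 2)
      then show ?thesis by (simp add: algebra_simps)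
    qed
    have qd: "(q has_derivative (\<lambda>v. F' x0 v (w x0))) (at x0)"
      unfolding q_def F'_def by (intro has_derivative_sum summand)
    have "((\<lambda>x. inv x0 (y x - q x)) has_derivative
        (\<lambda>v. inv x0 (fderiv y x0 v - F' x0 v (w x0)))) (at x0)"
      by (rule bounded_linear.has_derivative[OF bl has_derivative_diff[OF yd qd]])
    \<comment> \<open>The inverse is frozen at \<open>x0\<close>: since \<open>q x\<close> is
      exactly \<open>F x (w x) - F x0 (w x)\<close>, the solution is a fixed linear image of two
      functions already known to be differentiable at \<open>x0\<close>.\<close>
    moreover have "inv x0 (y x - q x) = w x" if x: "x \<in> S" for x
    proof -
      have "linear (\<lambda>v. F x v - F x0 v)"
        using lin[OF x] lin[OF x0] by (rule linear_compose_sub)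
      from linear_euclidean_sum[OF this, of "w x"] have "q x = F x (w x) - F x0 (w x)"
        by (simp add: q_def)
      then show ?thesis using inv[OF x0] Suc.prems(1)[OF x] by simp
    qed
    ultimately show ?thesis
      using has_derivative_transform_within_open[OF _ S x0] by blast
  qed
  show "Ck_on (Suc k) S w"
  proof (rule Ck_on_SucI[where f' = "\<lambda>x v. inv x (fderiv y x v - F' x v (w x))"])
    show "open S" by (rule S)
    show "(w has_derivative (\<lambda>v. inv x (fderiv y x v - F' x v (w x)))) (at x)"
      if "x \<in> S" for x by (rule wd[OF that])
    fix v
    have y': "Ck_on k S (\<lambda>x. fderiv y x v)" using yk by simp
    have F'k: "Ck_on k S (\<lambda>x. F' x v (w x))"
      unfolding F'_def
      by (intro Ck_on_sum Ck_on_bilinear[OF bounded_bilinear_scaleR] S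
          Ck_on_linear_compose[where h = "\<lambda>y. y \<bullet> _"] bounded_linear_inner_left wk)
        (use smooth_on_frechet[OF smooth] smooth_on_Ck in blast)
    let ?r = "\<lambda>x. fderiv y x v - F' x v (w x)"
    have r: "Ck_on k S ?r"
      using Ck_on_add[OF S y' Ck_on_linear_compose[OF S _ F'k, of uminus]]
      by (simp add: bounded_linear_minus bounded_linear_ident)
    \<comment> \<open>The directional derivative of \<open>w\<close> is itself a solution of the
      system, with right side \<open>?r\<close>, so the induction hypothesis applies to it.\<close>
    show "Ck_on k S (\<lambda>x. inv x (?r x))"
      by (rule Suc.IH[OF _ r]) (simp add: inv)
  qed
qed

lemma smooth_on_inverse_family:
  fixes F :: "'a::euclidean_space \<Rightarrow> 'e::euclidean_space \<Rightarrow> 'e"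
  assumes "open S" "\<And>x. x \<in> S \<Longrightarrow> linear (F x)" "\<And>x v. x \<in> S \<Longrightarrow> F x v = 0 \<Longrightarrow> v = 0"
    "\<And>b. smooth_on S (\<lambda>x. F x b)" "\<And>x. x \<in> S \<Longrightarrow> F x (w x) = y x" "smooth_on S y"
  shows "smooth_on S w"
  unfolding smooth_on_def 
proof
  fix k
  show "Ck_on k S w"
    using assms(1-5) smooth_on_Ck[OF assms(6)] by (rule Ck_on_inverse_family[where F = F and y = y])
qed

section \<open>Symmetry of second derivatives\<close>

text \<open>The mean value theorem is applied first in direction \<open>v\<close> to the difference
  of \<open>f\<close> along two parallel sides, then in direction \<open>w\<close> to the resulting
  first derivative.\<close>

lemma second_difference_mvt:
  fixes f :: "'a::euclidean_space \<Rightarrow> real"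
  assumes f: "smooth_on S f" and h: "0 < h"
    and seg: "\<And>s t. 0 \<le> s \<Longrightarrow> s \<le> h \<Longrightarrow> 0 \<le> t \<Longrightarrow> t \<le> h \<Longrightarrow> x + s *\<^sub>R v + t *\<^sub>R w \<in> S"
  obtains s t where "0 < s" "s < h" "0 < t" "t < h"
    "f (x + h *\<^sub>R v + h *\<^sub>R w) - f (x + h *\<^sub>R v) - f (x + h *\<^sub>R w) + f x =
      h\<^sup>2 * fderiv (\<lambda>y. fderiv f y v) (x + s *\<^sub>R v + t *\<^sub>R w) w"
proof -
  let ?f' = "\<lambda>y. fderiv f y"
  let ?g = "\<lambda>y. ?f' y v"
  have path: "((\<lambda>s. k (p + s *\<^sub>R q)) has_real_derivative fderiv k (p + s *\<^sub>R q) q) (at s)"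
    if "smooth_on S k" "p + s *\<^sub>R q \<in> S" for k :: "'a \<Rightarrow> real" and p q s
  proof -
    have k: "(k has_derivative fderiv k (p + s *\<^sub>R q)) (at (p + s *\<^sub>R q))"
      by (rule smooth_on_has_derivative[OF that])
    have "((\<lambda>s. p + s *\<^sub>R q) has_derivative (\<lambda>r. r *\<^sub>R q)) (at s)"
      by (auto intro!: derivative_eq_intros)
    from has_derivative_compose[OF this k]
    have "((\<lambda>s. k (p + s *\<^sub>R q)) has_derivative (\<lambda>r. fderiv k (p + s *\<^sub>R q) (r *\<^sub>R q))) (at s)" .
    moreover have "fderiv k (p + s *\<^sub>R q) (r *\<^sub>R q) = fderiv k (p + s *\<^sub>R q) q * r" for r
      using has_derivative_linear[OF k] by (simp add: linear_scale)
    ultimately show ?thesis by (simp add: has_field_derivative_def)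
  qed
  have "\<exists>s>0. s < h \<and> (\<lambda>s. f (x + h *\<^sub>R w + s *\<^sub>R v) - f (x + s *\<^sub>R v)) h
      - (\<lambda>s. f (x + h *\<^sub>R w + s *\<^sub>R v) - f (x + s *\<^sub>R v)) 0
      = (h - 0) * (\<lambda>s. ?g (x + h *\<^sub>R w + s *\<^sub>R v) - ?g (x + s *\<^sub>R v)) s"
  proof (rule MVT2[OF h])
    fix s assume s: "0 \<le> s" "s \<le> h"
    have "x + h *\<^sub>R w + s *\<^sub>R v \<in> S" "x + s *\<^sub>R v \<in> S"
      using seg[OF s, of h] seg[OF s, of 0] h by (simp_all add: algebra_simps)
    then show "((\<lambda>s. f (x + h *\<^sub>R w + s *\<^sub>R v) - f (x + s *\<^sub>R v)) has_real_derivative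
        ?g (x + h *\<^sub>R w + s *\<^sub>R v) - ?g (x + s *\<^sub>R v)) (at s)"
      by (intro DERIV_diff path f)
  qed
  then obtain s where s: "0 < s" "s < h" and eq1: "f (x + h *\<^sub>R w + h *\<^sub>R v) - f (x + h *\<^sub>R v) - f (x + h *\<^sub>R w) + f x
      = h * (?g (x + h *\<^sub>R w + s *\<^sub>R v) - ?g (x + s *\<^sub>R v))"
    by (auto simp: algebra_simps)
  have "\<exists>t>0. t < h \<and> (\<lambda>t. ?g (x + s *\<^sub>R v + t *\<^sub>R w)) h - (\<lambda>t. ?g (x + s *\<^sub>R v + t *\<^sub>R w)) 0
      = (h - 0) * (\<lambda>t. fderiv ?g (x + s *\<^sub>R v + t *\<^sub>R w) w) t"
  proof (rule MVT2[OF h])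
    fix t assume t: "0 \<le> t" "t \<le> h"
    show "((\<lambda>t. ?g (x + s *\<^sub>R v + t *\<^sub>R w)) has_real_derivative
        fderiv ?g (x + s *\<^sub>R v + t *\<^sub>R w) w) (at t)"
      by (rule path[OF smooth_on_frechet[OF f]]) (use seg s t in auto)
  qed
  then obtain t where t: "0 < t" "t < h" and eq2: "?g (x + s *\<^sub>R v + h *\<^sub>R w) - ?g (x + s *\<^sub>R v)
      = h * fderiv ?g (x + s *\<^sub>R v + t *\<^sub>R w) w"
    by auto
  show thesis
    by (rule that[OF s t]) (use eq1 eq2 in \<open>simp add: algebra_simps power2_eq_square\<close>)
qed

text \<open>The second difference over a parallelogram is symmetric in \<open>v\<close> and
  \<open>w\<close>. So the two mixed derivatives take a common value at points arbitrarily near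
  \<open>x\<close>, though not at the same point, and continuity forces equality at
  \<open>x\<close>.\<close>

lemma frechet_symmetric_real:
  fixes f :: "'a::euclidean_space \<Rightarrow> real"
  assumes f: "smooth_on S f" and S: "open S" and x: "x \<in> S"
  shows "fderiv (\<lambda>y. fderiv f y v) x w
       = fderiv (\<lambda>y. fderiv f y w) x v"
    (is "?A x = ?B x")
proof (rule ccontr)
  assume ne: "?A x \<noteq> ?B x"
  \<comment> \<open>Half the supposed gap: two deviations smaller than \<open>e\<close> cannot
    bridge it.\<close>
  define e where "e = \<bar>?A x - ?B x\<bar> / 2"
  have e: "0 < e" using ne by (simp add: e_def)
  have "smooth_on S ?A" "smooth_on S ?B" by (intro smooth_on_frechet f)+
  then have "continuous_on S ?A" "continuous_on S ?B" using smooth_on_Ck[of S _ 0] by auto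
  then have "isCont ?A x" "isCont ?B x" using S x by (auto simp: continuous_on_eq_continuous_at)
  then obtain d1 d2 where d1: "0 < d1" "\<And>y. dist y x < d1 \<Longrightarrow> dist (?A y) (?A x) < e"
    and d2: "0 < d2" "\<And>y. dist y x < d2 \<Longrightarrow> dist (?B y) (?B x) < e"
    using e unfolding continuous_at_eps_delta by metis
  obtain d3 where d3: "0 < d3" "\<And>y. dist y x < d3 \<Longrightarrow> y \<in> S"
    using S x unfolding open_dist by blast
  define d where "d = min d1 (min d2 d3)"
  \<comment> \<open>Keeps the whole parallelogram with sides \<open>h v\<close> and
    \<open>h w\<close> within distance \<open>d\<close> of \<open>x\<close>; the summand 1 covers
    \<open>v = w = 0\<close>.\<close>
  define h where "h = d / (norm v + norm w + 1)"
  have d: "0 < d" using d1 d2 d3 by (simp add: d_def)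
  have n: "0 < norm v + norm w + 1" by (simp add: add_nonneg_pos)
  have h: "0 < h" using d n by (simp add: h_def)
  have near: "dist (x + s *\<^sub>R v + t *\<^sub>R w) x < d" if "0 \<le> s" "s \<le> h" "0 \<le> t" "t \<le> h" for s t
  proof -
    have "dist (x + s *\<^sub>R v + t *\<^sub>R w) x = norm (s *\<^sub>R v + t *\<^sub>R w)" by (simp add: dist_norm)
    also have "\<dots> \<le> s * norm v + t * norm w"
      using norm_triangle_ineq[of "s *\<^sub>R v" "t *\<^sub>R w"] that by simp
    also have "\<dots> \<le> h * norm v + h * norm w"
      using that by (intro add_mono mult_right_mono) auto
    also have "\<dots> < h * (norm v + norm w + 1)" using h by (simp add: algebra_simps)
    also have "\<dots> = d" using n by (simp add: h_def)
    finally show ?thesis .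
  qed
  have near': "dist (x + t *\<^sub>R w + s *\<^sub>R v) x < d" if "0 \<le> s" "s \<le> h" "0 \<le> t" "t \<le> h" for s t
    using near[OF that] by (simp add: algebra_simps)
  obtain s t where st: "0 < s" "s < h" "0 < t" "t < h"
    "f (x + h *\<^sub>R v + h *\<^sub>R w) - f (x + h *\<^sub>R v) - f (x + h *\<^sub>R w) + f x = h\<^sup>2 * ?A (x + s *\<^sub>R v + t *\<^sub>R w)"
    by (rule second_difference_mvt[OF f h, of x v w]) (use near d3 in \<open>auto simp: d_def\<close>)
  obtain s' t' where st': "0 < t'" "t' < h" "0 < s'" "s' < h"
    "f (x + h *\<^sub>R w + h *\<^sub>R v) - f (x + h *\<^sub>R w) - f (x + h *\<^sub>R v) + f x = h\<^sup>2 * ?B (x + t' *\<^sub>R w + s' *\<^sub>R v)"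
    by (rule second_difference_mvt[OF f h, of x w v]) (use near' d3 in \<open>auto simp: d_def\<close>)
  have "h\<^sup>2 * ?A (x + s *\<^sub>R v + t *\<^sub>R w) = h\<^sup>2 * ?B (x + t' *\<^sub>R w + s' *\<^sub>R v)"
    using st(5) st'(5) by (simp add: algebra_simps)
  then have "?A (x + s *\<^sub>R v + t *\<^sub>R w) = ?B (x + t' *\<^sub>R w + s' *\<^sub>R v)"
    using h by simp
  moreover have "dist (?A (x + s *\<^sub>R v + t *\<^sub>R w)) (?A x) < e"
    using near[of s t] st by (intro d1) (auto simp: d_def)
  moreover have "dist (?B (x + t' *\<^sub>R w + s' *\<^sub>R v)) (?B x) < e"
    using near'[of s' t'] st' by (intro d2) (auto simp: d_def)
  ultimately show False unfolding dist_real_def e_def by argo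
qed

lemma frechet_derivative_inner:
  assumes "f differentiable at x"
  shows "fderiv (\<lambda>y. f y \<bullet> b) x v = fderiv f x v \<bullet> b"
proof -
  have "((\<lambda>y. f y \<bullet> b) has_derivative (\<lambda>v. fderiv f x v \<bullet> b)) (at x)"
    using assms by (intro has_derivative_inner_left) (simp add: frechet_derivative_works)
  from frechet_derivative_at[OF this] show ?thesis by metis
qed

lemma frechet_symmetric:
  fixes f :: "'a::euclidean_space \<Rightarrow> 'b::euclidean_space"
  assumes f: "smooth_on S f" and S: "open S" and x: "x \<in> S"
  shows "fderiv (\<lambda>y. fderiv f y v) x w
       = fderiv (\<lambda>y. fderiv f y w) x v"
proof (rule euclidean_eqI)
  fix b :: 'b assume "b \<in> Basis"
  have fb: "smooth_on S (\<lambda>y. f y \<bullet> b)"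
    by (rule smooth_on_linear_compose[OF S bounded_linear_inner_left f])
  have diff: "k differentiable at y" if "smooth_on S k" "y \<in> S" for k :: "'a \<Rightarrow> 'b" and y
    using smooth_on_has_derivative[OF that] by (auto simp: differentiable_def)
  have *: "fderiv (\<lambda>y. fderiv f y v) x w \<bullet> b
    = fderiv (\<lambda>y. fderiv (\<lambda>y. f y \<bullet> b) y v) x w" for v w
  proof -
    have "fderiv (\<lambda>y. fderiv f y v) x w \<bullet> b
      = fderiv (\<lambda>y. fderiv f y v \<bullet> b) x w"
      by (rule frechet_derivative_inner[OF diff[OF smooth_on_frechet[OF f] x], symmetric])
    also have "\<dots> = fderiv (\<lambda>y. fderiv (\<lambda>y. f y \<bullet> b) y v) x w"
    proof (rule fun_cong[OF frechet_derivative_cong[OF S x]])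
      show "fderiv f y v \<bullet> b = fderiv (\<lambda>y. f y \<bullet> b) y v" if "y \<in> S" for y
        by (rule frechet_derivative_inner[OF diff[OF f that], symmetric])
      show "(\<lambda>y. fderiv f y v \<bullet> b) differentiable at x"
        using smooth_on_has_derivative[OF smooth_on_linear_compose[OF S bounded_linear_inner_left smooth_on_frechet[OF f]] x]
        unfolding differentiable_def by blast
    qed
    finally show ?thesis .
  qed
  show "fderiv (\<lambda>y. fderiv f y v) x w \<bullet> b
       = fderiv (\<lambda>y. fderiv f y w) x v \<bullet> b"
    unfolding * by (rule frechet_symmetric_real[OF fb S x])
qed

text \<open>A product rule for application in which \<open>F\<close> is only tested on fixed
  vectors. Expanding \<open>g y\<close> in the basis reduces it to the rule for scalar
  multiples.\<close>

lemma has_derivative_apply: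
  fixes F :: "'a::euclidean_space \<Rightarrow> 'b::euclidean_space \<Rightarrow> 'c::real_normed_vector"
  assumes S: "open S" "x \<in> S" and lin: "\<And>y. y \<in> S \<Longrightarrow> linear (F y)"
    and F: "\<And>b. ((\<lambda>y. F y b) has_derivative F' b) (at x)"
    and g: "(g has_derivative g') (at x)"
  shows "((\<lambda>y. F y (g y)) has_derivative (\<lambda>v. F' (g x) v + F x (g' v))) (at x)"
proof -
  have ev: "eventually (\<lambda>y. y \<in> S) (at x)"
    using S eventually_at_topological by blast
  \<comment> \<open>Linearity of \<open>F'\<close> in its parameter is not assumed; linearity of
    \<open>F y\<close> and uniqueness of derivatives force it.\<close>
  have F'sum: "F' a = (\<lambda>v. \<Sum>b\<in>Basis. (a \<bullet> b) *\<^sub>R F' b v)" for a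
  proof -
    have "((\<lambda>y. \<Sum>b\<in>Basis. (a \<bullet> b) *\<^sub>R F y b) has_derivative (\<lambda>v. \<Sum>b\<in>Basis. (a \<bullet> b) *\<^sub>R F' b v)) (at x)"
      by (intro has_derivative_sum bounded_linear.has_derivative[OF bounded_linear_scaleR_right] F)
    then have "((\<lambda>y. F y a) has_derivative (\<lambda>v. \<Sum>b\<in>Basis. (a \<bullet> b) *\<^sub>R F' b v)) (at x)"
      by (rule has_derivative_transform_within_open[OF _ S]) (use lin linear_euclidean_sum in metis)
    then show ?thesis using has_derivative_unique[OF F] by blast
  qed
  have "((\<lambda>y. \<Sum>b\<in>Basis. (g y \<bullet> b) *\<^sub>R F y b) has_derivative
      (\<lambda>v. \<Sum>b\<in>Basis. (g x \<bullet> b) *\<^sub>R F' b v + (g' v \<bullet> b) *\<^sub>R F x b)) (at x)"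
    by (intro has_derivative_sum has_derivative_scaleR has_derivative_inner_left F g)
  then have "((\<lambda>y. F y (g y)) has_derivative
      (\<lambda>v. \<Sum>b\<in>Basis. (g x \<bullet> b) *\<^sub>R F' b v + (g' v \<bullet> b) *\<^sub>R F x b)) (at x)"
    by (rule has_derivative_transform_within_open[OF _ S]) (use lin linear_euclidean_sum in metis)
  moreover have "(\<Sum>b\<in>Basis. (g x \<bullet> b) *\<^sub>R F' b v + (g' v \<bullet> b) *\<^sub>R F x b) = F' (g x) v + F x (g' v)" for v
    using linear_euclidean_sum[OF lin[OF S(2)], of "g' v"] F'sum[of "g x"] by (simp add: sum.distrib)
  ultimately show ?thesis by simp
qed

lemma frechet_derivative_frechet_apply:
  fixes f :: "'a::euclidean_space \<Rightarrow> 'b::real_normed_vector"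
  assumes S: "open S" "x \<in> S" and f: "smooth_on S f" and g: "(g has_derivative g') (at x)"
  shows "((\<lambda>y. fderiv f y (g y)) has_derivative
    (\<lambda>v. fderiv (\<lambda>y. fderiv f y (g x)) x v
        + fderiv f x (g' v))) (at x)"
  by (rule has_derivative_apply[OF S _ _ g, where F = "\<lambda>y. fderiv f y"
        and F' = "\<lambda>b. fderiv (\<lambda>y. fderiv f y b) x"])
    (rule smooth_on_linear_frechet[OF f], assumption,
     rule smooth_on_has_derivative[OF smooth_on_frechet[OF f] S(2)])

section \<open>Bump functions\<close>

text \<open>The flat function exp(-1/t) is the case \<open>n = 0\<close>. The powers of 1/t are
  carried along because differentiation leads to them: the span of the family is closed under it, so
  smoothness becomes one induction over all \<open>n\<close>.\<close>

definition flat_exp :: "nat \<Rightarrow> real \<Rightarrow> real" where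
  "flat_exp n t = (if t > 0 then inverse t ^ n * exp (- inverse t) else 0)"

lemma flat_exp_tendsto_0: "(flat_exp n \<longlongrightarrow> 0) (at 0)"
proof (rule filterlim_split_at)
  show "(flat_exp n \<longlongrightarrow> 0) (at_left 0)"
    by (rule tendsto_eventually) (auto simp: eventually_at_filter flat_exp_def)
  have "((\<lambda>t. inverse t ^ n / exp (inverse t)) \<longlongrightarrow> 0) (at_right (0::real))"
    by (rule filterlim_compose[OF tendsto_power_div_exp_0 filterlim_inverse_at_top_right])
  then show "(flat_exp n \<longlongrightarrow> 0) (at_right 0)"
    by (rule Lim_transform_eventually)
      (auto simp: eventually_at_filter flat_exp_def exp_minus divide_inverse)
qed

lemma flat_exp_deriv:
  "(flat_exp n has_real_derivative flat_exp (n + 2) t - real n * flat_exp (n + 1) t) (at t)"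
proof -
  consider "t < 0" | "t = 0" | "t > 0" by linarith
  then show ?thesis
  proof cases
    case 1
    have "((\<lambda>t. 0) has_real_derivative 0) (at t)" by simp
    then have "(flat_exp n has_real_derivative 0) (at t)"
      by (rule has_field_derivative_transform_within_open[of _ _ _ "{..<0}"])
        (use 1 in \<open>auto simp: flat_exp_def\<close>)
    then show ?thesis using 1 by (simp add: flat_exp_def)
  next
    case 2
    \<comment> \<open>Dividing by \<open>h\<close> only raises the power of 1/h: the difference
      quotient at 0 is \<open>flat_exp (Suc n)\<close>.\<close>
    have "((\<lambda>h. (flat_exp n (0 + h) - flat_exp n 0) / h) \<longlongrightarrow> 0) (at 0)"
      by (rule Lim_transform_eventually[OF flat_exp_tendsto_0[of "Suc n"]])
        (auto simp: eventually_at_filter flat_exp_def field_simps)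
    then have "(flat_exp n has_real_derivative 0) (at 0)" by (simp add: DERIV_def)
    then show ?thesis using 2 by (simp add: flat_exp_def)
  next
    case 3
    have "((\<lambda>t. inverse t ^ n * exp (- inverse t)) has_real_derivative
        inverse t ^ (n + 2) * exp (- inverse t) - real n * (inverse t ^ (n + 1) * exp (- inverse t))) (at t)"
    proof -
      have i: "(inverse has_real_derivative - (inverse t * inverse t)) (at t)"
        using 3 DERIV_inverse[of t] by (simp add: power2_eq_square)
      have "((\<lambda>t. inverse t ^ n) has_real_derivative real n * (- (inverse t * inverse t) * inverse t ^ (n - Suc 0))) (at t)"
        by (rule DERIV_power[OF i])
      moreover have "real n * (- (inverse t * inverse t) * inverse t ^ (n - Suc 0)) = - real n * inverse t ^ (n + 1)"
        by (cases n) (simp_all add: algebra_simps)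
      ultimately have p: "((\<lambda>t. inverse t ^ n) has_real_derivative - real n * inverse t ^ (n + 1)) (at t)"
        by metis
      have e: "((\<lambda>t. exp (- inverse t)) has_real_derivative exp (- inverse t) * (inverse t * inverse t)) (at t)"
        using DERIV_fun_exp[OF DERIV_minus[OF i]] by simp
      show ?thesis
        using DERIV_mult[OF p e] by (simp add: algebra_simps)
    qed
    then have "(flat_exp n has_real_derivative
        inverse t ^ (n + 2) * exp (- inverse t) - real n * (inverse t ^ (n + 1) * exp (- inverse t))) (at t)"
      by (rule has_field_derivative_transform_within_open[of _ _ _ "{0<..}"])
        (use 3 in \<open>auto simp: flat_exp_def\<close>)
    then show ?thesis using 3 by (simp add: flat_exp_def)
  qed
qed

lemma smooth_on_flat_exp: "smooth_on UNIV (flat_exp n)"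
proof -
  have "Ck_on k UNIV (flat_exp n)" for k
  proof (induction k arbitrary: n)
    case 0
    have "isCont (flat_exp n) t" for t using flat_exp_deriv by (rule DERIV_isCont)
    then show ?case by (simp add: continuous_on_eq_continuous_at)
  next
    case (Suc k)
    show ?case
    proof (rule Ck_on_SucI[OF open_UNIV])
      show "(flat_exp n has_derivative (\<lambda>v. (flat_exp (n + 2) t - real n * flat_exp (n + 1) t) * v)) (at t)" for t
        using flat_exp_deriv[of n t] by (simp add: has_field_derivative_def)
      show "Ck_on k UNIV (\<lambda>t. (flat_exp (n + 2) t - real n * flat_exp (n + 1) t) * v)" for v
      proof -
        have "Ck_on k UNIV (\<lambda>t. v * flat_exp (n + 2) t + (- v * real n) * flat_exp (n + 1) t)"
          by (intro Ck_on_add open_UNIV Ck_on_linear_compose[OF open_UNIV bounded_linear_mult_right] Suc.IH)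
        then show ?thesis by (simp add: algebra_simps)
      qed
    qed
  qed
  then show ?thesis by (simp add: smooth_on_def)
qed

text \<open>The squared distance keeps the argument polynomial, hence smooth at the centre as well.
  There is no plateau of value 1: the factor will appear on both sides of a linear system, where
  positivity is enough.\<close>

definition bump :: "'e::euclidean_space \<Rightarrow> real \<Rightarrow> 'e \<Rightarrow> real" where
  "bump x r y = flat_exp 0 (r\<^sup>2 - (y - x) \<bullet> (y - x))"

lemma bump_pos: "bump x r y > 0" if "dist y x < r"
proof -
  have "(norm (y - x))\<^sup>2 < r\<^sup>2"
    using that by (intro power_strict_mono) (auto simp: dist_norm)
  then show ?thesis by (simp add: bump_def flat_exp_def power2_norm_eq_inner)
qed

lemma bump_zero: "bump x r y = 0" if "dist y x \<ge> r" "r > 0"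
proof -
  have "r\<^sup>2 \<le> (norm (y - x))\<^sup>2"
    using that by (intro power_mono) (auto simp: dist_norm)
  then show ?thesis by (simp add: bump_def flat_exp_def power2_norm_eq_inner)
qed

lemma smooth_on_bump: "open S \<Longrightarrow> smooth_on S (bump x r)"
proof -
  assume S: "open S"
  have d: "smooth_on S (\<lambda>y. y - x)"
    by (intro smooth_on_diff smooth_on_const smooth_on_linear bounded_linear_ident S)
  have "smooth_on S (\<lambda>y. r\<^sup>2 - (y - x) \<bullet> (y - x))"
    by (intro smooth_on_diff[OF S] smooth_on_const smooth_on_bilinear[OF bounded_bilinear_inner S d d])
  from smooth_on_compose[OF S open_UNIV smooth_on_flat_exp[of 0] this]
  show ?thesis by (simp add: bump_def[abs_def])
qed

section \<open>Tangent vectors and brackets in an atlas\<close>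

text \<open>The part of a manifold structure on which the calculus of tangent vectors rests, with
  openness asked of coordinate images and no topology on the points. It is used for the base and
  again for the slit tangent bundle.\<close>

locale atlas =
  fixes A :: "('a, 'e::euclidean_space) chart set"
  assumes inj_chart: "c \<in> A \<Longrightarrow> inj_on (snd c) (fst c)"
    and open_overlap: "c \<in> A \<Longrightarrow> d \<in> A \<Longrightarrow> open (snd c ` (fst c \<inter> fst d))"
    and smooth_transition: "c \<in> A \<Longrightarrow> d \<in> A \<Longrightarrow>
      smooth_on (snd c ` (fst c \<inter> fst d)) (snd d \<circ> chart_inv c)"
begin

definition jac :: "('a, 'e) chart \<Rightarrow> ('a, 'e) chart \<Rightarrow> 'a \<Rightarrow> 'e \<Rightarrow> 'e" where
  "jac c d p = fderiv (snd d \<circ> chart_inv c) (snd c p)"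

lemma open_img: "c \<in> A \<Longrightarrow> open (snd c ` fst c)"
  using open_overlap[of c c] by simp

lemma chart_inv_snd [simp]: "c \<in> A \<Longrightarrow> p \<in> fst c \<Longrightarrow> chart_inv c (snd c p) = p"
  using inj_chart by (simp add: chart_inv_def)

lemma snd_chart_inv [simp]: "c \<in> A \<Longrightarrow> z \<in> snd c ` fst c \<Longrightarrow> snd c (chart_inv c z) = z"
  by (auto simp: chart_inv_snd)

lemma chart_inv_in: "c \<in> A \<Longrightarrow> z \<in> snd c ` fst c \<Longrightarrow> chart_inv c z \<in> fst c"
  by (auto simp: chart_inv_snd)

lemma transition_has_derivative:
  assumes "c \<in> A" "d \<in> A" "p \<in> fst c" "p \<in> fst d"
  shows "((snd d \<circ> chart_inv c) has_derivative jac c d p) (at (snd c p))"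
  unfolding jac_def by (rule smooth_on_has_derivative[OF smooth_transition]) (use assms in auto)

lemma linear_jac:
  assumes "c \<in> A" "d \<in> A" "p \<in> fst c" "p \<in> fst d"
  shows "linear (jac c d p)"
  using transition_has_derivative[OF assms] has_derivative_linear by blast

text \<open>The chain rule through a transition map. Composition of Jacobians and chart independence
  of \<open>dir_deriv\<close> and \<open>rho\<close> are read off from it.\<close>

lemma change_chart_has_derivative:
  assumes "c \<in> A" "d \<in> A" "p \<in> fst c" "p \<in> fst d"
    and g: "((g \<circ> chart_inv d) has_derivative g') (at (snd d p))"
  shows "((g \<circ> chart_inv c) has_derivative (\<lambda>v. g' (jac c d p v))) (at (snd c p))"
proof -
  have "((\<lambda>z. (g \<circ> chart_inv d) ((snd d \<circ> chart_inv c) z)) has_derivative (\<lambda>v. g' (jac c d p v))) (at (snd c p))"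
    by (rule has_derivative_compose[OF transition_has_derivative[OF assms(1-4)]]) (use g assms in \<open>simp add: comp_def\<close>)
  then show ?thesis
    by (rule has_derivative_transform_within_open[OF _ open_overlap[OF assms(1,2)]])
      (use assms in auto)
qed

lemma jac_id:
  assumes "c \<in> A" "p \<in> fst c"
  shows "jac c c p v = v"
proof -
  have "((\<lambda>z. z) has_derivative (\<lambda>v. v)) (at (snd c p))" by (rule has_derivative_ident)
  then have "((snd c \<circ> chart_inv c) has_derivative (\<lambda>v. v)) (at (snd c p))"
    by (rule has_derivative_transform_within_open[OF _ open_img[OF assms(1)]]) (use assms in auto)
  from frechet_derivative_at[OF this] show ?thesis by (metis jac_def)
qed

lemma jac_comp:
  assumes "c \<in> A" "d \<in> A" "e \<in> A" "p \<in> fst c" "p \<in> fst d" "p \<in> fst e"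
  shows "jac d e p (jac c d p v) = jac c e p v"
proof -
  have "((snd e \<circ> chart_inv c) has_derivative (\<lambda>v. jac d e p (jac c d p v))) (at (snd c p))"
    using assms by (intro change_chart_has_derivative transition_has_derivative)
  from frechet_derivative_at[OF this] show ?thesis by (metis jac_def)
qed

lemma tangent_iff:
  "v \<in> tangent_space A p \<longleftrightarrow> (\<forall>c. \<not> (c \<in> A \<and> p \<in> fst c) \<longrightarrow> v c = 0) \<and>
    (\<forall>c\<in>A. \<forall>d\<in>A. p \<in> fst c \<and> p \<in> fst d \<longrightarrow> v d = jac c d p (v c))"
  by (simp add: tangent_space_def jac_def)

lemma tangent_I:
  "(\<And>c. \<not> (c \<in> A \<and> p \<in> fst c) \<Longrightarrow> v c = 0) \<Longrightarrow>
    (\<And>c d. c \<in> A \<Longrightarrow> d \<in> A \<Longrightarrow> p \<in> fst c \<Longrightarrow> p \<in> fst d \<Longrightarrow> v d = jac c d p (v c)) \<Longrightarrow>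
    v \<in> tangent_space A p"
  unfolding tangent_iff by blast

lemma tangent_outside: "v \<in> tangent_space A p \<Longrightarrow> \<not> (c \<in> A \<and> p \<in> fst c) \<Longrightarrow> v c = 0"
  unfolding tangent_iff by blast

lemma tangent_change:
  "v \<in> tangent_space A p \<Longrightarrow> c \<in> A \<Longrightarrow> d \<in> A \<Longrightarrow> p \<in> fst c \<Longrightarrow> p \<in> fst d \<Longrightarrow> v d = jac c d p (v c)"
  unfolding tangent_iff by blast

lemma tangent_eqI:
  assumes "v \<in> tangent_space A p" "w \<in> tangent_space A p" "c \<in> A" "p \<in> fst c" "v c = w c"
  shows "v = w"
proof
  fix d show "v d = w d"
    using assms tangent_outside tangent_change by metis
qed

lemma tangent_zero [simp]: "0 \<in> tangent_space A p"
  by (rule tangent_I) (simp_all add: linear_0[OF linear_jac])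

lemma tangent_add: "v \<in> tangent_space A p \<Longrightarrow> w \<in> tangent_space A p \<Longrightarrow> v + w \<in> tangent_space A p"
  by (rule tangent_I) (simp_all add: linear_add[OF linear_jac, symmetric] tangent_outside,
      metis tangent_change linear_add[OF linear_jac])

lemma tangent_scale: "v \<in> tangent_space A p \<Longrightarrow> r *\<^sub>R v \<in> tangent_space A p"
  by (rule tangent_I) (simp_all add: tangent_outside, metis tangent_change linear_scale[OF linear_jac])

lemma tangent_uminus: "v \<in> tangent_space A p \<Longrightarrow> - v \<in> tangent_space A p"
  using tangent_scale[of v p "-1"] by simp

lemma tangent_diff: "v \<in> tangent_space A p \<Longrightarrow> w \<in> tangent_space A p \<Longrightarrow> v - w \<in> tangent_space A p"
  using tangent_add[of v p "- w"] tangent_uminus[of w p] by simp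

definition tvec_of :: "('a, 'e) chart \<Rightarrow> 'a \<Rightarrow> 'e \<Rightarrow> ('a, 'e) tvec" where
  "tvec_of c p y = (\<lambda>d. if d \<in> A \<and> p \<in> fst d then jac c d p y else 0)"

lemma tvec_of_tangent: "c \<in> A \<Longrightarrow> p \<in> fst c \<Longrightarrow> tvec_of c p y \<in> tangent_space A p"
  by (rule tangent_I) (auto simp: tvec_of_def jac_comp)

lemma tvec_of_self [simp]: "c \<in> A \<Longrightarrow> p \<in> fst c \<Longrightarrow> tvec_of c p y c = y"
  by (simp add: tvec_of_def jac_id)

lemma chart_at: "p \<in> points A \<Longrightarrow> chart_at A p \<in> A \<and> p \<in> fst (chart_at A p)"
  unfolding points_def chart_at_def by (rule someI_ex) blast

lemma in_points: "c \<in> A \<Longrightarrow> p \<in> fst c \<Longrightarrow> p \<in> points A"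
  by (auto simp: points_def)

text \<open>Frees \<open>dir_deriv\<close> from the arbitrary chart \<open>chart_at\<close>: the
  Jacobian of the transition is absorbed by the transformation rule of the tangent vector.\<close>

lemma dir_deriv_chart:
  assumes "c \<in> A" "p \<in> fst c" "a \<in> tangent_space A p"
    and f: "((f \<circ> chart_inv c) has_derivative f') (at (snd c p))"
  shows "dir_deriv A p a f = f' (a c)"
proof -
  let ?d = "chart_at A p"
  have d: "?d \<in> A" "p \<in> fst ?d" using chart_at in_points assms by blast+
  have "((f \<circ> chart_inv ?d) has_derivative (\<lambda>v. f' (jac ?d c p v))) (at (snd ?d p))"
    by (rule change_chart_has_derivative[OF d(1) assms(1) d(2) assms(2) f])
  from frechet_derivative_at[OF this]
  have "dir_deriv A p a f = f' (jac ?d c p (a ?d))"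
    unfolding dir_deriv_def Let_def by metis
  also have "jac ?d c p (a ?d) = a c" using tangent_change assms d by metis
  finally show ?thesis .
qed

section \<open>Vector fields in charts and the Lie bracket\<close>

definition rep :: "('a, 'e) chart \<Rightarrow> ('a \<Rightarrow> ('a, 'e) tvec) \<Rightarrow> 'e \<Rightarrow> 'e" where
  "rep c X = (\<lambda>z. X (chart_inv c z) c)"

lemma rep_snd [simp]: "c \<in> A \<Longrightarrow> p \<in> fst c \<Longrightarrow> rep c X (snd c p) = X p c"
  by (simp add: rep_def)

lemma vf_tangent: "X \<in> vector_fields A \<Longrightarrow> X p \<in> tangent_space A p"
  by (cases "p \<in> points A") (auto simp: vector_fields_def)

lemma vf_zero: "X \<in> vector_fields A \<Longrightarrow> p \<notin> points A \<Longrightarrow> X p = 0"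
  by (simp add: vector_fields_def)

lemma vf_smooth: "X \<in> vector_fields A \<Longrightarrow> c \<in> A \<Longrightarrow> smooth_on (snd c ` fst c) (rep c X)"
  by (simp add: vector_fields_def rep_def)

lemma vf_has_derivative:
  "X \<in> vector_fields A \<Longrightarrow> c \<in> A \<Longrightarrow> z \<in> snd c ` fst c \<Longrightarrow>
    (rep c X has_derivative fderiv (rep c X) z) (at z)"
  using vf_smooth smooth_on_has_derivative by blast

lemma vf_I:
  "(\<And>p. p \<in> points A \<Longrightarrow> X p \<in> tangent_space A p) \<Longrightarrow> (\<And>p. p \<notin> points A \<Longrightarrow> X p = 0) \<Longrightarrow>
    (\<And>c. c \<in> A \<Longrightarrow> smooth_on (snd c ` fst c) (rep c X)) \<Longrightarrow> X \<in> vector_fields A"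
  by (simp add: vector_fields_def rep_def)

lemma vf_eqI:
  assumes "X \<in> vector_fields A" "Y \<in> vector_fields A"
    "\<And>p. p \<in> points A \<Longrightarrow> \<exists>c\<in>A. p \<in> fst c \<and> X p c = Y p c"
  shows "X = Y"
proof
  fix p show "X p = Y p"
  proof (cases "p \<in> points A")
    case True
    then show ?thesis using assms tangent_eqI[OF vf_tangent vf_tangent] by metis
  qed (simp add: vf_zero assms)
qed

lemma vf_add: "X \<in> vector_fields A \<Longrightarrow> Y \<in> vector_fields A \<Longrightarrow> X + Y \<in> vector_fields A"
proof (rule vf_I)
  assume X: "X \<in> vector_fields A" and Y: "Y \<in> vector_fields A"
  have "rep c (X + Y) = (\<lambda>z. rep c X z + rep c Y z)" for c by (simp add: rep_def fun_eq_iff)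
  then show "smooth_on (snd c ` fst c) (rep c (X + Y))" if "c \<in> A" for c
    using smooth_on_add[OF open_img[OF that] vf_smooth[OF X that] vf_smooth[OF Y that]] by simp
qed (auto simp: vf_tangent tangent_add vf_zero)

lemma vf_scale: "X \<in> vector_fields A \<Longrightarrow> r *\<^sub>R X \<in> vector_fields A"
proof (rule vf_I)
  assume X: "X \<in> vector_fields A"
  have "rep c (r *\<^sub>R X) = (\<lambda>z. r *\<^sub>R rep c X z)" for c by (simp add: rep_def fun_eq_iff)
  then show "smooth_on (snd c ` fst c) (rep c (r *\<^sub>R X))" if "c \<in> A" for c
    using smooth_on_cscaleR[OF open_img[OF that] vf_smooth[OF X that]] by simp
qed (auto simp: vf_tangent tangent_scale vf_zero)

lemma vf_uminus: "X \<in> vector_fields A \<Longrightarrow> - X \<in> vector_fields A"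
  using vf_scale[of X "-1"] by simp

lemma vf_diff: "X \<in> vector_fields A \<Longrightarrow> Y \<in> vector_fields A \<Longrightarrow> X - Y \<in> vector_fields A"
  using vf_add[of X "- Y"] vf_uminus[of Y] by simp

lemma bracket_chart:
  assumes "c \<in> A" "p \<in> fst c"
  shows "lie_bracket A X Y p c = fderiv (rep c Y) (snd c p) (X p c)
      - fderiv (rep c X) (snd c p) (Y p c)"
  using assms by (simp add: lie_bracket_def rep_def[abs_def])

lemma rep_bracket:
  assumes "c \<in> A" "z \<in> snd c ` fst c"
  shows "rep c (lie_bracket A X Y) z = fderiv (rep c Y) z (rep c X z)
      - fderiv (rep c X) z (rep c Y z)"
  using assms bracket_chart[OF assms(1) chart_inv_in[OF assms]] by (simp add: rep_def)

lemma smooth_rep_bracket: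
  assumes "c \<in> A" "X \<in> vector_fields A" "Y \<in> vector_fields A"
  shows "smooth_on (snd c ` fst c) (rep c (lie_bracket A X Y))"
proof (rule smooth_on_cong[OF open_img[OF assms(1)]])
  show "smooth_on (snd c ` fst c) (\<lambda>z. fderiv (rep c Y) z (rep c X z)
      - fderiv (rep c X) z (rep c Y z))"
    by (rule smooth_on_diff[OF open_img[OF assms(1)] smooth_on_frechet_apply smooth_on_frechet_apply])
      (fact open_img[OF assms(1)] vf_smooth[OF assms(2,1)] vf_smooth[OF assms(3,1)])+
qed (simp add: rep_bracket assms(1))

lemma rep_change:
  assumes "c \<in> A" "d \<in> A" "z \<in> snd c ` (fst c \<inter> fst d)" "X \<in> vector_fields A"
  shows "rep d X ((snd d \<circ> chart_inv c) z) = fderiv (snd d \<circ> chart_inv c) z (rep c X z)"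
proof -
  obtain p where p: "p \<in> fst c" "p \<in> fst d" "z = snd c p" using assms(3) by auto
  show ?thesis
    using tangent_change[OF vf_tangent[OF assms(4)] assms(1,2) p(1,2)] p assms(1,2)
    by (simp add: jac_def)
qed

text \<open>Differentiating the transformation rule of \<open>Y\<close> along \<open>X\<close> produces the second derivative of the
  transition map, which cancels in the bracket because it is symmetric.\<close>

lemma rep_change_derivative:
  assumes cd: "c \<in> A" "d \<in> A" "p \<in> fst c" "p \<in> fst d"
    and XY: "X \<in> vector_fields A" "Y \<in> vector_fields A"
  shows "fderiv (rep d Y) (snd d p) (X p d) =
    fderiv (\<lambda>z. fderiv (snd d \<circ> chart_inv c) z (Y p c)) (snd c p) (X p c)
    + jac c d p (fderiv (rep c Y) (snd c p) (X p c))"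
proof -
  let ?t = "snd d \<circ> chart_inv c" and ?O = "snd c ` (fst c \<inter> fst d)" and ?z = "snd c p"
  have O: "open ?O" "?z \<in> ?O" using open_overlap cd by auto
  have tz: "?t ?z = snd d p" using cd by simp
  have Yd: "(rep d Y has_derivative fderiv (rep d Y) (snd d p)) (at (snd d p))"
    using vf_has_derivative XY cd by simp
  have Yc: "(rep c Y has_derivative fderiv (rep c Y) ?z) (at ?z)"
    using vf_has_derivative XY cd by simp
  have "((\<lambda>z. rep d Y (?t z)) has_derivative (\<lambda>v. fderiv (rep d Y) (snd d p) (jac c d p v))) (at ?z)"
    by (rule has_derivative_compose[OF transition_has_derivative[OF cd]]) (use Yd tz in simp)
  then have "((\<lambda>z. fderiv ?t z (rep c Y z)) has_derivative
      (\<lambda>v. fderiv (rep d Y) (snd d p) (jac c d p v))) (at ?z)"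
    by (rule has_derivative_transform_within_open[OF _ O]) (rule rep_change[OF cd(1,2) _ XY(2)])
  from has_derivative_unique[OF this frechet_derivative_frechet_apply[OF O smooth_transition[OF cd(1,2)] Yc]]
  have "fderiv (rep d Y) (snd d p) (jac c d p (X p c)) =
    fderiv (\<lambda>z. fderiv ?t z (rep c Y ?z)) ?z (X p c)
        + fderiv ?t ?z (fderiv (rep c Y) ?z (X p c))"
    by metis
  then show ?thesis
    using tangent_change[OF vf_tangent[OF XY(1)] cd] cd by (simp add: jac_def)
qed

lemma bracket_tangent:
  assumes XY: "X \<in> vector_fields A" "Y \<in> vector_fields A"
  shows "lie_bracket A X Y p \<in> tangent_space A p"
proof -
  have *: "lie_bracket A X Y p d = jac c d p (lie_bracket A X Y p c)"
    if cd: "c \<in> A" "d \<in> A" "p \<in> fst c" "p \<in> fst d" for c d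
  proof -
    have z: "snd c p \<in> snd c ` (fst c \<inter> fst d)" using cd by auto
    have "lie_bracket A X Y p d = jac c d p (fderiv (rep c Y) (snd c p) (X p c))
        - jac c d p (fderiv (rep c X) (snd c p) (Y p c))"
      unfolding bracket_chart[OF cd(2,4)] rep_change_derivative[OF cd XY] rep_change_derivative[OF cd XY(2,1)]
        frechet_symmetric[OF smooth_transition[OF cd(1,2)] open_overlap[OF cd(1,2)] z, of "X p c" "Y p c"]
      by simp
    then show ?thesis
      unfolding bracket_chart[OF cd(1,3)] linear_diff[OF linear_jac[OF cd]] .
  qed
  show ?thesis by (rule tangent_I[OF _ *]) (auto simp: lie_bracket_def)
qed

lemma vf_bracket:
  assumes "X \<in> vector_fields A" "Y \<in> vector_fields A"
  shows "lie_bracket A X Y \<in> vector_fields A"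
proof (rule vf_I)
  show "lie_bracket A X Y p = 0" if "p \<notin> points A" for p
    using that by (auto simp: lie_bracket_def points_def fun_eq_iff)
qed (use assms in \<open>simp_all add: bracket_tangent smooth_rep_bracket\<close>)

lemma bracket_antisym: "lie_bracket A X Y = - lie_bracket A Y X"
  by (auto simp: lie_bracket_def fun_eq_iff)

lemma frechet_derivative_add:
  assumes "f differentiable at x" "g differentiable at x"
  shows "fderiv (\<lambda>x. f x + g x) x v = fderiv f x v + fderiv g x v"
proof -
  have "((\<lambda>x. f x + g x) has_derivative (\<lambda>v. fderiv f x v + fderiv g x v)) (at x)"
    using assms by (intro has_derivative_add) (simp_all add: frechet_derivative_works)
  from frechet_derivative_at[OF this] show ?thesis by metis
qed

lemma vf_differentiable:
  "X \<in> vector_fields A \<Longrightarrow> c \<in> A \<Longrightarrow> z \<in> snd c ` fst c \<Longrightarrow> rep c X differentiable at z"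
  using vf_has_derivative unfolding differentiable_def by blast

lemma bracket_add:
  assumes XYZ: "X \<in> vector_fields A" "Y \<in> vector_fields A" "Z \<in> vector_fields A"
  shows "lie_bracket A (X + Y) Z = lie_bracket A X Z + lie_bracket A Y Z"
proof (rule vf_eqI)
  fix p assume "p \<in> points A"
  then obtain c where c: "c \<in> A" "p \<in> fst c" by (auto simp: points_def)
  have r: "rep c (X + Y) = (\<lambda>z. rep c X z + rep c Y z)" by (simp add: rep_def fun_eq_iff)
  have l: "linear (fderiv (rep c Z) (snd c p))"
    using vf_smooth[OF XYZ(3) c(1)] smooth_on_linear_frechet c by blast
  show "\<exists>c\<in>A. p \<in> fst c \<and> lie_bracket A (X + Y) Z p c = (lie_bracket A X Z + lie_bracket A Y Z) p c"
    by (rule bexI[OF _ c(1)])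
      (use c XYZ in \<open>simp add: bracket_chart r frechet_derivative_add vf_differentiable linear_add[OF l]\<close>)
qed (intro vf_bracket vf_add XYZ)+

lemma rep_bracket_has_derivative:
  assumes c: "c \<in> A" "p \<in> fst c" and XY: "X \<in> vector_fields A" "Y \<in> vector_fields A"
  shows "fderiv (rep c (lie_bracket A X Y)) (snd c p) v =
      fderiv (\<lambda>z. fderiv (rep c Y) z (X p c)) (snd c p) v
    + fderiv (rep c Y) (snd c p) (fderiv (rep c X) (snd c p) v)
    - (fderiv (\<lambda>z. fderiv (rep c X) z (Y p c)) (snd c p) v
    + fderiv (rep c X) (snd c p) (fderiv (rep c Y) (snd c p) v))"
proof -
  let ?O = "snd c ` fst c" and ?z = "snd c p"
  have O: "open ?O" "?z \<in> ?O" using open_img c by auto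
  note d = frechet_derivative_frechet_apply[OF O vf_smooth vf_has_derivative]
  have "((\<lambda>z. fderiv (rep c Y) z (rep c X z)
      - fderiv (rep c X) z (rep c Y z)) has_derivative
    (\<lambda>v. (fderiv (\<lambda>z. fderiv (rep c Y) z (rep c X ?z)) ?z v
      + fderiv (rep c Y) ?z (fderiv (rep c X) ?z v))
    - (fderiv (\<lambda>z. fderiv (rep c X) z (rep c Y ?z)) ?z v
      + fderiv (rep c X) ?z (fderiv (rep c Y) ?z v)))) (at ?z)"
    by (rule has_derivative_diff) (rule d[OF XY(2) c(1) XY(1) c(1) O(2)] d[OF XY(1) c(1) XY(2) c(1) O(2)])+
  then have "(rep c (lie_bracket A X Y) has_derivative
    (\<lambda>v. (fderiv (\<lambda>z. fderiv (rep c Y) z (rep c X ?z)) ?z v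
      + fderiv (rep c Y) ?z (fderiv (rep c X) ?z v))
    - (fderiv (\<lambda>z. fderiv (rep c X) z (rep c Y ?z)) ?z v
      + fderiv (rep c X) ?z (fderiv (rep c Y) ?z v)))) (at ?z)"
    by (rule has_derivative_transform_within_open[OF _ O]) (rule rep_bracket[OF c(1), symmetric])
  from frechet_derivative_at[OF this, symmetric] show ?thesis using c by simp
qed

text \<open>In a chart the products of first derivatives cancel by themselves, and the second
  derivatives of each field occur twice with opposite sign and exchanged directions, so symmetry
  removes them.\<close>

lemma jacobi:
  assumes XYZ: "X \<in> vector_fields A" "Y \<in> vector_fields A" "Z \<in> vector_fields A"
  shows "lie_bracket A X (lie_bracket A Y Z) + lie_bracket A Y (lie_bracket A Z X)
    + lie_bracket A Z (lie_bracket A X Y) = 0"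
proof (rule vf_eqI)
  fix p assume "p \<in> points A"
  then obtain c where c: "c \<in> A" "p \<in> fst c" by (auto simp: points_def)
  let ?z = "snd c p"
  have z: "?z \<in> snd c ` fst c" using c by simp
  have l: "linear (fderiv (rep c V) ?z)" if "V \<in> vector_fields A" for V
    using vf_smooth[OF that c(1)] smooth_on_linear_frechet z by blast
  have sym: "fderiv (\<lambda>z. fderiv (rep c V) z a) ?z b
     = fderiv (\<lambda>z. fderiv (rep c V) z b) ?z a" if "V \<in> vector_fields A" for V a b
    by (rule frechet_symmetric[OF vf_smooth[OF that c(1)] open_img[OF c(1)] z])
  note ll = linear_diff[OF l[OF XYZ(1)]] linear_diff[OF l[OF XYZ(2)]] linear_diff[OF l[OF XYZ(3)]]
  show "\<exists>c\<in>A. p \<in> fst c \<and> (lie_bracket A X (lie_bracket A Y Z) + lie_bracket A Y (lie_bracket A Z X)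
    + lie_bracket A Z (lie_bracket A X Y)) p c = 0 p c"
    by (rule bexI[OF _ c(1)])
      (use c XYZ sym[OF XYZ(1), of "Y p c" "Z p c"] sym[OF XYZ(2), of "Z p c" "X p c"]
          sym[OF XYZ(3), of "X p c" "Y p c"]
        in \<open>simp add: bracket_chart[OF c] rep_bracket_has_derivative ll\<close>)
qed (auto intro!: vf_add vf_bracket XYZ intro: vf_I simp: rep_def smooth_on_const)

section \<open>Vector fields as derivations of smooth functions\<close>

text \<open>The value 0 off the points makes agreement on the manifold the same as equality of total
  functions, so that identities can be stated in a real vector space; \<open>act\<close> is cut off
  for the same reason.\<close>

definition smooth_funs :: "('a \<Rightarrow> real) set" where
  "smooth_funs = {f. smooth_fun A f \<and> (\<forall>p. p \<notin> points A \<longrightarrow> f p = 0)}"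

definition act :: "('a \<Rightarrow> ('a, 'e) tvec) \<Rightarrow> ('a \<Rightarrow> real) \<Rightarrow> 'a \<Rightarrow> real" where
  "act X f = (\<lambda>p. if p \<in> points A then dir_deriv A p (X p) f else 0)"

lemma smooth_fun_has_derivative:
  "smooth_fun A f \<Longrightarrow> c \<in> A \<Longrightarrow> z \<in> snd c ` fst c \<Longrightarrow>
    ((f \<circ> chart_inv c) has_derivative fderiv (f \<circ> chart_inv c) z) (at z)"
  unfolding smooth_fun_def using smooth_on_has_derivative by blast

lemma act_chart:
  assumes "c \<in> A" "p \<in> fst c" "X \<in> vector_fields A" "smooth_fun A f"
  shows "act X f p = fderiv (f \<circ> chart_inv c) (snd c p) (X p c)"
  unfolding act_def using assms in_points
  by (simp add: dir_deriv_chart[OF _ _ vf_tangent smooth_fun_has_derivative])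

lemma act_rep:
  assumes "c \<in> A" "z \<in> snd c ` fst c" "X \<in> vector_fields A" "smooth_fun A f"
  shows "(act X f \<circ> chart_inv c) z = fderiv (f \<circ> chart_inv c) z (rep c X z)"
  using act_chart[OF assms(1) chart_inv_in[OF assms(1,2)] assms(3,4)] assms by (simp add: rep_def)

lemma smooth_fun_act:
  assumes "X \<in> vector_fields A" "smooth_fun A f"
  shows "smooth_fun A (act X f)"
  unfolding smooth_fun_def
proof
  fix c assume c: "c \<in> A"
  have "smooth_on (snd c ` fst c) (\<lambda>z. fderiv (f \<circ> chart_inv c) z (rep c X z))"
    by (rule smooth_on_frechet_apply[OF open_img[OF c] _ vf_smooth[OF assms(1) c]])
      (use assms(2) c in \<open>simp add: smooth_fun_def\<close>)
  then show "smooth_on (snd c ` fst c) (act X f \<circ> chart_inv c)"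
    by (rule smooth_on_cong[OF open_img[OF c], rotated]) (rule act_rep[OF c _ assms, symmetric])
qed

lemma act_closed: "X \<in> vector_fields A \<Longrightarrow> f \<in> smooth_funs \<Longrightarrow> act X f \<in> smooth_funs"
  by (simp add: smooth_funs_def smooth_fun_act) (simp add: act_def)

lemma smooth_funs_add: "f \<in> smooth_funs \<Longrightarrow> g \<in> smooth_funs \<Longrightarrow> f + g \<in> smooth_funs"
  by (auto simp: smooth_funs_def smooth_fun_def comp_def intro!: smooth_on_add open_img)

lemma smooth_funs_scale: "f \<in> smooth_funs \<Longrightarrow> r *\<^sub>R f \<in> smooth_funs"
  using smooth_on_cscaleR[OF open_img, of _ "f \<circ> chart_inv _" r]
  by (auto simp: smooth_funs_def smooth_fun_def comp_def)

lemma act_add_left: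
  assumes "X \<in> vector_fields A" "Y \<in> vector_fields A" "f \<in> smooth_funs"
  shows "act (X + Y) f = act X f + act Y f"
proof
  fix p show "act (X + Y) f p = (act X f + act Y f) p"
  proof (cases "p \<in> points A")
    case True
    then obtain c where c: "c \<in> A" "p \<in> fst c" by (auto simp: points_def)
    have f: "smooth_fun A f" using assms by (simp add: smooth_funs_def)
    have l: "linear (fderiv (f \<circ> chart_inv c) (snd c p))"
      using smooth_fun_has_derivative[OF f c(1)] has_derivative_linear c by blast
    show ?thesis using c assms f by (simp add: act_chart[OF c] vf_add linear_add[OF l])
  qed (simp add: act_def)
qed

lemma act_add_right:
  assumes "X \<in> vector_fields A" "f \<in> smooth_funs" "g \<in> smooth_funs"
  shows "act X (f + g) = act X f + act X g"
proof
  fix p show "act X (f + g) p = (act X f + act X g) p"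
  proof (cases "p \<in> points A")
    case True
    then obtain c where c: "c \<in> A" "p \<in> fst c" by (auto simp: points_def)
    have fg: "smooth_fun A f" "smooth_fun A g" "smooth_fun A (f + g)"
      using assms smooth_funs_add by (simp_all add: smooth_funs_def)
    have "((f + g) \<circ> chart_inv c) = (\<lambda>z. (f \<circ> chart_inv c) z + (g \<circ> chart_inv c) z)" by auto
    moreover have "f \<circ> chart_inv c differentiable at (snd c p)" "g \<circ> chart_inv c differentiable at (snd c p)"
      using smooth_fun_has_derivative[OF _ c(1)] fg c unfolding differentiable_def by blast+
    ultimately show ?thesis
      using c assms fg by (simp add: act_chart[OF c] frechet_derivative_add del: comp_apply)
  qed (simp add: act_def)
qed

text \<open>The Hessian of \<open>f\<close> occurs in both orders of differentiation and cancels by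
  symmetry; what is left is the differential of \<open>f\<close> on the coordinate bracket.\<close>

lemma act_bracket:
  assumes XY: "X \<in> vector_fields A" "Y \<in> vector_fields A" and f: "f \<in> smooth_funs"
  shows "act (lie_bracket A X Y) f = act X (act Y f) - act Y (act X f)"
proof
  fix p show "act (lie_bracket A X Y) f p = (act X (act Y f) - act Y (act X f)) p"
  proof (cases "p \<in> points A")
    case True
    then obtain c where c: "c \<in> A" "p \<in> fst c" by (auto simp: points_def)
    let ?O = "snd c ` fst c" and ?z = "snd c p" and ?f = "f \<circ> chart_inv c"
    have O: "open ?O" "?z \<in> ?O" using open_img c by auto
    have sf: "smooth_fun A f" using f by (simp add: smooth_funs_def)
    have fO: "smooth_on ?O ?f" using sf c by (simp add: smooth_fun_def)
    have *: "act V (act W f) p = fderiv (\<lambda>z. fderiv ?f z (W p c)) ?z (V p c)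
       + fderiv ?f ?z (fderiv (rep c W) ?z (V p c))"
      if V: "V \<in> vector_fields A" and W: "W \<in> vector_fields A" for V W
    proof -
      have "((act W f \<circ> chart_inv c) has_derivative (\<lambda>v.
          fderiv (\<lambda>z. fderiv ?f z (rep c W ?z)) ?z v
        + fderiv ?f ?z (fderiv (rep c W) ?z v))) (at ?z)"
        by (rule has_derivative_transform_within_open[OF
              frechet_derivative_frechet_apply[OF O fO vf_has_derivative[OF W c(1) O(2)]] O])
          (rule act_rep[OF c(1) _ W sf, symmetric])
      from frechet_derivative_at[OF this, symmetric] show ?thesis
        using c by (simp add: act_chart[OF c V smooth_fun_act[OF W sf]])
    qed
    have l: "linear (fderiv ?f ?z)"
      by (rule smooth_on_linear_frechet[OF fO O(2)])
    show ?thesis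
      using *[OF XY] *[OF XY(2,1)] frechet_symmetric[OF fO O, of "X p c" "Y p c"]
      by (simp add: act_chart[OF c vf_bracket[OF XY] sf] bracket_chart[OF c] linear_diff[OF l])
  qed (simp add: act_def)
qed

end

section \<open>The slit tangent bundle\<close>

text \<open>The extra axiom, a consequence of the Hausdorff property, is what allows bump functions supported
  in a chart to be extended by zero.\<close>

locale manifold = atlas A for A :: "('a, 'e::euclidean_space) chart set" +
  assumes open_off_compact: "c \<in> A \<Longrightarrow> compact C \<Longrightarrow> C \<subseteq> snd c ` fst c \<Longrightarrow> d \<in> A \<Longrightarrow>
    open (snd d ` {q \<in> fst d. \<not> (q \<in> fst c \<and> snd c q \<in> C)})"

text \<open>A compact part of a chart image corresponds to a compact subset of \<open>M\<close>,
  which is closed by the Hausdorff property. Removing it from another chart domain therefore leaves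
  an open set.\<close>

lemma smooth_manifold_imp_manifold:
  fixes A :: "('a, 'e::euclidean_space) chart set"
  assumes M: "smooth_manifold M A"
  shows "manifold A"
proof -
  have chart: "openin M (fst c)" "open (snd c ` fst c)"
    "homeomorphic_map (subtopology M (fst c)) (top_of_set (snd c ` fst c)) (snd c)" if "c \<in> A" for c
    using M that unfolding smooth_manifold_def by blast+
  have sub: "fst c \<subseteq> topspace M" if "c \<in> A" for c
    using chart(1)[OF that] openin_subset by blast
  have opn: "open (snd c ` U)" if "c \<in> A" "openin M U" "U \<subseteq> fst c" for c U
  proof -
    have "openin (subtopology M (fst c)) U"
      using that by (metis inf.absorb_iff1 openin_subtopology)
    moreover have "open_map (subtopology M (fst c)) (top_of_set (snd c ` fst c)) (snd c)"
      using chart(3)[OF that(1)] homeomorphic_imp_open_map by blast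
    ultimately have "openin (top_of_set (snd c ` fst c)) (snd c ` U)"
      by (simp add: open_map_def)
    then show ?thesis using chart(2)[OF that(1)] openin_open_trans by blast
  qed
  have inj: "inj_on (snd c) (fst c)" if "c \<in> A" for c
    using homeomorphic_imp_injective_map[OF chart(3)[OF that]] sub[OF that]
    by (simp add: inf.absorb2)
  have at: "atlas A"
  proof
    show "open (snd c ` (fst c \<inter> fst d))" if "c \<in> A" "d \<in> A" for c d
      by (rule opn[OF that(1) openin_Int[OF chart(1)[OF that(1)] chart(1)[OF that(2)]]]) simp
    show "smooth_on (snd c ` (fst c \<inter> fst d)) (snd d \<circ> chart_inv c)" if "c \<in> A" "d \<in> A" for c d
      using M that by (simp add: smooth_manifold_def)
  qed (rule inj)
  interpret atlas A by (rule at)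
  show ?thesis
  proof (intro manifold.intro at manifold_axioms.intro)
    fix c d and C :: "'e set"
    assume c: "c \<in> A" and C: "compact C" "C \<subseteq> snd c ` fst c" and d: "d \<in> A"
    let ?K = "{q \<in> fst c. snd c q \<in> C}"
    obtain g where g: "homeomorphic_maps (subtopology M (fst c)) (top_of_set (snd c ` fst c)) (snd c) g"
      using chart(3)[OF c] homeomorphic_map_maps by blast
    have gc: "continuous_map (top_of_set (snd c ` fst c)) (subtopology M (fst c)) g"
      and gi: "\<And>q. q \<in> topspace (subtopology M (fst c)) \<Longrightarrow> g (snd c q) = q"
      using g unfolding homeomorphic_maps_def by blast+
    have "continuous_map (top_of_set (snd c ` fst c)) M g"
      using gc continuous_map_into_fulltopology by blast
    moreover have "compactin (top_of_set (snd c ` fst c)) C"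
      using C by (simp add: compactin_subtopology)
    ultimately have "compactin M (g ` C)" using image_compactin by metis
    moreover have "g ` C = ?K"
    proof -
      have g': "g (snd c q) = q" if "q \<in> fst c" for q
        using gi[of q] that sub[OF c] by auto
      show ?thesis using C(2) g' by (auto simp: image_iff) (metis (no_types, lifting) imageE subsetD g')
    qed
    moreover have "Hausdorff_space M" using M by (simp add: smooth_manifold_def)
    ultimately have "closedin M ?K" using compactin_imp_closedin by metis
    then have "openin M (fst d - ?K)" by (rule openin_diff[OF chart(1)[OF d]])
    then have "open (snd d ` (fst d - ?K))" by (rule opn[OF d]) auto
    moreover have "fst d - ?K = {q \<in> fst d. \<not> (q \<in> fst c \<and> snd c q \<in> C)}" by auto
    ultimately show "open (snd d ` {q \<in> fst d. \<not> (q \<in> fst c \<and> snd c q \<in> C)})" by simp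
  qed
qed

lemma open_Compl_zero: "open (- {0::'e::euclidean_space})"
  by (simp add: open_Compl)

context manifold
begin

section \<open>The induced atlas of nonzero tangent vectors\<close>

abbreviation "sc \<equiv> slit_chart A"

lemma fst_sc: "fst (sc c) = {u \<in> slit A. fst u \<in> fst c}"
  by (simp add: slit_chart_def)

lemma snd_sc: "snd (sc c) u = (snd c (fst u), snd u c)"
  by (simp add: slit_chart_def)

lemma slit_iff: "u \<in> slit A \<longleftrightarrow> fst u \<in> points A \<and> snd u \<in> tangent_space A (fst u) \<and> snd u \<noteq> 0"
  by (auto simp: slit_def tangent_bundle_def)

lemma slit_nonzero:
  assumes "u \<in> slit A" "c \<in> A" "fst u \<in> fst c"
  shows "snd u c \<noteq> 0"
  using tangent_eqI[of "snd u" "fst u" 0 c] assms by (auto simp: slit_iff)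

lemma tvec_of_in_slit:
  assumes "c \<in> A" "p \<in> fst c" "y \<noteq> 0"
  shows "(p, tvec_of c p y) \<in> slit A"
proof -
  have "tvec_of c p y \<noteq> 0" using tvec_of_self[OF assms(1,2), of y] assms(3) by force
  then show ?thesis
    using tvec_of_tangent[OF assms(1,2)] in_points[OF assms(1,2)] by (simp add: slit_iff)
qed

lemma inj_sc: "c \<in> A \<Longrightarrow> inj_on (snd (sc c)) (fst (sc c))"
proof (rule inj_onI)
  fix u w assume c: "c \<in> A" and u: "u \<in> fst (sc c)" and w: "w \<in> fst (sc c)" and eq: "snd (sc c) u = snd (sc c) w"
  have "fst u = fst w"
    using inj_onD[OF inj_chart[OF c], of "fst u" "fst w"] u w eq by (simp add: fst_sc snd_sc)
  moreover from this have "snd u = snd w"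
    using tangent_eqI[of "snd u" "fst u" "snd w" c] u w eq c by (simp add: fst_sc snd_sc slit_iff)
  ultimately show "u = w" by (simp add: prod_eq_iff)
qed

text \<open>A nonzero tangent vector has a nonzero coordinate in every chart around its base point,
  and every nonzero \<open>y\<close> is the coordinate of \<open>tvec_of c p y\<close>; so the fibre
  coordinates fill the punctured space.\<close>

lemma overlap_sc:
  assumes "c \<in> A"
  shows "snd (sc c) ` (fst (sc c) \<inter> fst (sc d)) = (snd c ` (fst c \<inter> fst d)) \<times> (- {0})"
proof
  show "snd (sc c) ` (fst (sc c) \<inter> fst (sc d)) \<subseteq> (snd c ` (fst c \<inter> fst d)) \<times> (- {0})"
  proof (rule image_subsetI)
    fix u assume "u \<in> fst (sc c) \<inter> fst (sc d)"
    then have u: "u \<in> slit A" "fst u \<in> fst c" "fst u \<in> fst d" by (simp_all add: fst_sc)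
    then show "snd (sc c) u \<in> (snd c ` (fst c \<inter> fst d)) \<times> (- {0})"
      using slit_nonzero[OF u(1) assms u(2)] by (simp add: snd_sc)
  qed
  show "(snd c ` (fst c \<inter> fst d)) \<times> (- {0}) \<subseteq> snd (sc c) ` (fst (sc c) \<inter> fst (sc d))"
  proof
    fix z assume "z \<in> (snd c ` (fst c \<inter> fst d)) \<times> (- {0::'e})"
    then obtain p y where p: "p \<in> fst c" "p \<in> fst d" "y \<noteq> 0" "z = (snd c p, y)" by auto
    have "(p, tvec_of c p y) \<in> fst (sc c) \<inter> fst (sc d)" "snd (sc c) (p, tvec_of c p y) = z"
      using p assms tvec_of_in_slit by (auto simp: fst_sc snd_sc)
    then show "z \<in> snd (sc c) ` (fst (sc c) \<inter> fst (sc d))" by force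
  qed
qed

lemma img_sc: "c \<in> A \<Longrightarrow> snd (sc c) ` fst (sc c) = (snd c ` fst c) \<times> (- {0})"
  using overlap_sc[of c c] by simp

lemma chart_inv_sc:
  assumes "c \<in> A" "x \<in> snd c ` fst c" "y \<noteq> 0"
  shows "chart_inv (sc c) (x, y) = (chart_inv c x, tvec_of c (chart_inv c x) y)"
proof -
  let ?u = "(chart_inv c x, tvec_of c (chart_inv c x) y)"
  have p: "chart_inv c x \<in> fst c" using chart_inv_in assms by blast
  have "?u \<in> fst (sc c)" using tvec_of_in_slit[OF assms(1) p assms(3)] p by (simp add: fst_sc)
  moreover have "snd (sc c) ?u = (x, y)" using assms p by (simp add: snd_sc)
  ultimately show ?thesis
    using inv_into_f_f[OF inj_sc[OF assms(1)]] unfolding chart_inv_def by metis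
qed

abbreviation "transition c d \<equiv> snd d \<circ> chart_inv c"

lemma transition_sc:
  assumes "c \<in> A" "d \<in> A" "z \<in> (snd c ` (fst c \<inter> fst d)) \<times> (- {0})"
  shows "(snd (sc d) \<circ> chart_inv (sc c)) z = (transition c d (fst z), fderiv (transition c d) (fst z) (snd z))"
proof -
  obtain p y where p: "p \<in> fst c" "p \<in> fst d" "y \<noteq> 0" "z = (snd c p, y)" using assms(3) by auto
  then have "chart_inv (sc c) z = (p, tvec_of c p y)" using assms(1) chart_inv_sc by simp
  then show ?thesis using p assms by (simp add: snd_sc tvec_of_def jac_def)
qed

lemma smooth_fst_compose:
  assumes "open S" "open T" "smooth_on T f" "S \<subseteq> T \<times> UNIV"
  shows "smooth_on S (\<lambda>z::'e \<times> 'e. (f :: 'e \<Rightarrow> 'c::real_normed_vector) (fst z))"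
  by (rule smooth_on_compose[OF assms(1,2,3) smooth_on_linear[OF bounded_linear_fst]]) (use assms(4) in auto)

lemma smooth_transition_sc:
  assumes "c \<in> A" "d \<in> A"
  shows "smooth_on ((snd c ` (fst c \<inter> fst d)) \<times> (- {0})) (snd (sc d) \<circ> chart_inv (sc c))"
proof -
  let ?S = "(snd c ` (fst c \<inter> fst d)) \<times> (- {0::'e})" and ?O = "snd c ` (fst c \<inter> fst d)"
  have S: "open ?S" using open_overlap[OF assms] by (intro open_Times open_Compl_zero)
  have O: "open ?O" using open_overlap[OF assms] .
  note st = smooth_transition[OF assms]
  have "smooth_on ?S (\<lambda>z. (transition c d (fst z), fderiv (transition c d) (fst z) (snd z)))"
  proof (rule smooth_on_Pair[OF S])
    show "smooth_on ?S (\<lambda>z. transition c d (fst z))" by (rule smooth_fst_compose[OF S O st]) auto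
    show "smooth_on ?S (\<lambda>z. fderiv (transition c d) (fst z) (snd z))"
    proof (rule smooth_on_apply[OF S, where F = "\<lambda>z. fderiv (transition c d) (fst z)" and g = snd])
      show "linear (fderiv (transition c d) (fst z))" if "z \<in> ?S" for z
        using that by (intro smooth_on_linear_frechet[OF st]) auto
      show "smooth_on ?S (\<lambda>z. fderiv (transition c d) (fst z) b)" for b
        by (rule smooth_fst_compose[OF S O smooth_on_frechet[OF st]]) auto
      show "smooth_on ?S snd" by (rule smooth_on_linear[OF bounded_linear_snd])
    qed
  qed
  then show ?thesis
    by (rule smooth_on_cong[OF S, rotated]) (rule transition_sc[OF assms, symmetric])
qed

sublocale slit: atlas "slit_atlas A"
proof
  fix c' assume "c' \<in> slit_atlas A"
  then obtain c where c: "c \<in> A" "c' = sc c" by (auto simp: slit_atlas_def)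
  show "inj_on (snd c') (fst c')" using inj_sc c by simp
  fix d' assume "d' \<in> slit_atlas A"
  then obtain d where d: "d \<in> A" "d' = sc d" by (auto simp: slit_atlas_def)
  show "open (snd c' ` (fst c' \<inter> fst d'))"
    unfolding c(2) d(2) overlap_sc[OF c(1)]
    by (rule open_Times[OF open_overlap[OF c(1) d(1)] open_Compl_zero])
  show "smooth_on (snd c' ` (fst c' \<inter> fst d')) (snd d' \<circ> chart_inv c')"
    using smooth_transition_sc[OF c(1) d(1)] by (simp add: c d overlap_sc)
qed

lemma sc_in [simp]: "c \<in> A \<Longrightarrow> sc c \<in> slit_atlas A"
  by (simp add: slit_atlas_def)

lemma slit_atlas_cases: "c' \<in> slit_atlas A \<Longrightarrow> (\<And>c. c \<in> A \<Longrightarrow> c' = sc c \<Longrightarrow> thesis) \<Longrightarrow> thesis"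
  by (auto simp: slit_atlas_def)

lemma slit_chart_ex: "u \<in> slit A \<Longrightarrow> \<exists>c\<in>A. fst u \<in> fst c"
  by (simp add: slit_iff points_def)

lemma points_slit_atlas [simp]: "points (slit_atlas A) = slit A"
proof -
  have "u \<in> points (slit_atlas A) \<longleftrightarrow> (\<exists>c\<in>A. u \<in> slit A \<and> fst u \<in> fst c)" for u
    by (simp add: points_def slit_atlas_def fst_sc)
  then show ?thesis using slit_chart_ex by blast
qed

lemma in_sc: "u \<in> slit A \<Longrightarrow> fst u \<in> fst c \<Longrightarrow> u \<in> fst (sc c)"
  by (simp add: fst_sc)

text \<open>The matrix is block triangular. The base component transforms by itself, which makes
  \<open>rho\<close> well defined, and the second derivative of the transition map acts on the base
  component only, so that vertical vectors (0, x) transform like tangent vectors of the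
  base.\<close>

lemma slit_jac:
  assumes cd: "c \<in> A" "d \<in> A" and u: "u \<in> slit A" "fst u \<in> fst c" "fst u \<in> fst d"
  shows "slit.jac (sc c) (sc d) u v = (jac c d (fst u) (fst v),
     fderiv (\<lambda>x. fderiv (transition c d) x (snd u c)) (snd c (fst u)) (fst v)
       + jac c d (fst u) (snd v))"
proof -
  let ?S = "(snd c ` (fst c \<inter> fst d)) \<times> (- {0::'e})" and ?z = "snd (sc c) u"
  have zS: "?z \<in> ?S" using overlap_sc[OF cd(1), of d] u by (auto simp: fst_sc)
  have S: "open ?S" using open_overlap[OF cd] by (intro open_Times open_Compl_zero)
  note st = smooth_transition[OF cd]
  have fz: "fst ?z = snd c (fst u)" "snd ?z = snd u c" by (simp_all add: snd_sc)
  have zO: "fst ?z \<in> snd c ` (fst c \<inter> fst d)" using zS by auto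
  have fd: "(fst has_derivative fst) (at ?z)" "(snd has_derivative snd) (at ?z)"
    by (intro bounded_linear_imp_has_derivative bounded_linear_fst bounded_linear_snd)+
  have 1: "((\<lambda>z. transition c d (fst z)) has_derivative (\<lambda>v. fderiv (transition c d) (fst ?z) (fst v))) (at ?z)"
    by (rule has_derivative_compose[OF fd(1) smooth_on_has_derivative[OF st zO]])
  have 2: "((\<lambda>z. fderiv (transition c d) (fst z) (snd z)) has_derivative
     (\<lambda>v. fderiv (\<lambda>x. fderiv (transition c d) x (snd ?z)) (fst ?z) (fst v)
       + fderiv (transition c d) (fst ?z) (snd v))) (at ?z)"
  proof (rule has_derivative_apply[OF S zS, where F = "\<lambda>z. fderiv (transition c d) (fst z)"
        and F' = "\<lambda>b v. fderiv (\<lambda>x. fderiv (transition c d) x b) (fst ?z) (fst v)"])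
    show "linear (fderiv (transition c d) (fst z))" if "z \<in> ?S" for z
      using that by (intro smooth_on_linear_frechet[OF st]) auto
    show "((\<lambda>z. fderiv (transition c d) (fst z) b) has_derivative
        (\<lambda>v. fderiv (\<lambda>x. fderiv (transition c d) x b) (fst ?z) (fst v))) (at ?z)" for b
      by (rule has_derivative_compose[OF fd(1) smooth_on_has_derivative[OF smooth_on_frechet[OF st] zO]])
    show "(snd has_derivative snd) (at ?z)" by (rule fd)
  qed
  have "((snd (sc d) \<circ> chart_inv (sc c)) has_derivative (\<lambda>v. (fderiv (transition c d) (fst ?z) (fst v),
     fderiv (\<lambda>x. fderiv (transition c d) x (snd ?z)) (fst ?z) (fst v)
       + fderiv (transition c d) (fst ?z) (snd v)))) (at ?z)"
    by (rule has_derivative_transform_within_open[OF has_derivative_Pair[OF 1 2] S zS])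
      (rule transition_sc[OF cd, symmetric])
  from frechet_derivative_at[OF this, symmetric] show ?thesis
    by (simp add: slit.jac_def jac_def fz)
qed

section \<open>Projection and vertical lift at a point\<close>

lemma rho_chart:
  assumes a: "a \<in> tangent_space (slit_atlas A) u" and u: "u \<in> slit A" and d: "d \<in> A" "fst u \<in> fst d"
  shows "rho A u a d = fst (a (sc d))"
proof -
  let ?c = "chart_at (slit_atlas A) u"
  have c: "?c \<in> slit_atlas A" "u \<in> fst ?c" using slit.chart_at u by auto
  have du: "u \<in> fst (sc d)" using u d by (simp add: fst_sc)
  have "(fst has_derivative fst) (at (snd (sc d) u))"
    by (rule bounded_linear_imp_has_derivative[OF bounded_linear_fst])
  then have "(((snd d \<circ> fst) \<circ> chart_inv (sc d)) has_derivative fst) (at (snd (sc d) u))"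
  proof (rule has_derivative_transform_within_open[OF _ slit.open_img[OF sc_in[OF d(1)]]])
    show "fst z = ((snd d \<circ> fst) \<circ> chart_inv (sc d)) z" if "z \<in> snd (sc d) ` fst (sc d)" for z
      using slit.snd_chart_inv[OF sc_in[OF d(1)] that] by (simp add: snd_sc) (metis fst_conv)
  qed (use du in simp)
  from slit.change_chart_has_derivative[OF c(1) sc_in[OF d(1)] c(2) du this]
  have "fderiv ((snd d \<circ> fst) \<circ> chart_inv ?c) (snd ?c u) = (\<lambda>v. fst (slit.jac ?c (sc d) u v))"
    by (rule frechet_derivative_at[symmetric])
  then have "rho A u a d = fst (slit.jac ?c (sc d) u (a ?c))"
    using d by (simp add: rho_def differential_def Let_def)
  also have "slit.jac ?c (sc d) u (a ?c) = a (sc d)"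
    using slit.tangent_change[OF a c(1) sc_in[OF d(1)] c(2) du] by simp
  finally show ?thesis .
qed

lemma rho_outside: "\<not> (d \<in> A \<and> fst u \<in> fst d) \<Longrightarrow> rho A u a d = 0"
  by (auto simp: rho_def differential_def)

lemma rho_tangent:
  assumes a: "a \<in> tangent_space (slit_atlas A) u" and u: "u \<in> slit A"
  shows "rho A u a \<in> tangent_space A (fst u)"
proof (rule tangent_I)
  show "rho A u a c = 0" if "\<not> (c \<in> A \<and> fst u \<in> fst c)" for c
    using that by (rule rho_outside)
  show "rho A u a d = jac c d (fst u) (rho A u a c)"
    if cd: "c \<in> A" "d \<in> A" "fst u \<in> fst c" "fst u \<in> fst d" for c d
    using slit.tangent_change[OF a sc_in[OF cd(1)] sc_in[OF cd(2)] in_sc[OF u cd(3)] in_sc[OF u cd(4)]]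
    by (simp add: rho_chart[OF a u] cd slit_jac[OF cd(1,2) u cd(3,4)])
qed

lemma gamma_chart:
  assumes "u \<in> slit A" "c \<in> A" "fst u \<in> fst c"
  shows "gamma A u x (sc c) = (0, x c)"
proof -
  have "((\<lambda>t. (snd c (fst u), snd u c + t *\<^sub>R x c)) has_vector_derivative (0, x c)) (at 0)"
    by (auto intro!: derivative_eq_intros has_vector_derivative_Pair)
  moreover have "snd (sc c) \<circ> (\<lambda>t. (fst u, snd u + t *\<^sub>R x)) = (\<lambda>t. (snd c (fst u), snd u c + t *\<^sub>R x c))"
    by (auto simp: snd_sc)
  ultimately show ?thesis
    using assms by (simp add: gamma_def velocity_at_0_def vector_derivative_at in_sc)
qed

lemma gamma_tangent:
  assumes u: "u \<in> slit A" and x: "x \<in> tangent_space A (fst u)"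
  shows "gamma A u x \<in> tangent_space (slit_atlas A) u"
proof (rule slit.tangent_I)
  show "gamma A u x c = 0" if "\<not> (c \<in> slit_atlas A \<and> u \<in> fst c)" for c
    using that by (auto simp: gamma_def velocity_at_0_def)
  fix c' d' assume cd': "c' \<in> slit_atlas A" "d' \<in> slit_atlas A" "u \<in> fst c'" "u \<in> fst d'"
  then obtain c d where cd: "c \<in> A" "d \<in> A" "c' = sc c" "d' = sc d"
    by (auto elim!: slit_atlas_cases)
  then have ud: "fst u \<in> fst c" "fst u \<in> fst d" using cd' by (simp_all add: fst_sc)
  have "linear (fderiv (\<lambda>x. fderiv (transition c d) x (snd u c)) (snd c (fst u)))"
    by (rule smooth_on_linear_frechet[OF smooth_on_frechet[OF smooth_transition[OF cd(1,2)]]]) (use ud in auto)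
  then show "gamma A u x d' = slit.jac c' d' u (gamma A u x c')"
    unfolding cd(3,4) gamma_chart[OF u cd(1) ud(1)] gamma_chart[OF u cd(2) ud(2)]
      slit_jac[OF cd(1,2) u ud]
    by (simp add: linear_0 linear_0[OF linear_jac[OF cd(1,2) ud]] tangent_change[OF x cd(1,2) ud])
qed

lemma slit_tangent_eqI:
  assumes "a \<in> tangent_space (slit_atlas A) u" "b \<in> tangent_space (slit_atlas A) u" "u \<in> slit A"
    "c \<in> A" "fst u \<in> fst c" "a (sc c) = b (sc c)"
  shows "a = b"
  by (rule slit.tangent_eqI[OF assms(1,2) sc_in[OF assms(4)] in_sc[OF assms(3,5)] assms(6)])

lemma rho_gamma:
  assumes u: "u \<in> slit A" and x: "x \<in> tangent_space A (fst u)"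
  shows "rho A u (gamma A u x) = 0"
proof
  fix d show "rho A u (gamma A u x) d = 0 d"
    using rho_outside[of d u] rho_chart[OF gamma_tangent[OF u x] u] gamma_chart[OF u]
    by (cases "d \<in> A \<and> fst u \<in> fst d") auto
qed

lemma vertical_is_gamma:
  assumes a: "a \<in> tangent_space (slit_atlas A) u" and u: "u \<in> slit A" and 0: "rho A u a = 0"
  obtains x where "x \<in> tangent_space A (fst u)" "a = gamma A u x"
proof -
  obtain c where c: "c \<in> A" "fst u \<in> fst c" using slit_chart_ex u by blast
  let ?x = "tvec_of c (fst u) (snd (a (sc c)))"
  have x: "?x \<in> tangent_space A (fst u)" using tvec_of_tangent c by blast
  have "fst (a (sc c)) = 0" using rho_chart[OF a u c] 0 by simp
  then have "a (sc c) = gamma A u ?x (sc c)"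
    using c by (simp add: gamma_chart[OF u c] prod_eq_iff)
  then have "a = gamma A u ?x" by (rule slit_tangent_eqI[OF a gamma_tangent[OF u x] u c])
  then show thesis using that x by blast
qed

lemma gamma_inj:
  assumes "u \<in> slit A" "x \<in> tangent_space A (fst u)" "y \<in> tangent_space A (fst u)" "gamma A u x = gamma A u y"
  shows "x = y"
proof -
  obtain c where c: "c \<in> A" "fst u \<in> fst c" using slit_chart_ex assms(1) by blast
  have "x c = y c" using gamma_chart[OF assms(1) c, of x] gamma_chart[OF assms(1) c, of y] assms(4) by simp
  then show ?thesis by (rule tangent_eqI[OF assms(2,3) c])
qed

lemma gamma_add:
  assumes u: "u \<in> slit A" and xy: "x \<in> tangent_space A (fst u)" "y \<in> tangent_space A (fst u)"
  shows "gamma A u (x + y) = gamma A u x + gamma A u y"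
proof -
  obtain c where c: "c \<in> A" "fst u \<in> fst c" using slit_chart_ex u by blast
  show ?thesis
    by (rule slit_tangent_eqI[OF gamma_tangent[OF u tangent_add[OF xy]]
          slit.tangent_add[OF gamma_tangent[OF u xy(1)] gamma_tangent[OF u xy(2)]] u c])
      (simp add: gamma_chart[OF u c])
qed

lemma gamma_scale:
  assumes u: "u \<in> slit A" and x: "x \<in> tangent_space A (fst u)"
  shows "gamma A u (r *\<^sub>R x) = r *\<^sub>R gamma A u x"
proof -
  obtain c where c: "c \<in> A" "fst u \<in> fst c" using slit_chart_ex u by blast
  show ?thesis
    by (rule slit_tangent_eqI[OF gamma_tangent[OF u tangent_scale[OF x]]
          slit.tangent_scale[OF gamma_tangent[OF u x]] u c])
      (simp add: gamma_chart[OF u c])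
qed

lemma rho_add:
  assumes u: "u \<in> slit A" and ab: "a \<in> tangent_space (slit_atlas A) u" "b \<in> tangent_space (slit_atlas A) u"
  shows "rho A u (a + b) = rho A u a + rho A u b"
proof
  fix d show "rho A u (a + b) d = (rho A u a + rho A u b) d"
    using rho_outside[of d u] rho_chart[OF ab(1) u] rho_chart[OF ab(2) u]
      rho_chart[OF slit.tangent_add[OF ab] u]
    by (cases "d \<in> A \<and> fst u \<in> fst d") auto
qed

lemma rho_uminus:
  assumes u: "u \<in> slit A" and a: "a \<in> tangent_space (slit_atlas A) u"
  shows "rho A u (- a) = - rho A u a"
proof
  fix d show "rho A u (- a) d = (- rho A u a) d"
    using rho_outside[of d u] rho_chart[OF a u] rho_chart[OF slit.tangent_uminus[OF a] u]
    by (cases "d \<in> A \<and> fst u \<in> fst d") auto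
qed

section \<open>Smooth sections of the pullback bundle\<close>

text \<open>The counterpart of \<open>rep\<close> for \<pi>-vector fields, which take their
  components in a base chart but depend on the coordinates of a slit chart.\<close>

definition prep :: "('a, 'e) chart \<Rightarrow> ('a, 'e) pi_field \<Rightarrow> 'e \<times> 'e \<Rightarrow> 'e" where
  "prep c X = (\<lambda>z. X (chart_inv (sc c) z) c)"

abbreviation "simg c \<equiv> snd (sc c) ` fst (sc c)"

lemma open_simg: "c \<in> A \<Longrightarrow> open (simg c)"
  using slit.open_img by simp

lemma simg_slit: "c \<in> A \<Longrightarrow> z \<in> simg c \<Longrightarrow> chart_inv (sc c) z \<in> slit A \<and> fst (chart_inv (sc c) z) \<in> fst c"
  using slit.chart_inv_in[OF sc_in] by (auto simp: fst_sc)

lemma in_simg: "u \<in> slit A \<Longrightarrow> fst u \<in> fst c \<Longrightarrow> snd (sc c) u \<in> simg c"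
  using in_sc by simp

lemma chart_inv_sc_snd [simp]: "c \<in> A \<Longrightarrow> u \<in> slit A \<Longrightarrow> fst u \<in> fst c \<Longrightarrow> chart_inv (sc c) (snd (sc c) u) = u"
  using slit.chart_inv_snd[OF sc_in] in_sc by simp

lemma prep_snd [simp]: "c \<in> A \<Longrightarrow> u \<in> slit A \<Longrightarrow> fst u \<in> fst c \<Longrightarrow> prep c X (snd (sc c) u) = X u c"
  by (simp add: prep_def)

lemma pf_tangent: "X \<in> pi_fields A \<Longrightarrow> u \<in> slit A \<Longrightarrow> X u \<in> tangent_space A (fst u)"
  by (simp add: pi_fields_def)

lemma pf_zero: "X \<in> pi_fields A \<Longrightarrow> u \<notin> slit A \<Longrightarrow> X u = 0"
  unfolding pi_fields_def by blast

lemma pf_smooth: "X \<in> pi_fields A \<Longrightarrow> c \<in> A \<Longrightarrow> smooth_on (simg c) (prep c X)"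
  by (simp add: pi_fields_def prep_def)

lemma pf_has_derivative:
  "X \<in> pi_fields A \<Longrightarrow> c \<in> A \<Longrightarrow> z \<in> simg c \<Longrightarrow>
    (prep c X has_derivative fderiv (prep c X) z) (at z)"
  using pf_smooth smooth_on_has_derivative by blast

lemma pf_I:
  "(\<And>u. u \<in> slit A \<Longrightarrow> X u \<in> tangent_space A (fst u)) \<Longrightarrow> (\<And>u. u \<notin> slit A \<Longrightarrow> X u = 0) \<Longrightarrow>
    (\<And>c. c \<in> A \<Longrightarrow> smooth_on (simg c) (prep c X)) \<Longrightarrow> X \<in> pi_fields A"
  by (simp add: pi_fields_def prep_def)

lemma pf_I_rep:
  assumes "\<And>u. u \<in> slit A \<Longrightarrow> X u \<in> tangent_space A (fst u)" "\<And>u. u \<notin> slit A \<Longrightarrow> X u = 0"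
    "\<And>c. c \<in> A \<Longrightarrow> smooth_on (simg c) (f c)"
    "\<And>c u. c \<in> A \<Longrightarrow> u \<in> slit A \<Longrightarrow> fst u \<in> fst c \<Longrightarrow> X u c = f c (snd (sc c) u)"
  shows "X \<in> pi_fields A"
proof (rule pf_I[OF assms(1,2)])
  fix c assume c: "c \<in> A"
  show "smooth_on (simg c) (prep c X)"
    by (rule smooth_on_cong[OF open_simg[OF c] _ assms(3)[OF c]])
      (use assms(4)[OF c] simg_slit[OF c] slit.snd_chart_inv[OF sc_in[OF c]] in \<open>simp add: prep_def\<close>)
qed

lemma pf_eqI:
  assumes "X \<in> pi_fields A" "Y \<in> pi_fields A"
    "\<And>u c. u \<in> slit A \<Longrightarrow> c \<in> A \<Longrightarrow> fst u \<in> fst c \<Longrightarrow> X u c = Y u c"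
  shows "X = Y"
proof
  fix u show "X u = Y u"
    using assms slit_chart_ex[of u] tangent_eqI[OF pf_tangent[OF assms(1)] pf_tangent[OF assms(2)]] pf_zero
    by (cases "u \<in> slit A") metis+
qed

lemma pf_add:
  assumes "X \<in> pi_fields A" "Y \<in> pi_fields A"
  shows "X + Y \<in> pi_fields A"
  by (rule pf_I_rep[where f = "\<lambda>c z. prep c X z + prep c Y z"])
    (use assms in \<open>simp_all add: pf_tangent tangent_add pf_zero pf_smooth smooth_on_add[OF open_simg] fun_eq_iff[of "_ + _"] fun_eq_iff[of "_ *\<^sub>R _"]\<close>)

lemma pf_scale:
  assumes "X \<in> pi_fields A"
  shows "r *\<^sub>R X \<in> pi_fields A"
  by (rule pf_I_rep[where f = "\<lambda>c z. r *\<^sub>R prep c X z"])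
    (use assms in \<open>simp_all add: pf_tangent tangent_scale pf_zero pf_smooth smooth_on_cscaleR[OF open_simg] fun_eq_iff[of "_ + _"] fun_eq_iff[of "_ *\<^sub>R _"]\<close>)

lemma pf_uminus: "X \<in> pi_fields A \<Longrightarrow> - X \<in> pi_fields A"
  using pf_scale[of X "-1"] by simp

lemma pf_diff: "X \<in> pi_fields A \<Longrightarrow> Y \<in> pi_fields A \<Longrightarrow> X - Y \<in> pi_fields A"
  using pf_add[of X "- Y"] pf_uminus[of Y] by simp

lemma pf_0: "0 \<in> pi_fields A"
  by (rule pf_I_rep[where f = "\<lambda>c z. 0"]) (simp_all add: smooth_on_const)

lemma eta_pf: "eta A \<in> pi_fields A"
  by (rule pf_I_rep[where f = "\<lambda>c. snd"])
    (auto simp: eta_def on_slit_def slit_iff snd_sc smooth_on_linear[OF bounded_linear_snd])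

lemma tm_I_rep:
  assumes "\<And>u. u \<in> slit A \<Longrightarrow> X u \<in> tangent_space (slit_atlas A) u" "\<And>u. u \<notin> slit A \<Longrightarrow> X u = 0"
    "\<And>c. c \<in> A \<Longrightarrow> smooth_on (simg c) (f c)"
    "\<And>c u. c \<in> A \<Longrightarrow> u \<in> slit A \<Longrightarrow> fst u \<in> fst c \<Longrightarrow> X u (sc c) = f c (snd (sc c) u)"
  shows "X \<in> tm_fields A"
proof (rule slit.vf_I)
  fix c' assume "c' \<in> slit_atlas A"
  then obtain c where c: "c \<in> A" "c' = sc c" by (auto elim: slit_atlas_cases)
  have "smooth_on (simg c) (slit.rep (sc c) X)"
    by (rule smooth_on_cong[OF open_simg[OF c(1)] _ assms(3)[OF c(1)]])
      (use assms(4)[OF c(1)] simg_slit[OF c(1)] slit.snd_chart_inv[OF sc_in[OF c(1)]] in \<open>simp add: slit.rep_def\<close>)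
  then show "smooth_on (snd c' ` fst c') (slit.rep c' X)" using c by simp
qed (use assms in auto)

lemma gamma_field_chart:
  "X \<in> pi_fields A \<Longrightarrow> c \<in> A \<Longrightarrow> u \<in> slit A \<Longrightarrow> fst u \<in> fst c \<Longrightarrow> gamma_field A X u (sc c) = (0, X u c)"
  by (simp add: gamma_field_def on_slit_def gamma_chart)

lemma gamma_field_tm:
  assumes "X \<in> pi_fields A"
  shows "gamma_field A X \<in> tm_fields A"
proof (rule tm_I_rep[where f = "\<lambda>c z. (0, prep c X z)"])
  show "smooth_on (simg c) (\<lambda>z. (0, prep c X z))" if "c \<in> A" for c
    by (rule smooth_on_Pair[OF open_simg[OF that] smooth_on_const pf_smooth[OF assms that]])
qed (use assms in \<open>simp_all add: gamma_field_chart gamma_field_def on_slit_def gamma_tangent pf_tangent gamma_chart\<close>)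

lemma tm_tangent: "B \<in> tm_fields A \<Longrightarrow> B u \<in> tangent_space (slit_atlas A) u"
  using slit.vf_tangent by blast

lemma rho_field_chart:
  "B \<in> tm_fields A \<Longrightarrow> c \<in> A \<Longrightarrow> u \<in> slit A \<Longrightarrow> fst u \<in> fst c \<Longrightarrow> rho_field A B u c = fst (B u (sc c))"
  by (simp add: rho_field_def on_slit_def rho_chart tm_tangent)

lemma rho_field_pf:
  assumes "B \<in> tm_fields A"
  shows "rho_field A B \<in> pi_fields A"
proof (rule pf_I_rep[where f = "\<lambda>c z. fst (slit.rep (sc c) B z)"])
  show "smooth_on (simg c) (\<lambda>z. fst (slit.rep (sc c) B z))" if "c \<in> A" for c
    by (rule smooth_on_linear_compose[OF open_simg[OF that] bounded_linear_fst slit.vf_smooth[OF assms sc_in[OF that]]])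
  show "rho_field A B u c = fst (slit.rep (sc c) B (snd (sc c) u))" if "c \<in> A" "u \<in> slit A" "fst u \<in> fst c" for c u
    using rho_field_chart[OF assms that] slit.rep_snd[OF sc_in[OF that(1)] in_sc[OF that(2,3)]] by simp
qed (use assms in \<open>simp_all add: rho_field_def on_slit_def rho_tangent tm_tangent\<close>)

lemma tm_eqI:
  assumes "B \<in> tm_fields A" "C \<in> tm_fields A"
    "\<And>u c. u \<in> slit A \<Longrightarrow> c \<in> A \<Longrightarrow> fst u \<in> fst c \<Longrightarrow> B u (sc c) = C u (sc c)"
  shows "B = C"
proof (rule slit.vf_eqI[OF assms(1,2)])
  fix u assume "u \<in> points (slit_atlas A)"
  then have u: "u \<in> slit A" by simp
  then obtain c where "c \<in> A" "fst u \<in> fst c" using slit_chart_ex by blast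
  then show "\<exists>c\<in>slit_atlas A. u \<in> fst c \<and> B u c = C u c"
    using assms(3)[OF u] in_sc[OF u] sc_in by blast
qed

lemma gamma_field_add:
  assumes "X \<in> pi_fields A" "Y \<in> pi_fields A"
  shows "gamma_field A (X + Y) = gamma_field A X + gamma_field A Y"
  by (rule tm_eqI[OF gamma_field_tm[OF pf_add[OF assms]] slit.vf_add[OF gamma_field_tm gamma_field_tm]])
    (use assms in \<open>simp_all add: gamma_field_chart pf_add\<close>)

lemma rho_field_add:
  assumes "B \<in> tm_fields A" "C \<in> tm_fields A"
  shows "rho_field A (B + C) = rho_field A B + rho_field A C"
  by (rule pf_eqI[OF rho_field_pf[OF slit.vf_add[OF assms]] pf_add[OF rho_field_pf rho_field_pf]])
    (use assms in \<open>simp_all add: rho_field_chart slit.vf_add\<close>)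

lemma rho_gamma_field: "X \<in> pi_fields A \<Longrightarrow> rho_field A (gamma_field A X) = 0"
  by (rule pf_eqI[OF rho_field_pf[OF gamma_field_tm] pf_0])
    (simp_all add: rho_field_chart gamma_field_tm gamma_field_chart)

lemma gamma_field_inj:
  assumes "X \<in> pi_fields A" "Y \<in> pi_fields A" "gamma_field A X = gamma_field A Y"
  shows "X = Y"
  by (rule pf_eqI[OF assms(1,2)]) (metis assms gamma_field_chart snd_conv)

text \<open>The choice made at each point does not endanger smoothness, because in every chart
  \<open>X\<close> is just the fibre component of \<open>B\<close>.\<close>

lemma vertical_field:
  assumes B: "B \<in> tm_fields A" "rho_field A B = 0"
  obtains X where "X \<in> pi_fields A" "B = gamma_field A X"
proof -
  define X where "X u = (if u \<in> slit A then SOME x. x \<in> tangent_space A (fst u) \<and> B u = gamma A u x else 0)" for u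
  have X: "X u \<in> tangent_space A (fst u) \<and> B u = gamma A u (X u)" if u: "u \<in> slit A" for u
  proof -
    have "rho_field A B u = 0" using B(2) by simp
    then have "rho A u (B u) = 0" using u by (simp add: rho_field_def on_slit_def)
    then obtain x where "x \<in> tangent_space A (fst u)" "B u = gamma A u x"
      using vertical_is_gamma[OF tm_tangent[OF B(1)] u] by blast
    then have "\<exists>x. x \<in> tangent_space A (fst u) \<and> B u = gamma A u x" by blast
    from someI_ex[OF this] show ?thesis using u by (simp add: X_def)
  qed
  have Xp: "X \<in> pi_fields A"
  proof (rule pf_I_rep[where f = "\<lambda>c z. snd (slit.rep (sc c) B z)"])
    show "smooth_on (simg c) (\<lambda>z. snd (slit.rep (sc c) B z))" if "c \<in> A" for c
      by (rule smooth_on_linear_compose[OF open_simg[OF that] bounded_linear_snd slit.vf_smooth[OF B(1) sc_in[OF that]]])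
    show "X u c = snd (slit.rep (sc c) B (snd (sc c) u))" if "c \<in> A" "u \<in> slit A" "fst u \<in> fst c" for c u
      using X[OF that(2)] gamma_chart[OF that(2,1,3), of "X u"] slit.rep_snd[OF sc_in[OF that(1)] in_sc[OF that(2,3)], of B]
      by simp
  qed (use X in \<open>simp_all add: X_def\<close>)
  have "B = gamma_field A X"
    by (rule tm_eqI[OF B(1) gamma_field_tm[OF Xp]]) (use X in \<open>simp add: gamma_field_def on_slit_def\<close>)
  then show thesis using that Xp by blast
qed

end

section \<open>Fibre derivatives, the metric and horizontal lifts\<close>

lemma has_real_derivative_along_line:
  fixes k :: "'a::real_normed_vector \<Rightarrow> real"
  assumes k: "(k has_derivative k') (at (p + s *\<^sub>R q))"
  shows "((\<lambda>s. k (p + s *\<^sub>R q)) has_real_derivative k' q) (at s)"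
proof -
  have "((\<lambda>s. p + s *\<^sub>R q) has_derivative (\<lambda>r. r *\<^sub>R q)) (at s)"
    by (auto intro!: derivative_eq_intros)
  from has_derivative_compose[OF this k]
  have "((\<lambda>s. k (p + s *\<^sub>R q)) has_derivative (\<lambda>r. k' (r *\<^sub>R q))) (at s)" .
  moreover have "k' (r *\<^sub>R q) = k' q * r" for r
    using has_derivative_linear[OF k] by (simp add: linear_scale)
  ultimately show ?thesis by (simp add: has_field_derivative_def)
qed

lemma has_real_derivative_along_line_0:
  fixes k :: "'a::real_normed_vector \<Rightarrow> real"
  assumes "(k has_derivative k') (at p)"
  shows "((\<lambda>s. k (p + s *\<^sub>R q)) has_real_derivative k' q) (at 0)"
  by (rule has_real_derivative_along_line) (use assms in simp)

lemma (in atlas) act_cong: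
  assumes "X \<in> vector_fields A" "smooth_fun A f" "\<And>p. p \<in> points A \<Longrightarrow> f p = g p"
  shows "act X f = act X g"
proof
  fix p show "act X f p = act X g p"
  proof (cases "p \<in> points A")
    case True
    let ?c = "chart_at A p"
    have c: "?c \<in> A" "p \<in> fst ?c" using chart_at True by blast+
    have "fderiv (f \<circ> chart_inv ?c) (snd ?c p) = fderiv (g \<circ> chart_inv ?c) (snd ?c p)"
    proof (rule frechet_derivative_cong[OF open_img[OF c(1)]])
      show "snd ?c p \<in> snd ?c ` fst ?c" using c by simp
      show "(f \<circ> chart_inv ?c) y = (g \<circ> chart_inv ?c) y" if "y \<in> snd ?c ` fst ?c" for y
        using assms(3) in_points[OF c(1) chart_inv_in[OF c(1) that]] by simp
      show "f \<circ> chart_inv ?c differentiable at (snd ?c p)"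
        using smooth_fun_has_derivative[OF assms(2) c(1)] c unfolding differentiable_def by blast
    qed
    then show ?thesis using True by (simp add: act_def dir_deriv_def Let_def)
  qed (simp add: act_def)
qed

context manifold
begin

section \<open>The derivative along the fibres\<close>

definition dv :: "('a, 'e) pi_field \<Rightarrow> ('a, 'e) pi_field \<Rightarrow> ('a, 'e) pi_field" where
  "dv X Y = (\<lambda>u c. if u \<in> slit A \<and> c \<in> A \<and> fst u \<in> fst c
     then fderiv (prep c Y) (snd (sc c) u) (0, X u c) else 0)"

lemma dv_chart:
  "u \<in> slit A \<Longrightarrow> c \<in> A \<Longrightarrow> fst u \<in> fst c \<Longrightarrow>
    dv X Y u c = fderiv (prep c Y) (snd (sc c) u) (0, X u c)"
  by (simp add: dv_def)

text \<open>Components of \<pi>-vector fields change by the Jacobian of the base transition, which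
  is constant along the fibres. Differentiating the rule in a direction (0, X) therefore leaves no
  second-derivative term, unlike in a general direction.\<close>

lemma dv_tangent:
  assumes X: "X \<in> pi_fields A" and Y: "Y \<in> pi_fields A" and u: "u \<in> slit A"
  shows "dv X Y u \<in> tangent_space A (fst u)"
proof (rule tangent_I)
  show "dv X Y u c = 0" if "\<not> (c \<in> A \<and> fst u \<in> fst c)" for c
    using that by (auto simp: dv_def)
  fix c d assume cd: "c \<in> A" "d \<in> A" and ud: "fst u \<in> fst c" "fst u \<in> fst d"
  let ?S = "snd (sc c) ` (fst (sc c) \<inter> fst (sc d))" and ?z = "snd (sc c) u"
  let ?T = "snd (sc d) \<circ> chart_inv (sc c)"
  have S: "open ?S" "?z \<in> ?S"
    using slit.open_overlap[OF sc_in[OF cd(1)] sc_in[OF cd(2)]] in_sc[OF u ud(1)] in_sc[OF u ud(2)] by auto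
  note st = smooth_transition[OF cd]
  have fstS: "fst z \<in> snd c ` (fst c \<inter> fst d)" if "z \<in> ?S" for z
    using that overlap_sc[OF cd(1), of d] by auto
  have Tz: "?T ?z = snd (sc d) u" using cd u ud by simp
  have eq: "prep d Y (?T z) = fderiv (transition c d) (fst z) (prep c Y z)" if "z \<in> ?S" for z
  proof -
    obtain w where "w \<in> fst (sc c) \<inter> fst (sc d)" and zw: "z = snd (sc c) w"
      using \<open>z \<in> ?S\<close> by blast
    then have w: "w \<in> slit A" "fst w \<in> fst c" "fst w \<in> fst d" by (simp_all add: fst_sc)
    then show ?thesis unfolding zw
      using tangent_change[OF pf_tangent[OF Y w(1)] cd w(2,3)] cd
      by (simp add: jac_def) (simp add: snd_sc)
  qed
  have "((\<lambda>z. prep d Y (?T z)) has_derivative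
      (\<lambda>v. fderiv (prep d Y) (snd (sc d) u) (slit.jac (sc c) (sc d) u v))) (at ?z)"
    by (rule has_derivative_compose[OF slit.transition_has_derivative[OF sc_in[OF cd(1)] sc_in[OF cd(2)] in_sc[OF u ud(1)] in_sc[OF u ud(2)]]])
      (use pf_has_derivative[OF Y cd(2) in_simg[OF u ud(2)]] Tz in simp)
  then have L: "((\<lambda>z. fderiv (transition c d) (fst z) (prep c Y z)) has_derivative
      (\<lambda>v. fderiv (prep d Y) (snd (sc d) u) (slit.jac (sc c) (sc d) u v))) (at ?z)"
    by (rule has_derivative_transform_within_open[OF _ S]) (rule eq)
  have "((\<lambda>z. fderiv (transition c d) (fst z) (prep c Y z)) has_derivative
     (\<lambda>v. fderiv (\<lambda>x. fderiv (transition c d) x (prep c Y ?z)) (fst ?z) (fst v)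
       + fderiv (transition c d) (fst ?z) (fderiv (prep c Y) ?z v))) (at ?z)"
  proof (rule has_derivative_apply[OF S, where F = "\<lambda>z. fderiv (transition c d) (fst z)"
        and F' = "\<lambda>b v. fderiv (\<lambda>x. fderiv (transition c d) x b) (fst ?z) (fst v)"])
    show "linear (fderiv (transition c d) (fst z))" if "z \<in> ?S" for z
      by (rule smooth_on_linear_frechet[OF st fstS[OF that]])
    show "((\<lambda>z. fderiv (transition c d) (fst z) b) has_derivative
        (\<lambda>v. fderiv (\<lambda>x. fderiv (transition c d) x b) (fst ?z) (fst v))) (at ?z)" for b
      by (rule has_derivative_compose[OF bounded_linear_imp_has_derivative[OF bounded_linear_fst]
            smooth_on_has_derivative[OF smooth_on_frechet[OF st] fstS[OF S(2)]]])
    show "(prep c Y has_derivative fderiv (prep c Y) ?z) (at ?z)"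
      by (rule pf_has_derivative[OF Y cd(1) in_simg[OF u ud(1)]])
  qed
  from has_derivative_unique[OF L this]
  have "fderiv (prep d Y) (snd (sc d) u) (slit.jac (sc c) (sc d) u (0, X u c)) =
      fderiv (\<lambda>x. fderiv (transition c d) x (prep c Y ?z)) (fst ?z) (fst (0::'e, X u c))
       + fderiv (transition c d) (fst ?z) (fderiv (prep c Y) ?z (0, X u c))"
    by (rule fun_cong)
  moreover have lin0: "fderiv (\<lambda>x. fderiv (transition c d) x b) (fst ?z) 0 = 0" for b
    by (rule linear_0[OF smooth_on_linear_frechet[OF smooth_on_frechet[OF st] fstS[OF S(2)]]])
  moreover have "slit.jac (sc c) (sc d) u (0, X u c) = (0, X u d)"
    using slit_jac[OF cd u ud, of "(0, X u c)"] lin0[of "snd u c"] linear_0[OF linear_jac[OF cd ud]]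
      tangent_change[OF pf_tangent[OF X u] cd ud]
    by (simp add: snd_sc)
  ultimately show "dv X Y u d = jac c d (fst u) (dv X Y u c)"
    by (simp add: dv_chart u cd ud jac_def) (simp add: snd_sc)
qed

lemma dv_pf:
  assumes X: "X \<in> pi_fields A" and Y: "Y \<in> pi_fields A"
  shows "dv X Y \<in> pi_fields A"
proof (rule pf_I_rep[where f = "\<lambda>c z. fderiv (prep c Y) z (0, prep c X z)"])
  show "smooth_on (simg c) (\<lambda>z. fderiv (prep c Y) z (0, prep c X z))" if "c \<in> A" for c
    by (rule smooth_on_frechet_apply[OF open_simg[OF that] pf_smooth[OF Y that]
          smooth_on_Pair[OF open_simg[OF that] smooth_on_const pf_smooth[OF X that]]])
qed (use dv_tangent[OF X Y] in \<open>auto simp: dv_chart dv_def fun_eq_iff\<close>)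

lemma gamma_rep_derivative:
  assumes X: "X \<in> pi_fields A" and c: "c \<in> A" and z: "z \<in> simg c"
  shows "fderiv (slit.rep (sc c) (gamma_field A X)) z v = (0, fderiv (prep c X) z v)"
proof -
  have "((\<lambda>z. (0::'e, prep c X z)) has_derivative (\<lambda>v. (0, fderiv (prep c X) z v))) (at z)"
    by (rule has_derivative_Pair[OF has_derivative_const pf_has_derivative[OF X c z]])
  then have "(slit.rep (sc c) (gamma_field A X) has_derivative (\<lambda>v. (0, fderiv (prep c X) z v))) (at z)"
    by (rule has_derivative_transform_within_open[OF _ open_simg[OF c] z])
      (use simg_slit[OF c] gamma_field_chart[OF X c] in \<open>simp add: slit.rep_def prep_def\<close>)
  from frechet_derivative_at[OF this, symmetric] show ?thesis by simp
qed

lemma rho_rep_derivative: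
  assumes B: "B \<in> tm_fields A" and c: "c \<in> A" and z: "z \<in> simg c"
  shows "fderiv (prep c (rho_field A B)) z v = fst (fderiv (slit.rep (sc c) B) z v)"
proof -
  have "((\<lambda>z. fst (slit.rep (sc c) B z)) has_derivative (\<lambda>v. fst (fderiv (slit.rep (sc c) B) z v))) (at z)"
    by (rule has_derivative_fst[OF slit.vf_has_derivative[OF B sc_in[OF c] z]])
  then have "(prep c (rho_field A B) has_derivative (\<lambda>v. fst (fderiv (slit.rep (sc c) B) z v))) (at z)"
    by (rule has_derivative_transform_within_open[OF _ open_simg[OF c] z])
      (use simg_slit[OF c] rho_field_chart[OF B c] in \<open>simp add: slit.rep_def prep_def\<close>)
  from frechet_derivative_at[OF this, symmetric] show ?thesis by simp
qed

text \<open>The base component of a vertical lift is identically 0 in every chart. Hence the base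
  component of the bracket consists of the derivative of the base component of \<open>B\<close>
  alone.\<close>

lemma rho_bracket_gamma:
  assumes X: "X \<in> pi_fields A" and B: "B \<in> tm_fields A"
  shows "rho_field A (bracket A (gamma_field A X) B) = dv X (rho_field A B)"
proof (rule pf_eqI[OF rho_field_pf[OF slit.vf_bracket[OF gamma_field_tm[OF X] B]] dv_pf[OF X rho_field_pf[OF B]]])
  fix u c assume u: "u \<in> slit A" "c \<in> A" "fst u \<in> fst c"
  show "rho_field A (bracket A (gamma_field A X) B) u c = dv X (rho_field A B) u c"
    using rho_field_chart[OF slit.vf_bracket[OF gamma_field_tm[OF X] B] u(2,1,3)]
      slit.bracket_chart[OF sc_in[OF u(2)] in_sc[OF u(1,3)], of "gamma_field A X" B]
    by (simp add: gamma_rep_derivative[OF X u(2) in_simg[OF u(1,3)]] rho_rep_derivative[OF B u(2) in_simg[OF u(1,3)]]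
        dv_chart u gamma_field_chart[OF X u(2,1,3)])
qed

lemma bracket_gamma_gamma:
  assumes X: "X \<in> pi_fields A" and Y: "Y \<in> pi_fields A"
  shows "bracket A (gamma_field A X) (gamma_field A Y) = gamma_field A (dv X Y - dv Y X)"
proof (rule tm_eqI[OF slit.vf_bracket[OF gamma_field_tm[OF X] gamma_field_tm[OF Y]]
      gamma_field_tm[OF pf_diff[OF dv_pf[OF X Y] dv_pf[OF Y X]]]])
  fix u c assume u: "u \<in> slit A" "c \<in> A" "fst u \<in> fst c"
  show "bracket A (gamma_field A X) (gamma_field A Y) u (sc c) = gamma_field A (dv X Y - dv Y X) u (sc c)"
    using slit.bracket_chart[OF sc_in[OF u(2)] in_sc[OF u(1,3)], of "gamma_field A X" "gamma_field A Y"]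
      gamma_field_chart[OF pf_diff[OF dv_pf[OF X Y] dv_pf[OF Y X]] u(2,1,3)]
    by (simp add: gamma_rep_derivative X Y u in_simg dv_chart gamma_field_chart)
qed

lemma dv_eta:
  assumes X: "X \<in> pi_fields A"
  shows "dv X (eta A) = X"
proof (rule pf_eqI[OF dv_pf[OF X eta_pf] X])
  fix u c assume u: "u \<in> slit A" "c \<in> A" "fst u \<in> fst c"
  have "(snd has_derivative snd) (at (snd (sc c) u))"
    by (rule bounded_linear_imp_has_derivative[OF bounded_linear_snd])
  then have "(prep c (eta A) has_derivative snd) (at (snd (sc c) u))"
  proof (rule has_derivative_transform_within_open[OF _ open_simg[OF u(2)] in_simg[OF u(1,3)]])
    fix z assume z: "z \<in> simg c"
    then show "snd z = prep c (eta A) z"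
      using simg_slit[OF u(2) z] slit.snd_chart_inv[OF sc_in[OF u(2)] z]
      by (simp add: prep_def eta_def on_slit_def snd_sc) (metis snd_conv)
  qed
  from frechet_derivative_at[OF this, symmetric] show "dv X (eta A) u c = X u c"
    by (simp add: dv_chart u)
qed

lemma dv_add_right:
  assumes "X \<in> pi_fields A" "Y \<in> pi_fields A" "Z \<in> pi_fields A"
  shows "dv X (Y + Z) = dv X Y + dv X Z"
proof (rule pf_eqI[OF dv_pf[OF assms(1) pf_add[OF assms(2,3)]] pf_add[OF dv_pf[OF assms(1,2)] dv_pf[OF assms(1,3)]]])
  fix u c assume u: "u \<in> slit A" "c \<in> A" "fst u \<in> fst c"
  have "prep c (Y + Z) = (\<lambda>z. prep c Y z + prep c Z z)" by (simp add: prep_def fun_eq_iff)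
  moreover have "prep c Y differentiable at (snd (sc c) u)" "prep c Z differentiable at (snd (sc c) u)"
    using pf_has_derivative[OF assms(2) u(2) in_simg[OF u(1,3)]] pf_has_derivative[OF assms(3) u(2) in_simg[OF u(1,3)]]
    unfolding differentiable_def by blast+
  ultimately show "dv X (Y + Z) u c = (dv X Y + dv X Z) u c"
    by (simp add: dv_chart u frechet_derivative_add)
qed

lemma dv_add_left:
  assumes "X \<in> pi_fields A" "Y \<in> pi_fields A" "Z \<in> pi_fields A"
  shows "dv (X + Y) Z = dv X Z + dv Y Z"
proof (rule pf_eqI[OF dv_pf[OF pf_add[OF assms(1,2)] assms(3)] pf_add[OF dv_pf[OF assms(1,3)] dv_pf[OF assms(2,3)]]])
  fix u c assume u: "u \<in> slit A" "c \<in> A" "fst u \<in> fst c"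
  have l: "linear (fderiv (prep c Z) (snd (sc c) u))"
    by (rule smooth_on_linear_frechet[OF pf_smooth[OF assms(3) u(2)] in_simg[OF u(1,3)]])
  show "dv (X + Y) Z u c = (dv X Z + dv Y Z) u c"
    using linear_add[OF l, of "(0, X u c)" "(0, Y u c)"] by (simp add: dv_chart u)
qed

section \<open>The metric as second fibre derivative of the energy\<close>

lemma chart_inv_sc_tangent:
  assumes "c \<in> A" "p \<in> fst c" "w \<in> tangent_space A p" "w c \<noteq> 0"
  shows "chart_inv (sc c) (snd c p, w c) = (p, w)"
proof -
  have "w \<noteq> 0" using assms(4) by auto
  then have "(p, w) \<in> slit A" using assms in_points by (simp add: slit_iff)
  then show ?thesis using chart_inv_sc_snd[OF assms(1), of "(p, w)"] assms(2) by (simp add: snd_sc)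
qed

text \<open>Turns the nested one-variable derivatives of the definition into a second derivative in
  a chart. The chart expression is valid only while the displaced vector is nonzero, hence the care
  for open sets of parameters.\<close>

lemma finsler_metric_chart:
  assumes E: "smooth_fun (slit_atlas A) (energy L)" and c: "c \<in> A" and u: "u \<in> slit A" "fst u \<in> fst c"
    and xy: "x \<in> tangent_space A (fst u)" "y \<in> tangent_space A (fst u)"
  shows "finsler_metric L u x y = frechet_derivative
    (\<lambda>z. fderiv (energy L \<circ> chart_inv (sc c)) z (0, y c)) (at (snd (sc c) u)) (0, x c)"
proof -
  let ?E = "energy L \<circ> chart_inv (sc c)" and ?x0 = "snd c (fst u)" and ?y0 = "snd u c"
  have ut: "snd u \<in> tangent_space A (fst u)" using u by (simp add: slit_iff)
  have E': "smooth_on (simg c) ?E" using E c by (simp add: smooth_fun_def)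
  have pt: "(?x0, w) \<in> simg c" if "w \<noteq> 0" for w
    using that u c img_sc[OF c] by auto
  have val: "?E (?x0, ?y0 + s *\<^sub>R x c + t *\<^sub>R y c) = energy L (fst u, snd u + s *\<^sub>R x + t *\<^sub>R y)"
    if "?y0 + s *\<^sub>R x c + t *\<^sub>R y c \<noteq> 0" for s t
    using chart_inv_sc_tangent[OF c u(2), of "snd u + s *\<^sub>R x + t *\<^sub>R y"] that
    by (simp add: tangent_add tangent_scale ut xy)
  have op: "open {t. a + t *\<^sub>R b \<noteq> 0}" for a b :: 'e
  proof -
    have "{t. a + t *\<^sub>R b \<noteq> 0} = (\<lambda>t. a + t *\<^sub>R b) -` (- {0})" by auto
    then show ?thesis
      using open_vimage[OF open_Compl_zero, of "\<lambda>t. a + t *\<^sub>R b"] by (simp add: continuous_intros)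
  qed
  have inner: "deriv (\<lambda>t. energy L (fst u, snd u + s *\<^sub>R x + t *\<^sub>R y)) 0 =
      fderiv ?E (?x0, ?y0 + s *\<^sub>R x c) (0, y c)" if s: "?y0 + s *\<^sub>R x c \<noteq> 0" for s
  proof (rule DERIV_imp_deriv)
    have "((\<lambda>t. ?E ((?x0, ?y0 + s *\<^sub>R x c) + t *\<^sub>R (0, y c))) has_real_derivative
        fderiv ?E (?x0, ?y0 + s *\<^sub>R x c) (0, y c)) (at 0)"
      by (rule has_real_derivative_along_line_0[OF smooth_on_has_derivative[OF E' pt[OF s]]])
    then show "((\<lambda>t. energy L (fst u, snd u + s *\<^sub>R x + t *\<^sub>R y)) has_real_derivative
        fderiv ?E (?x0, ?y0 + s *\<^sub>R x c) (0, y c)) (at 0)"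
      by (rule has_field_derivative_transform_within_open[OF _ op[of "?y0 + s *\<^sub>R x c" "y c"]])
        (use s val in simp_all)
  qed
  have nz: "?y0 \<noteq> 0" using slit_nonzero u c by blast
  have "((\<lambda>s. fderiv ?E ((?x0, ?y0) + s *\<^sub>R (0, x c)) (0, y c)) has_real_derivative
      fderiv (\<lambda>z. fderiv ?E z (0, y c)) (?x0, ?y0) (0, x c)) (at 0)"
    by (rule has_real_derivative_along_line_0[OF smooth_on_has_derivative[OF smooth_on_frechet[OF E'] pt[OF nz]]])
  then have "((\<lambda>s. deriv (\<lambda>t. energy L (fst u, snd u + s *\<^sub>R x + t *\<^sub>R y)) 0) has_real_derivative
      fderiv (\<lambda>z. fderiv ?E z (0, y c)) (?x0, ?y0) (0, x c)) (at 0)"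
    by (rule has_field_derivative_transform_within_open[OF _ op[of "?y0" "x c"]])
      (use nz inner in simp_all)
  from DERIV_imp_deriv[OF this] show ?thesis
    by (simp add: finsler_metric_def snd_sc)
qed

text \<open>\<open>E0\<close> and \<open>met\<close> are the energy and the metric cut off outside
  the slit bundle, so that they belong to \<open>slit.smooth_funs\<close>.\<close>

definition E0 :: "(('a, 'e) tm \<Rightarrow> real) \<Rightarrow> ('a, 'e) tm \<Rightarrow> real" where
  "E0 L = on_slit A (energy L)"

definition met :: "(('a, 'e) tm \<Rightarrow> real) \<Rightarrow> ('a, 'e) pi_field \<Rightarrow> ('a, 'e) pi_field \<Rightarrow> ('a, 'e) tm \<Rightarrow> real" where
  "met L X Y = on_slit A (metric_fun L X Y)"

lemma smooth_energy:
  assumes "smooth_fun (slit_atlas A) L"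
  shows "smooth_fun (slit_atlas A) (energy L)"
  unfolding smooth_fun_def
proof
  fix c assume c: "c \<in> slit_atlas A"
  have L: "smooth_on (snd c ` fst c) (L \<circ> chart_inv c)" using assms c by (simp add: smooth_fun_def)
  have "smooth_on (snd c ` fst c) (\<lambda>z. (1/2) *\<^sub>R ((L \<circ> chart_inv c) z * (L \<circ> chart_inv c) z))"
    by (rule smooth_on_cscaleR[OF slit.open_img[OF c] smooth_on_bilinear[OF bounded_bilinear_mult slit.open_img[OF c] L L]])
  then show "smooth_on (snd c ` fst c) (energy L \<circ> chart_inv c)"
    by (simp add: energy_def[abs_def] comp_def power2_eq_square)
qed

lemma E0_smooth:
  assumes "smooth_fun (slit_atlas A) (energy L)"
  shows "E0 L \<in> slit.smooth_funs"
proof -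
  have "smooth_on (snd c ` fst c) (E0 L \<circ> chart_inv c)" if c: "c \<in> slit_atlas A" for c
  proof (rule smooth_on_cong[OF slit.open_img[OF c]])
    show "smooth_on (snd c ` fst c) (energy L \<circ> chart_inv c)" using assms c by (simp add: smooth_fun_def)
    show "(energy L \<circ> chart_inv c) z = (E0 L \<circ> chart_inv c) z" if "z \<in> snd c ` fst c" for z
      using slit.in_points[OF c slit.chart_inv_in[OF c that]] by (simp add: E0_def on_slit_def)
  qed
  then show ?thesis by (simp add: slit.smooth_funs_def smooth_fun_def) (simp add: E0_def on_slit_def)
qed

lemma act_E0:
  assumes "smooth_fun (slit_atlas A) (energy L)" "B \<in> tm_fields A"
  shows "slit.act B (E0 L) = slit.act B (energy L)"
  by (rule slit.act_cong[OF assms(2,1), symmetric]) (simp add: E0_def on_slit_def)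

text \<open>Differentiating the chart expression of dE on (0, Y) along (0, X) gives the Hessian term
  and dE on (0, \<open>dv X Y\<close>); the subtracted term removes the latter.\<close>

lemma met_formula:
  assumes E: "smooth_fun (slit_atlas A) (energy L)" and X: "X \<in> pi_fields A" and Y: "Y \<in> pi_fields A"
  shows "met L X Y = slit.act (gamma_field A X) (slit.act (gamma_field A Y) (E0 L))
    - slit.act (gamma_field A (dv X Y)) (E0 L)"
proof
  fix u
  show "met L X Y u = (slit.act (gamma_field A X) (slit.act (gamma_field A Y) (E0 L))
    - slit.act (gamma_field A (dv X Y)) (E0 L)) u"
  proof (cases "u \<in> slit A")
    case u: True
    then obtain c where c: "c \<in> A" "fst u \<in> fst c" using slit_chart_ex by blast
    let ?E = "energy L \<circ> chart_inv (sc c)" and ?z = "snd (sc c) u"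
    note cu = sc_in[OF c(1)] in_sc[OF u c(2)] and z = in_simg[OF u c(2)]
    have E': "smooth_on (simg c) ?E" using E c by (simp add: smooth_fun_def)
    have gX: "gamma_field A X \<in> tm_fields A" "gamma_field A Y \<in> tm_fields A" "gamma_field A (dv X Y) \<in> tm_fields A"
      using gamma_field_tm X Y dv_pf by blast+
    have l: "linear (fderiv ?E ?z)" by (rule smooth_on_linear_frechet[OF E' z])
    have "((slit.act (gamma_field A Y) (energy L) \<circ> chart_inv (sc c)) has_derivative (\<lambda>v.
          fderiv (\<lambda>z. fderiv ?E z (slit.rep (sc c) (gamma_field A Y) ?z)) ?z v
        + fderiv ?E ?z (fderiv (slit.rep (sc c) (gamma_field A Y)) ?z v))) (at ?z)"
      by (rule has_derivative_transform_within_open[OF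
              frechet_derivative_frechet_apply[OF open_simg[OF c(1)] z E' slit.vf_has_derivative[OF gX(2) cu(1) z]]
              open_simg[OF c(1)] z])
          (rule slit.act_rep[OF cu(1) _ gX(2) E, symmetric])
    from frechet_derivative_at[OF this, symmetric]
    have "slit.act (gamma_field A X) (slit.act (gamma_field A Y) (energy L)) u =
       fderiv (\<lambda>z. fderiv ?E z (0, Y u c)) ?z (0, X u c)
        + fderiv ?E ?z (0, dv X Y u c)"
      using slit.act_chart[OF cu gX(1) slit.smooth_fun_act[OF gX(2) E]]
        slit.rep_snd[OF cu, of "gamma_field A Y"]
      by (simp add: gamma_field_chart X Y c u gamma_rep_derivative[OF Y c(1) z] dv_chart)
    moreover have "slit.act (gamma_field A (dv X Y)) (energy L) u = fderiv ?E ?z (0, dv X Y u c)"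
      using slit.act_chart[OF cu gX(3) E] gamma_field_chart[OF dv_pf[OF X Y] c(1) u c(2)] by simp
    moreover have "met L X Y u = fderiv (\<lambda>z. fderiv ?E z (0, Y u c)) ?z (0, X u c)"
      using finsler_metric_chart[OF E c(1) u c(2) pf_tangent[OF X u] pf_tangent[OF Y u]] u
      by (simp add: met_def metric_fun_def on_slit_def)
    ultimately show ?thesis by (simp add: act_E0[OF E] gX)
  qed (simp add: met_def on_slit_def slit.act_def)
qed

text \<open>Euler's identity for degree 2: on the ray through \<open>u\<close> the energy is (1 +
  t)^2 times its value at \<open>u\<close>, and both sides are differentiated at t = 0.\<close>

lemma act_eta_E0:
  assumes E: "smooth_fun (slit_atlas A) (energy L)"
    and hom: "\<And>u r. u \<in> tangent_bundle A \<Longrightarrow> r > 0 \<Longrightarrow> L (fst u, r *\<^sub>R snd u) = r * L u"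
  shows "slit.act (gamma_field A (eta A)) (E0 L) = 2 *\<^sub>R E0 L"
proof
  fix u
  show "slit.act (gamma_field A (eta A)) (E0 L) u = (2 *\<^sub>R E0 L) u"
  proof (cases "u \<in> slit A")
    case u: True
    then obtain c where c: "c \<in> A" "fst u \<in> fst c" using slit_chart_ex by blast
    let ?E = "energy L \<circ> chart_inv (sc c)" and ?z = "snd (sc c) u"
    note cu = sc_in[OF c(1)] in_sc[OF u c(2)] and z = in_simg[OF u c(2)]
    have E': "smooth_on (simg c) ?E" using E c by (simp add: smooth_fun_def)
    have ut: "snd u \<in> tangent_space A (fst u)" "u \<in> tangent_bundle A" using u by (simp_all add: slit_def tangent_bundle_def)
    have nz: "snd u c \<noteq> 0" using slit_nonzero u c by blast
    have "((\<lambda>t. ?E (?z + t *\<^sub>R (0, snd u c))) has_real_derivative fderiv ?E ?z (0, snd u c)) (at 0)"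
      by (rule has_real_derivative_along_line_0[OF smooth_on_has_derivative[OF E' z]])
    then have "((\<lambda>t. (1 + t)\<^sup>2 * energy L u) has_real_derivative fderiv ?E ?z (0, snd u c)) (at 0)"
    \<comment> \<open>Homogeneity is available for positive factors only, so \<open>t\<close> must
      stay above -1.\<close>
    proof (rule has_field_derivative_transform_within_open[where S = "{-1<..}"])
      fix t :: real assume "t \<in> {-1<..}"
      then have t: "1 + t > 0" by simp
      have "?z + t *\<^sub>R (0, snd u c) = (snd c (fst u), ((1 + t) *\<^sub>R snd u) c)"
        by (simp add: snd_sc algebra_simps)
      then have "?E (?z + t *\<^sub>R (0, snd u c)) = energy L (fst u, (1 + t) *\<^sub>R snd u)"
        using chart_inv_sc_tangent[OF c tangent_scale[OF ut(1)], of "1 + t"] nz t by simp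
      then show "?E (?z + t *\<^sub>R (0, snd u c)) = (1 + t)\<^sup>2 * energy L u"
        by (simp add: energy_def hom[OF ut(2) t] power_mult_distrib)
    qed auto
    moreover have "((\<lambda>t. (1 + t)\<^sup>2 * energy L u) has_real_derivative 2 * energy L u) (at 0)"
      by (auto intro!: derivative_eq_intros)
    ultimately have "fderiv ?E ?z (0, snd u c) = 2 * energy L u"
      using DERIV_unique by blast
    moreover have "slit.act (gamma_field A (eta A)) (energy L) u = fderiv ?E ?z (0, eta A u c)"
      using slit.act_chart[OF cu gamma_field_tm[OF eta_pf] E] gamma_field_chart[OF eta_pf c(1) u c(2)] by simp
    moreover have "eta A u c = snd u c" "E0 L u = energy L u"
      using u by (simp_all add: eta_def E0_def on_slit_def)
    ultimately show ?thesis
      by (simp add: act_E0[OF E gamma_field_tm[OF eta_pf]])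
  qed (simp add: E0_def on_slit_def slit.act_def)
qed

section \<open>Global frames and smoothness of horizontal lifts\<close>

text \<open>A coordinate field, constant in the chart, made global by a bump factor that depends on
  the base point only; connections can be applied to its vertical lift.\<close>

definition frame_field :: "('a, 'e) chart \<Rightarrow> 'e \<Rightarrow> real \<Rightarrow> 'e \<Rightarrow> ('a, 'e) pi_field" where
  "frame_field c x0 r b = (\<lambda>u. if u \<in> slit A \<and> fst u \<in> fst c
     then bump x0 r (snd c (fst u)) *\<^sub>R tvec_of c (fst u) b else 0)"

text \<open>Smoothness is checked in another chart \<open>d\<close> on two open sets. Over the
  overlap with \<open>c\<close> the field is a bump factor times a column of a Jacobian; away from
  the closed ball it is 0. Openness of the second set is the extra axiom of
  \<open>manifold\<close>.\<close>

lemma frame_field_pf: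
  assumes c: "c \<in> A" and r: "r > 0" "cball x0 r \<subseteq> snd c ` fst c"
  shows "frame_field c x0 r b \<in> pi_fields A"
proof (rule pf_I)
  show "frame_field c x0 r b u \<in> tangent_space A (fst u)" for u
    using c by (auto simp: frame_field_def intro!: tangent_scale tvec_of_tangent)
  show "frame_field c x0 r b u = 0" if "u \<notin> slit A" for u
    using that by (simp add: frame_field_def)
  fix d assume d: "d \<in> A"
  let ?C = "cball x0 r"
  let ?O1 = "snd d ` (fst d \<inter> fst c)" and ?O2 = "snd d ` {q \<in> fst d. \<not> (q \<in> fst c \<and> snd c q \<in> ?C)}"
  have O1: "open ?O1" by (rule open_overlap[OF d c])
  have O2: "open ?O2" by (rule open_off_compact[OF c compact_cball r(2) d])
  show "smooth_on (simg d) (prep d (frame_field c x0 r b))"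
  proof (rule smooth_on_local)
    fix z assume z: "z \<in> simg d"
    then obtain q y where q: "q \<in> fst d" "z = (snd d q, y)" "y \<noteq> 0" using img_sc[OF d] by auto
    show "\<exists>U. open U \<and> z \<in> U \<and> smooth_on U (prep d (frame_field c x0 r b))"
    proof (cases "q \<in> fst c \<and> snd c q \<in> ?C")
      case True
      let ?U = "?O1 \<times> (- {0::'e})"
      have U: "open ?U" by (rule open_Times[OF O1 open_Compl_zero])
      note st = smooth_transition[OF d c]
      have "smooth_on ?O1 (\<lambda>x. bump x0 r (transition d c x) *\<^sub>R
          fderiv (transition c d) (transition d c x) b)"
      proof (rule smooth_on_scaleR[OF O1])
        show "smooth_on ?O1 (\<lambda>x. bump x0 r (transition d c x))"
          by (rule smooth_on_compose[OF O1 open_UNIV smooth_on_bump[OF open_UNIV] st]) simp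
        show "smooth_on ?O1 (\<lambda>x. fderiv (transition c d) (transition d c x) b)"
          by (rule smooth_on_compose[OF O1 open_overlap[OF c d] smooth_on_frechet[OF smooth_transition[OF c d]] st])
            (use c d in auto)
      qed
      from smooth_fst_compose[OF U O1 this]
      have "smooth_on ?U (\<lambda>z. bump x0 r (transition d c (fst z)) *\<^sub>R
          fderiv (transition c d) (transition d c (fst z)) b)" by auto
      then have "smooth_on ?U (prep d (frame_field c x0 r b))"
      proof (rule smooth_on_cong[OF U, rotated])
        fix w assume w: "w \<in> ?U"
        then obtain p v where p: "p \<in> fst d" "p \<in> fst c" "w = (snd d p, v)" "v \<noteq> 0" by auto
        have "chart_inv (sc d) w = (p, tvec_of d p v)" using chart_inv_sc[OF d, of "snd d p" v] p d by simp
        moreover have "(p, tvec_of d p v) \<in> slit A" by (rule tvec_of_in_slit[OF d p(1,4)])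
        ultimately show "bump x0 r (transition d c (fst w)) *\<^sub>R
          fderiv (transition c d) (transition d c (fst w)) b = prep d (frame_field c x0 r b) w"
          using p d by (simp add: prep_def frame_field_def tvec_of_def jac_def)
      qed
      then show ?thesis using U q True by (intro exI[of _ ?U]) auto
    next
      case False
      let ?U = "?O2 \<times> (- {0::'e})"
      have U: "open ?U" by (rule open_Times[OF O2 open_Compl_zero])
      have "smooth_on ?U (prep d (frame_field c x0 r b))"
      proof (rule smooth_on_cong[OF U _ smooth_on_const[of _ 0]])
        fix w assume w: "w \<in> ?U"
        then obtain p v where p: "p \<in> fst d" "\<not> (p \<in> fst c \<and> snd c p \<in> ?C)" "w = (snd d p, v)" "v \<noteq> 0" by auto
        have "chart_inv (sc d) w = (p, tvec_of d p v)" using chart_inv_sc[OF d, of "snd d p" v] p d by simp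
        moreover have "bump x0 r (snd c p) = 0" if "p \<in> fst c"
          using p(2) that r by (intro bump_zero) (auto simp: dist_commute)
        ultimately show "0 = prep d (frame_field c x0 r b) w"
          by (simp add: prep_def frame_field_def)
      qed
      then show ?thesis using U q False by (intro exI[of _ ?U]) auto
    qed
  qed
qed

lemma cov_pf: "linear_connection A D \<Longrightarrow> B \<in> tm_fields A \<Longrightarrow> Y \<in> pi_fields A \<Longrightarrow> cov A D B Y \<in> pi_fields A"
  by (simp add: linear_connection_def)

lemma conn_add:
  assumes "linear_connection A D" "u \<in> slit A" "a \<in> tangent_space (slit_atlas A) u"
    "b \<in> tangent_space (slit_atlas A) u" "Y \<in> pi_fields A"
  shows "D u (a + b) Y = D u a Y + D u b Y"
  using assms unfolding linear_connection_def by blast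

lemma conn_scale:
  assumes "linear_connection A D" "u \<in> slit A" "a \<in> tangent_space (slit_atlas A) u" "Y \<in> pi_fields A"
  shows "D u (r *\<^sub>R a) Y = r *\<^sub>R D u a Y"
  using assms unfolding linear_connection_def by blast

lemma conn_tangent:
  assumes "linear_connection A D" "u \<in> slit A" "a \<in> tangent_space (slit_atlas A) u" "Y \<in> pi_fields A"
  shows "D u a Y \<in> tangent_space A (fst u)"
  using assms unfolding linear_connection_def by blast

lemma conn_add_right:
  assumes "linear_connection A D" "u \<in> slit A" "a \<in> tangent_space (slit_atlas A) u"
    "Y \<in> pi_fields A" "Z \<in> pi_fields A"
  shows "D u a (Y + Z) = D u a Y + D u a Z"
  using assms unfolding linear_connection_def by blast

lemma cov_add_left:
  assumes "linear_connection A D" "B \<in> tm_fields A" "C \<in> tm_fields A" "Y \<in> pi_fields A"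
  shows "cov A D (B + C) Y = cov A D B Y + cov A D C Y"
proof
  fix u show "cov A D (B + C) Y u = (cov A D B Y + cov A D C Y) u"
    using conn_add[OF assms(1) _ tm_tangent[OF assms(2)] tm_tangent[OF assms(3)] assms(4), of u]
    by (cases "u \<in> slit A") (auto simp: cov_def on_slit_def fun_eq_iff)
qed

lemma cov_add_right:
  assumes "linear_connection A D" "B \<in> tm_fields A" "Y \<in> pi_fields A" "Z \<in> pi_fields A"
  shows "cov A D B (Y + Z) = cov A D B Y + cov A D B Z"
proof
  fix u show "cov A D B (Y + Z) u = (cov A D B Y + cov A D B Z) u"
    using conn_add_right[OF assms(1) _ tm_tangent[OF assms(2)] assms(3,4), of u]
    by (cases "u \<in> slit A") (auto simp: cov_def on_slit_def fun_eq_iff)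
qed

text \<open>In a chart, \<open>Z\<close> solves a linear system whose matrix is smooth because it is
  a bump function times the matrix obtained by applying \<open>D\<close> to a globally defined frame.\<close>

lemma vertical_inverse_smooth:
  assumes D: "linear_connection A D"
    and inj: "\<And>u x. u \<in> slit A \<Longrightarrow> x \<in> tangent_space A (fst u) \<Longrightarrow> D u (gamma A u x) (eta A) = 0 \<Longrightarrow> x = 0"
    and Y: "Y \<in> pi_fields A"
    and Z: "\<And>u. u \<in> slit A \<Longrightarrow> Z u \<in> tangent_space A (fst u)" "\<And>u. u \<notin> slit A \<Longrightarrow> Z u = 0"
      "\<And>u. u \<in> slit A \<Longrightarrow> D u (gamma A u (Z u)) (eta A) = Y u"
  shows "Z \<in> pi_fields A"
proof (rule pf_I[OF Z(1,2)])
  fix c assume c: "c \<in> A"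
  show "smooth_on (simg c) (prep c Z)"
  proof (rule smooth_on_local)
    fix z0 assume z0: "z0 \<in> simg c"
    let ?x0 = "fst z0"
    have x0: "?x0 \<in> snd c ` fst c" "snd z0 \<noteq> 0" using z0 img_sc[OF c] by auto
    obtain r where r: "r > 0" "cball ?x0 r \<subseteq> snd c ` fst c"
      using open_contains_cball x0(1) open_img[OF c] by blast
    let ?N = "ball ?x0 r \<times> (- {0::'e})"
    have N: "open ?N" by (rule open_Times[OF open_ball open_Compl_zero])
    have Nsub: "?N \<subseteq> simg c" using r(2) by (auto simp: img_sc[OF c] subset_iff)
    define F where "F z v = (let u = chart_inv (sc c) z in
      bump ?x0 r (fst z) *\<^sub>R D u (gamma A u (tvec_of c (fst u) v)) (eta A) c)" for z :: "'e \<times> 'e" and v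
    have u: "chart_inv (sc c) z \<in> slit A" "fst (chart_inv (sc c) z) \<in> fst c"
      "snd (sc c) (chart_inv (sc c) z) = z" "snd c (fst (chart_inv (sc c) z)) = fst z" if "z \<in> ?N" for z
    proof -
      have "z \<in> simg c" using Nsub that by blast
      then show 1: "chart_inv (sc c) z \<in> slit A" "fst (chart_inv (sc c) z) \<in> fst c"
        "snd (sc c) (chart_inv (sc c) z) = z"
        using simg_slit[OF c] slit.snd_chart_inv[OF sc_in[OF c]] by simp_all
      from 1(3) show "snd c (fst (chart_inv (sc c) z)) = fst z" by (simp add: snd_sc prod_eq_iff)
    qed
    have bp: "bump ?x0 r (fst z) > 0" if "z \<in> ?N" for z
      using that by (intro bump_pos) (auto simp: dist_commute)
    have tv_add: "tvec_of c p (v + w) = tvec_of c p v + tvec_of c p w" if "p \<in> fst c" for p v w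
      by (rule tangent_eqI[OF _ _ c that]) (simp_all add: tvec_of_tangent tangent_add c that)
    have tv_scale: "tvec_of c p (s *\<^sub>R v) = s *\<^sub>R tvec_of c p v" if "p \<in> fst c" for p v s
      by (rule tangent_eqI[OF _ _ c that]) (simp_all add: tvec_of_tangent tangent_scale c that)
    have "smooth_on ?N (prep c Z)"
    proof (rule smooth_on_inverse_family[OF N, where F = F and y = "\<lambda>z. bump ?x0 r (fst z) *\<^sub>R prep c Y z"])
      fix z assume z: "z \<in> ?N"
      let ?u = "chart_inv (sc c) z"
      have t: "tvec_of c (fst ?u) v \<in> tangent_space A (fst ?u)" for v
        using tvec_of_tangent c u(2)[OF z] by blast
      note gt = gamma_tangent[OF u(1)[OF z]]
      show "linear (F z)"
      proof (rule linearI)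
        show "F z (v + w) = F z v + F z w" for v w
          by (simp add: F_def Let_def tv_add u(2)[OF z] gamma_add[OF u(1)[OF z] t t]
              conn_add[OF D u(1)[OF z] gt[OF t] gt[OF t] eta_pf] scaleR_add_right)
        show "F z (s *\<^sub>R v) = s *\<^sub>R F z v" for s v
          by (simp add: F_def Let_def tv_scale u(2)[OF z] gamma_scale[OF u(1)[OF z] t]
              conn_scale[OF D u(1)[OF z] gt[OF t] eta_pf])
      qed
      show "F z (prep c Z z) = bump ?x0 r (fst z) *\<^sub>R prep c Y z"
      proof -
        have "tvec_of c (fst ?u) (Z ?u c) = Z ?u"
          by (rule tangent_eqI[OF t Z(1)[OF u(1)[OF z]] c u(2)[OF z]]) (simp add: c u(2)[OF z])
        then show ?thesis using Z(3)[OF u(1)[OF z]] by (simp add: F_def Let_def prep_def)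
      qed
      fix v assume "F z v = 0"
      then have "D ?u (gamma A ?u (tvec_of c (fst ?u) v)) (eta A) c = 0"
        using bp[OF z] by (simp add: F_def Let_def)
      then have "D ?u (gamma A ?u (tvec_of c (fst ?u) v)) (eta A) = 0"
        by (intro tangent_eqI[OF conn_tangent[OF D u(1)[OF z] gt[OF t] eta_pf] tangent_zero c u(2)[OF z]]) simp
      then have "tvec_of c (fst ?u) v = 0" by (rule inj[OF u(1)[OF z] t])
      then show "v = 0" using tvec_of_self[OF c u(2)[OF z], of v] by simp
    next
      fix b
      let ?X = "frame_field c ?x0 r b"
      have X: "?X \<in> pi_fields A" by (rule frame_field_pf[OF c r])
      have "smooth_on ?N (prep c (cov A D (gamma_field A ?X) (eta A)))"
        by (rule smooth_on_subset[OF pf_smooth[OF cov_pf[OF D gamma_field_tm[OF X] eta_pf] c] Nsub])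
      then show "smooth_on ?N (\<lambda>z. F z b)"
      proof (rule smooth_on_cong[OF N, rotated])
        fix z assume z: "z \<in> ?N"
        let ?u = "chart_inv (sc c) z"
        have t: "tvec_of c (fst ?u) b \<in> tangent_space A (fst ?u)"
          using tvec_of_tangent c u(2)[OF z] by blast
        show "prep c (cov A D (gamma_field A ?X) (eta A)) z = F z b"
          using u[OF z]
          by (simp add: prep_def cov_def on_slit_def gamma_field_def F_def Let_def frame_field_def
              gamma_scale[OF u(1)[OF z] t] conn_scale[OF D u(1)[OF z] gamma_tangent[OF u(1)[OF z] t] eta_pf])
      qed
    next
      show "smooth_on ?N (\<lambda>z. bump ?x0 r (fst z) *\<^sub>R prep c Y z)"
        by (rule smooth_on_scaleR[OF N _ smooth_on_subset[OF pf_smooth[OF Y c] Nsub]],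
            rule smooth_fst_compose[OF N open_UNIV smooth_on_bump[OF open_UNIV]]) simp
    qed
    moreover have "z0 \<in> ?N" using x0 r by (cases z0) simp
    ultimately show "\<exists>U. open U \<and> z0 \<in> U \<and> smooth_on U (prep c Z)" using N by blast
  qed
qed

text \<open>The lifted vector would lie in the vertical and in the horizontal space, so it would
  split both as itself plus 0 and as 0 plus itself, against uniqueness.\<close>

lemma regular_vertical_inj:
  assumes D: "regular_connection A D" and u: "u \<in> slit A" and x: "x \<in> tangent_space A (fst u)"
    and 0: "D u (gamma A u x) (eta A) = 0"
  shows "x = 0"
proof -
  have lin: "linear_connection A D" using D by (simp add: regular_connection_def)
  let ?a = "gamma A u x" and ?P = "\<lambda>a b c. b \<in> vertical_space A u \<and> c \<in> horizontal_space A D u \<and> a = b + c"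
  have a: "?a \<in> tangent_space (slit_atlas A) u" by (rule gamma_tangent[OF u x])
  have "\<exists>!(b, c). ?P ?a b c"
    using D u a unfolding regular_connection_def by blast
  then have ex: "\<exists>!q. ?P ?a (fst q) (snd q)" unfolding case_prod_unfold .
  have z: "D u 0 (eta A) = 0"
    using conn_scale[OF lin u slit.tangent_zero eta_pf, of 0] by simp
  have "?P ?a ?a 0" "?P ?a 0 ?a"
    using a 0 z rho_gamma[OF u x] rho_gamma[OF u tangent_zero] 
    by (simp_all add: vertical_space_def horizontal_space_def K_map_def)
      (metis slit.tangent_zero gamma_scale[OF u tangent_zero, of 0] scaleR_zero_left)
  then have "?a = 0" using ex by (metis fst_conv snd_conv)
  then have "?a = gamma A u 0" using gamma_scale[OF u tangent_zero, of 0] by simp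
  then show ?thesis using gamma_inj[OF u x tangent_zero] by simp
qed

text \<open>Some tangent vector projects to \<open>x\<close>, for instance the one with chart
  components \<open>(x c, 0)\<close>; its horizontal part projects to \<open>x\<close> too. So the
  partial inverse in \<open>beta\<close> is applied inside the image of the horizontal
  space.\<close>

lemma beta_pointwise:
  assumes D: "regular_connection A D" and u: "u \<in> slit A" and x: "x \<in> tangent_space A (fst u)"
  shows "beta A D u x \<in> tangent_space (slit_atlas A) u \<and> D u (beta A D u x) (eta A) = 0 \<and> rho A u (beta A D u x) = x"
proof -
  obtain c where c: "c \<in> A" "fst u \<in> fst c" using slit_chart_ex u by blast
  let ?a = "slit.tvec_of (sc c) u (x c, 0)"
  have a: "?a \<in> tangent_space (slit_atlas A) u"
    by (rule slit.tvec_of_tangent[OF sc_in[OF c(1)] in_sc[OF u c(2)]])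
  have ra: "rho A u ?a = x"
    by (rule tangent_eqI[OF rho_tangent[OF a u] x c])
      (use rho_chart[OF a u c] slit.tvec_of_self[OF sc_in[OF c(1)] in_sc[OF u c(2)]] in simp)
  obtain b h where bh: "b \<in> vertical_space A u" "h \<in> horizontal_space A D u" "?a = b + h"
    using D u a unfolding regular_connection_def by blast
  have "rho A u h = x"
    using rho_add[OF u, of b h] bh ra by (simp add: vertical_space_def horizontal_space_def)
  then have "x \<in> rho A u ` horizontal_space A D u" using bh by blast
  from inv_into_into[OF this] f_inv_into_f[OF this] show ?thesis
    by (simp add: beta_def horizontal_space_def K_map_def)
qed

text \<open>A smooth field \<open>B\<close> over \<open>X\<close> turns smoothness of the lift into
  that of \<open>Z\<close>, where B - \<beta>X = \<gamma>Z. Since the horizontal lift is annihilated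
  by K, \<open>Z\<close> solves K(\<gamma>Z) = K(B), a linear system with smooth data.\<close>

lemma beta_field_props:
  assumes D: "regular_connection A D" and X: "X \<in> pi_fields A" and B: "B \<in> tm_fields A" "rho_field A B = X"
  shows "beta_field A D X \<in> tm_fields A \<and> rho_field A (beta_field A D X) = X
    \<and> cov A D (beta_field A D X) (eta A) = 0"
proof -
  have lin: "linear_connection A D" using D by (simp add: regular_connection_def)
  note bp = beta_pointwise[OF D _ pf_tangent[OF X]]
  define Z where "Z u = (if u \<in> slit A then SOME x. x \<in> tangent_space A (fst u) \<and> B u - beta A D u (X u) = gamma A u x else 0)" for u
  have Z: "Z u \<in> tangent_space A (fst u) \<and> B u - beta A D u (X u) = gamma A u (Z u)" if u: "u \<in> slit A" for u
  proof -
    have b: "beta A D u (X u) \<in> tangent_space (slit_atlas A) u" using bp u by blast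
    have t: "B u - beta A D u (X u) \<in> tangent_space (slit_atlas A) u"
      by (rule slit.tangent_diff[OF tm_tangent[OF B(1)] b])
    have "rho_field A B u = X u" using B(2) by simp
    then have "rho A u (B u) = X u" using u by (simp add: rho_field_def on_slit_def)
    then have "rho A u (B u - beta A D u (X u)) = 0"
      using rho_add[OF u tm_tangent[OF B(1)] slit.tangent_uminus[OF b]] rho_uminus[OF u b] bp[OF u u] by simp
    then obtain x where "x \<in> tangent_space A (fst u)" "B u - beta A D u (X u) = gamma A u x"
      using vertical_is_gamma[OF t u] by blast
    then have "\<exists>x. x \<in> tangent_space A (fst u) \<and> B u - beta A D u (X u) = gamma A u x" by blast
    from someI_ex[OF this] show ?thesis using u by (simp add: Z_def)
  qed
  have "Z \<in> pi_fields A"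
  proof (rule vertical_inverse_smooth[OF lin regular_vertical_inj[OF D] cov_pf[OF lin B(1) eta_pf]])
    fix u assume u: "u \<in> slit A"
    have b: "beta A D u (X u) \<in> tangent_space (slit_atlas A) u" using bp u by blast
    have "B u = gamma A u (Z u) + beta A D u (X u)" using Z[OF u] by (metis diff_add_cancel)
    then have "D u (B u) (eta A) = D u (gamma A u (Z u)) (eta A) + D u (beta A D u (X u)) (eta A)"
      using conn_add[OF lin u gamma_tangent[OF u] b eta_pf, of "Z u"] Z[OF u] by simp
    then show "D u (gamma A u (Z u)) (eta A) = cov A D B (eta A) u"
      using bp[OF u u] u by (simp add: cov_def on_slit_def)
  qed (use Z in \<open>simp_all add: Z_def\<close>)
  then have g: "gamma_field A Z \<in> tm_fields A" by (rule gamma_field_tm)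
  have eq: "beta_field A D X = B - gamma_field A Z"
  proof
    fix u show "beta_field A D X u = (B - gamma_field A Z) u"
      using Z[of u] slit.vf_zero[OF B(1), of u] 
      by (cases "u \<in> slit A") (auto simp: beta_field_def gamma_field_def on_slit_def algebra_simps)
  qed
  show ?thesis
  proof (intro conjI)
    show bt: "beta_field A D X \<in> tm_fields A" unfolding eq by (rule slit.vf_diff[OF B(1) g])
    show "rho_field A (beta_field A D X) = X"
    proof
      fix u show "rho_field A (beta_field A D X) u = X u"
        using bp[of u] pf_zero[OF X, of u] by (cases "u \<in> slit A") (auto simp: rho_field_def beta_field_def on_slit_def)
    qed
    show "cov A D (beta_field A D X) (eta A) = 0"
    proof
      fix u show "cov A D (beta_field A D X) (eta A) u = 0 u"
        using bp[of u] by (cases "u \<in> slit A") (auto simp: cov_def beta_field_def on_slit_def)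
    qed
  qed
qed

end

section \<open>The algebra of Finsler connections\<close>

lemma double_zero: "x + x = (0::'a::real_vector) \<Longrightarrow> x = 0"
  by (metis scaleR_2 scaleR_eq_0_iff zero_neq_numeral)

lemma double_eq: "x + x = y + (y::'a::real_vector) \<Longrightarrow> x = y"
  using double_zero[of "x - y"] by (simp add: algebra_simps)

lemma additive_on_zero:
  fixes f :: "'a::real_vector \<Rightarrow> 'b::real_vector"
  assumes "\<And>x y. x \<in> S \<Longrightarrow> y \<in> S \<Longrightarrow> f (x + y) = f x + f y" "0 \<in> S"
  shows "f 0 = 0"
  using assms(1)[OF assms(2,2)] by simp

lemma additive_on_uminus:
  fixes f :: "'a::real_vector \<Rightarrow> 'b::real_vector"
  assumes f: "\<And>x y. x \<in> S \<Longrightarrow> y \<in> S \<Longrightarrow> f (x + y) = f x + f y" and "0 \<in> S" "x \<in> S" "- x \<in> S"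
  shows "f (- x) = - f x"
  using f[OF assms(3,4)] additive_on_zero[where f = f, OF f assms(2)] by (simp add: eq_neg_iff_add_eq_0 add.commute)

lemma additive_on_diff:
  fixes f :: "'a::real_vector \<Rightarrow> 'b::real_vector"
  assumes f: "\<And>x y. x \<in> S \<Longrightarrow> y \<in> S \<Longrightarrow> f (x + y) = f x + f y" and "0 \<in> S" "x \<in> S" "y \<in> S" "- y \<in> S"
  shows "f (x - y) = f x - f y"
  using f[OF assms(3,5)] additive_on_uminus[where f = f, OF f assms(2,4,5)] by simp

text \<open>
  \<open>VF\<close>, \<open>PF\<close> and \<open>FN\<close> stand for the vector fields on the slit tangent bundle, the \<open>\<pi>\<close>-vector fields and
  the smooth functions; \<open>dv X Y\<close> is the derivative of \<open>Y\<close> along the fibres in the direction \<open>X\<close>.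
  Real linearity suffices: linearity over the smooth functions is never needed, because \<open>g\<close> is
  definite on global fields.
\<close>

locale finsler_algebra =
  fixes VF :: "'v::real_vector set" and PF :: "'p::real_vector set" and FN :: "'f::real_vector set"
    and br :: "'v \<Rightarrow> 'v \<Rightarrow> 'v" and act :: "'v \<Rightarrow> 'f \<Rightarrow> 'f"
    and gam :: "'p \<Rightarrow> 'v" and rho :: "'v \<Rightarrow> 'p" and dv :: "'p \<Rightarrow> 'p \<Rightarrow> 'p"
    and eta :: 'p and E :: 'f and g :: "'p \<Rightarrow> 'p \<Rightarrow> 'f"
  assumes VF_add [simp]: "B \<in> VF \<Longrightarrow> C \<in> VF \<Longrightarrow> B + C \<in> VF"
    and VF_scale: "B \<in> VF \<Longrightarrow> r *\<^sub>R B \<in> VF"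
    and PF_add [simp]: "X \<in> PF \<Longrightarrow> Y \<in> PF \<Longrightarrow> X + Y \<in> PF"
    and PF_scale: "X \<in> PF \<Longrightarrow> r *\<^sub>R X \<in> PF"
    and FN_add [simp]: "f \<in> FN \<Longrightarrow> k \<in> FN \<Longrightarrow> f + k \<in> FN"
    and FN_scale: "f \<in> FN \<Longrightarrow> r *\<^sub>R f \<in> FN"
    and br_VF [simp]: "B \<in> VF \<Longrightarrow> C \<in> VF \<Longrightarrow> br B C \<in> VF"
    and br_add_left: "B \<in> VF \<Longrightarrow> C \<in> VF \<Longrightarrow> A \<in> VF \<Longrightarrow> br (B + C) A = br B A + br C A"
    and br_antisym: "br B C = - br C B"
    and jacobi: "A \<in> VF \<Longrightarrow> B \<in> VF \<Longrightarrow> C \<in> VF \<Longrightarrow> br A (br B C) + br B (br C A) + br C (br A B) = 0"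
    and act_FN [simp]: "B \<in> VF \<Longrightarrow> f \<in> FN \<Longrightarrow> act B f \<in> FN"
    and act_add_left: "B \<in> VF \<Longrightarrow> C \<in> VF \<Longrightarrow> f \<in> FN \<Longrightarrow> act (B + C) f = act B f + act C f"
    and act_add_right: "B \<in> VF \<Longrightarrow> f \<in> FN \<Longrightarrow> k \<in> FN \<Longrightarrow> act B (f + k) = act B f + act B k"
    and act_br: "B \<in> VF \<Longrightarrow> C \<in> VF \<Longrightarrow> f \<in> FN \<Longrightarrow> act (br B C) f = act B (act C f) - act C (act B f)"
    and gam_VF [simp]: "X \<in> PF \<Longrightarrow> gam X \<in> VF"
    and gam_add: "X \<in> PF \<Longrightarrow> Y \<in> PF \<Longrightarrow> gam (X + Y) = gam X + gam Y"
    and gam_inj: "X \<in> PF \<Longrightarrow> Y \<in> PF \<Longrightarrow> gam X = gam Y \<Longrightarrow> X = Y"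
    and rho_PF [simp]: "B \<in> VF \<Longrightarrow> rho B \<in> PF"
    and rho_add: "B \<in> VF \<Longrightarrow> C \<in> VF \<Longrightarrow> rho (B + C) = rho B + rho C"
    and rho_gam [simp]: "X \<in> PF \<Longrightarrow> rho (gam X) = 0"
    and vertical: "B \<in> VF \<Longrightarrow> rho B = 0 \<Longrightarrow> \<exists>X\<in>PF. B = gam X"
    and dv_PF [simp]: "X \<in> PF \<Longrightarrow> Y \<in> PF \<Longrightarrow> dv X Y \<in> PF"
    and dv_add_left: "X \<in> PF \<Longrightarrow> Y \<in> PF \<Longrightarrow> Z \<in> PF \<Longrightarrow> dv (X + Y) Z = dv X Z + dv Y Z"
    and dv_add_right: "X \<in> PF \<Longrightarrow> Y \<in> PF \<Longrightarrow> Z \<in> PF \<Longrightarrow> dv X (Y + Z) = dv X Y + dv X Z"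
    and eta_PF [simp]: "eta \<in> PF"
    and dv_eta [simp]: "X \<in> PF \<Longrightarrow> dv X eta = X"
    and rho_br_gam: "X \<in> PF \<Longrightarrow> B \<in> VF \<Longrightarrow> rho (br (gam X) B) = dv X (rho B)"
    and br_gam_gam: "X \<in> PF \<Longrightarrow> Y \<in> PF \<Longrightarrow> br (gam X) (gam Y) = gam (dv X Y - dv Y X)"
    and E_FN [simp]: "E \<in> FN"
    and act_eta_E: "act (gam eta) E = E + E"
    and g_formula: "X \<in> PF \<Longrightarrow> Y \<in> PF \<Longrightarrow> g X Y = act (gam X) (act (gam Y) E) - act (gam (dv X Y)) E"
    and g_definite: "X \<in> PF \<Longrightarrow> g X X = 0 \<Longrightarrow> X = 0"
begin

lemma VF_closed [simp]: "0 \<in> VF" "B \<in> VF \<Longrightarrow> - B \<in> VF" "B \<in> VF \<Longrightarrow> C \<in> VF \<Longrightarrow> B - C \<in> VF"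
  using VF_scale[of "gam eta" 0] VF_scale[of B "-1"] VF_scale[of C "-1"] VF_add[of B "- C"] by simp_all

lemma PF_closed [simp]: "0 \<in> PF" "X \<in> PF \<Longrightarrow> - X \<in> PF" "X \<in> PF \<Longrightarrow> Y \<in> PF \<Longrightarrow> X - Y \<in> PF"
  using PF_scale[of eta 0] PF_scale[of X "-1"] PF_scale[of Y "-1"] PF_add[of X "- Y"] by simp_all

lemma FN_closed [simp]: "0 \<in> FN" "f \<in> FN \<Longrightarrow> - f \<in> FN" "f \<in> FN \<Longrightarrow> k \<in> FN \<Longrightarrow> f - k \<in> FN"
  using FN_scale[of E 0] FN_scale[of f "-1"] FN_scale[of k "-1"] FN_add[of f "- k"] by simp_all

lemma br_add_right: "B \<in> VF \<Longrightarrow> C \<in> VF \<Longrightarrow> A \<in> VF \<Longrightarrow> br A (B + C) = br A B + br A C"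
  using br_antisym[of A "B + C"] br_antisym[of A B] br_antisym[of A C] br_add_left[of B C A] by simp

lemma br_left [simp]:
  assumes "A \<in> VF"
  shows "br 0 A = 0" "B \<in> VF \<Longrightarrow> br (- B) A = - br B A"
    "B \<in> VF \<Longrightarrow> C \<in> VF \<Longrightarrow> br (B - C) A = br B A - br C A"
    "B \<in> VF \<Longrightarrow> C \<in> VF \<Longrightarrow> br (B + C) A = br B A + br C A"
  by (rule additive_on_zero[of VF "\<lambda>B. br B A"] additive_on_uminus[of VF "\<lambda>B. br B A"]
      additive_on_diff[of VF "\<lambda>B. br B A"] br_add_left; simp add: assms br_add_left)+

lemma br_right [simp]:
  assumes "A \<in> VF"
  shows "br A 0 = 0" "B \<in> VF \<Longrightarrow> br A (- B) = - br A B"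
    "B \<in> VF \<Longrightarrow> C \<in> VF \<Longrightarrow> br A (B - C) = br A B - br A C"
    "B \<in> VF \<Longrightarrow> C \<in> VF \<Longrightarrow> br A (B + C) = br A B + br A C"
  by (rule additive_on_zero[of VF "br A"] additive_on_uminus[of VF "br A"]
      additive_on_diff[of VF "br A"] br_add_right; simp add: assms br_add_right)+

lemma act_left [simp]:
  assumes "f \<in> FN"
  shows "act 0 f = 0" "B \<in> VF \<Longrightarrow> act (- B) f = - act B f"
    "B \<in> VF \<Longrightarrow> C \<in> VF \<Longrightarrow> act (B - C) f = act B f - act C f"
    "B \<in> VF \<Longrightarrow> C \<in> VF \<Longrightarrow> act (B + C) f = act B f + act C f"
  by (rule additive_on_zero[of VF "\<lambda>B. act B f"] additive_on_uminus[of VF "\<lambda>B. act B f"]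
      additive_on_diff[of VF "\<lambda>B. act B f"] act_add_left; simp add: assms act_add_left)+

lemma act_right [simp]:
  assumes "B \<in> VF"
  shows "act B 0 = 0" "f \<in> FN \<Longrightarrow> act B (- f) = - act B f"
    "f \<in> FN \<Longrightarrow> k \<in> FN \<Longrightarrow> act B (f - k) = act B f - act B k"
    "f \<in> FN \<Longrightarrow> k \<in> FN \<Longrightarrow> act B (f + k) = act B f + act B k"
  by (rule additive_on_zero[of FN "act B"] additive_on_uminus[of FN "act B"]
      additive_on_diff[of FN "act B"] act_add_right; simp add: assms act_add_right)+

lemma gam_arith [simp]:
  shows "gam 0 = 0" "X \<in> PF \<Longrightarrow> gam (- X) = - gam X"
    "X \<in> PF \<Longrightarrow> Y \<in> PF \<Longrightarrow> gam (X - Y) = gam X - gam Y"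
    "X \<in> PF \<Longrightarrow> Y \<in> PF \<Longrightarrow> gam (X + Y) = gam X + gam Y"
  by (rule additive_on_zero[of PF gam] additive_on_uminus[of PF gam]
      additive_on_diff[of PF gam] gam_add; simp add: gam_add)+

lemma rho_arith [simp]:
  shows "rho 0 = 0" "B \<in> VF \<Longrightarrow> rho (- B) = - rho B"
    "B \<in> VF \<Longrightarrow> C \<in> VF \<Longrightarrow> rho (B - C) = rho B - rho C"
    "B \<in> VF \<Longrightarrow> C \<in> VF \<Longrightarrow> rho (B + C) = rho B + rho C"
  by (rule additive_on_zero[of VF rho] additive_on_uminus[of VF rho]
      additive_on_diff[of VF rho] rho_add; simp add: rho_add)+

lemma dv_left [simp]:
  assumes "Z \<in> PF"
  shows "dv 0 Z = 0" "X \<in> PF \<Longrightarrow> dv (- X) Z = - dv X Z"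
    "X \<in> PF \<Longrightarrow> Y \<in> PF \<Longrightarrow> dv (X - Y) Z = dv X Z - dv Y Z"
    "X \<in> PF \<Longrightarrow> Y \<in> PF \<Longrightarrow> dv (X + Y) Z = dv X Z + dv Y Z"
  by (rule additive_on_zero[of PF "\<lambda>X. dv X Z"] additive_on_uminus[of PF "\<lambda>X. dv X Z"]
      additive_on_diff[of PF "\<lambda>X. dv X Z"] dv_add_left; simp add: assms dv_add_left)+

lemma dv_right [simp]:
  assumes "Z \<in> PF"
  shows "dv Z 0 = 0" "X \<in> PF \<Longrightarrow> dv Z (- X) = - dv Z X"
    "X \<in> PF \<Longrightarrow> Y \<in> PF \<Longrightarrow> dv Z (X - Y) = dv Z X - dv Z Y"
    "X \<in> PF \<Longrightarrow> Y \<in> PF \<Longrightarrow> dv Z (X + Y) = dv Z X + dv Z Y"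
  by (rule additive_on_zero[of PF "dv Z"] additive_on_uminus[of PF "dv Z"]
      additive_on_diff[of PF "dv Z"] dv_add_right; simp add: assms dv_add_right)+

lemma g_FN [simp]: "X \<in> PF \<Longrightarrow> Y \<in> PF \<Longrightarrow> g X Y \<in> FN"
  by (simp add: g_formula)

lemma g_left [simp]:
  assumes "Z \<in> PF"
  shows "g 0 Z = 0" "X \<in> PF \<Longrightarrow> g (- X) Z = - g X Z"
    "X \<in> PF \<Longrightarrow> Y \<in> PF \<Longrightarrow> g (X - Y) Z = g X Z - g Y Z"
    "X \<in> PF \<Longrightarrow> Y \<in> PF \<Longrightarrow> g (X + Y) Z = g X Z + g Y Z"
  using assms by (simp_all add: g_formula)

lemma g_right [simp]:
  assumes "Z \<in> PF"
  shows "g Z 0 = 0" "X \<in> PF \<Longrightarrow> g Z (- X) = - g Z X"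
    "X \<in> PF \<Longrightarrow> Y \<in> PF \<Longrightarrow> g Z (X - Y) = g Z X - g Z Y"
    "X \<in> PF \<Longrightarrow> Y \<in> PF \<Longrightarrow> g Z (X + Y) = g Z X + g Z Y"
  using assms by (simp_all add: g_formula)

text \<open>The skew part of \<open>g_formula\<close> is the derivative of E along
  [\<gamma>X, \<gamma>Y] minus that along the vertical lift of \<open>dv X Y - dv Y X\<close>, and
  these fields coincide.\<close>

lemma g_sym: "X \<in> PF \<Longrightarrow> Y \<in> PF \<Longrightarrow> g X Y = g Y X"
  using act_br[of "gam X" "gam Y" E] by (simp add: g_formula br_gam_gam algebra_simps)

lemma g_eta: "X \<in> PF \<Longrightarrow> g X eta = act (gam X) E"
  by (simp add: g_formula act_eta_E)

lemma g_eqI: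
  assumes "X \<in> PF" "Y \<in> PF" "\<And>Z. Z \<in> PF \<Longrightarrow> g X Z = g Y Z"
  shows "X = Y"
  using g_definite[of "X - Y"] assms by simp

end

section \<open>The canonical spray and the fibre derivative of the metric\<close>

text \<open>\<open>spray\<close> is the defining equation of the canonical spray with the exterior
  derivative expanded, \<open>act (gam (rho B)) E\<close> being the value of d_J E on
  \<open>B\<close>.\<close>

locale finsler_spray = finsler_algebra +
  fixes G
  assumes G_VF [simp]: "G \<in> VF"
    and spray: "B \<in> VF \<Longrightarrow> act G (act (gam (rho B)) E) - act B (act (gam (rho G)) E) - act (gam (rho (br G B))) E
        = - act B E"
begin

text \<open>On vertical fields the spray equation reduces to g(Y, \<rho>G) = dE(\<gamma>Y), and the
  right side is g(Y, \<eta>) by homogeneity. Definiteness concludes.\<close>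

lemma rho_G [simp]: "rho G = eta"
proof (rule g_eqI)
  fix Y assume Y: "Y \<in> PF"
  have "rho (br G (gam Y)) = - dv Y (rho G)"
    using rho_br_gam[of Y G] br_antisym[of G "gam Y"] Y by simp
  then have "act (gam (dv Y (rho G))) E - act (gam Y) (act (gam (rho G)) E) = - act (gam Y) E"
    using spray[of "gam Y"] Y by simp
  then have "g Y (rho G) = act (gam Y) E"
    using Y by (simp add: g_formula) (metis minus_diff_eq minus_minus)
  then show "g (rho G) Y = g eta Y" using Y g_sym[of Y "rho G"] g_sym[of Y eta] g_eta[of Y] by simp
qed simp_all

text \<open>A global field over any \<open>X\<close>, obtained before there is a horizontal lift: it
  projects to \<open>dv X eta\<close>, that is, to \<open>X\<close>.\<close>

definition lift where "lift X = br (gam X) G"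

lemma lift_VF [simp]: "X \<in> PF \<Longrightarrow> lift X \<in> VF"
  by (simp add: lift_def)

lemma rho_lift [simp]: "X \<in> PF \<Longrightarrow> rho (lift X) = X"
  by (simp add: lift_def rho_br_gam)

text \<open>The Jacobi identity of \<gamma>X, \<gamma>Y and any field over Z, projected by
  \<open>rho\<close>; \<open>lift Z\<close> supplies the third field.\<close>

lemma dv_flat:
  assumes "X \<in> PF" "Y \<in> PF" "Z \<in> PF"
  shows "dv X (dv Y Z) - dv Y (dv X Z) = dv (dv X Y - dv Y X) Z"
proof -
  have "rho (br (gam X) (br (gam Y) (lift Z)) + br (gam Y) (br (lift Z) (gam X))
      + br (lift Z) (br (gam X) (gam Y))) = 0"
    using jacobi[of "gam X" "gam Y" "lift Z"] assms by simp
  moreover have "br (lift Z) (gam X) = - br (gam X) (lift Z)"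
    "br (lift Z) (br (gam X) (gam Y)) = - br (gam (dv X Y - dv Y X)) (lift Z)"
    using br_antisym br_gam_gam assms by metis+
  ultimately show ?thesis
    using assms by (simp add: rho_br_gam del: gam_arith)
qed

text \<open>In coordinates the third fibre derivative of the energy, twice the Cartan
  tensor.\<close>

definition dvg where "dvg X Y Z = act (gam X) (g Y Z) - g (dv X Y) Z - g Y (dv X Z)"

lemma dvg_FN [simp]: "X \<in> PF \<Longrightarrow> Y \<in> PF \<Longrightarrow> Z \<in> PF \<Longrightarrow> dvg X Y Z \<in> FN"
  by (simp add: dvg_def)

lemma dvg_left [simp]: "X \<in> PF \<Longrightarrow> X' \<in> PF \<Longrightarrow> Y \<in> PF \<Longrightarrow> Z \<in> PF \<Longrightarrow> dvg (X - X') Y Z = dvg X Y Z - dvg X' Y Z"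
  by (simp add: dvg_def)

text \<open>Expanded by \<open>g_formula\<close>, exchanging X and Y costs a commutator on
  \<gamma>Z(E), settled by the vertical bracket, and a commutator of \<open>dv\<close> on Z, settled
  by flatness.\<close>

lemma dvg_sym12:
  assumes "X \<in> PF" "Y \<in> PF" "Z \<in> PF"
  shows "dvg X Y Z = dvg Y X Z"
proof -
  have "act (gam (dv X Y - dv Y X)) (act (gam Z) E) = act (gam X) (act (gam Y) (act (gam Z) E)) - act (gam Y) (act (gam X) (act (gam Z) E))"
    using act_br[of "gam X" "gam Y" "act (gam Z) E"] br_gam_gam[of X Y] assms by simp
  moreover have "act (gam (dv X (dv Y Z))) E - act (gam (dv Y (dv X Z))) E = act (gam (dv (dv X Y) Z)) E - act (gam (dv (dv Y X) Z)) E"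
    using arg_cong[OF dv_flat[OF assms], of "\<lambda>X. act (gam X) E"] assms by simp
  ultimately show ?thesis
    using assms by (simp add: dvg_def g_formula algebra_simps)
qed

text \<open>With \<eta> in the second slot the expression collapses to \<open>g_formula\<close>,
  because g(\<eta>, Z) is the derivative of E along \<gamma>Z; symmetry moves \<eta> to the first
  slot.\<close>

lemma dvg_eta: "Y \<in> PF \<Longrightarrow> Z \<in> PF \<Longrightarrow> dvg eta Y Z = 0"
proof -
  assume YZ: "Y \<in> PF" "Z \<in> PF"
  have "dvg Y eta Z = 0"
    using YZ g_eta[of Z] g_eta[of "dv Y Z"] g_sym[of eta Z] g_sym[of eta "dv Y Z"]
    by (simp add: dvg_def g_formula[of Y Z])
  then show ?thesis using dvg_sym12[of eta Y Z] YZ by simp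
qed

lemma act_eta_g:
  assumes "Y \<in> PF" "Z \<in> PF"
  shows "act (gam eta) (g Y Z) = g (dv eta Y) Z + g Y (dv eta Z)"
  using dvg_eta[OF assms] by (simp add: dvg_def algebra_simps)

text \<open>The third fibre derivative of the energy is homogeneous of degree -1. The extra
  \<open>- dvg X Y Z\<close> comes from \<open>dv X eta = X\<close>, which enters when
  \<open>dv eta\<close> is commuted past \<open>dv X\<close>.\<close>

lemma dvg_homogeneous:
  assumes "X \<in> PF" "Y \<in> PF" "Z \<in> PF"
  shows "act (gam eta) (dvg X Y Z) - dvg X (dv eta Y) Z - dvg X Y (dv eta Z) = dvg (dv eta X) Y Z - dvg X Y Z"
proof -
  have 1: "act (gam eta) (act (gam X) (g Y Z)) = act (gam X) (act (gam eta) (g Y Z))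
      + act (gam (dv eta X)) (g Y Z) - act (gam X) (g Y Z)"
    using act_br[of "gam eta" "gam X" "g Y Z"] br_gam_gam[of eta X] assms by (simp add: algebra_simps)
  have 2: "dv eta (dv X Y) = dv X (dv eta Y) + dv (dv eta X) Y - dv X Y" if "Y \<in> PF" for Y
    using dv_flat[of eta X Y] that assms by (simp add: algebra_simps)
  show ?thesis
    using assms by (simp add: dvg_def 1 2 act_eta_g algebra_simps)
qed

end

section \<open>Torsion, splitting and Bianchi identities of one connection\<close>

text \<open>What the Cartan and the Hashiguchi connection share. The lift enters through its
  properties, and the two torsion conditions are written with the projected brackets already
  evaluated.\<close>

locale finsler_connection = finsler_spray +
  fixes D and \<beta>
  assumes D_PF [simp]: "B \<in> VF \<Longrightarrow> Y \<in> PF \<Longrightarrow> D B Y \<in> PF"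
    and D_add_left: "B \<in> VF \<Longrightarrow> C \<in> VF \<Longrightarrow> Y \<in> PF \<Longrightarrow> D (B + C) Y = D B Y + D C Y"
    and D_add_right: "B \<in> VF \<Longrightarrow> Y \<in> PF \<Longrightarrow> Z \<in> PF \<Longrightarrow> D B (Y + Z) = D B Y + D B Z"
    and beta_VF [simp]: "X \<in> PF \<Longrightarrow> \<beta> X \<in> VF"
    and rho_beta [simp]: "X \<in> PF \<Longrightarrow> rho (\<beta> X) = X"
    and D_beta_eta [simp]: "X \<in> PF \<Longrightarrow> D (\<beta> X) eta = 0"
    and vertical_metric: "X \<in> PF \<Longrightarrow> Y \<in> PF \<Longrightarrow> Z \<in> PF \<Longrightarrow>
        act (gam X) (g Y Z) = g (D (gam X) Y) Z + g Y (D (gam X) Z)"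
    and T_symmetry: "X \<in> PF \<Longrightarrow> Y \<in> PF \<Longrightarrow> Z \<in> PF \<Longrightarrow>
        g (D (gam X) Y - dv X Y) Z = g (D (gam X) Z - dv X Z) Y"
    and Q_zero: "X \<in> PF \<Longrightarrow> Y \<in> PF \<Longrightarrow> D (\<beta> X) Y - D (\<beta> Y) X = rho (br (\<beta> X) (\<beta> Y))"
begin

lemma D_left [simp]:
  assumes "Y \<in> PF"
  shows "D 0 Y = 0" "B \<in> VF \<Longrightarrow> D (- B) Y = - D B Y"
    "B \<in> VF \<Longrightarrow> C \<in> VF \<Longrightarrow> D (B - C) Y = D B Y - D C Y"
    "B \<in> VF \<Longrightarrow> C \<in> VF \<Longrightarrow> D (B + C) Y = D B Y + D C Y"
  by (rule additive_on_zero[of VF "\<lambda>B. D B Y"] additive_on_uminus[of VF "\<lambda>B. D B Y"]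
      additive_on_diff[of VF "\<lambda>B. D B Y"] D_add_left; simp add: assms D_add_left)+

lemma D_right [simp]:
  assumes "B \<in> VF"
  shows "D B 0 = 0" "X \<in> PF \<Longrightarrow> D B (- X) = - D B X"
    "X \<in> PF \<Longrightarrow> Y \<in> PF \<Longrightarrow> D B (X - Y) = D B X - D B Y"
    "X \<in> PF \<Longrightarrow> Y \<in> PF \<Longrightarrow> D B (X + Y) = D B X + D B Y"
  by (rule additive_on_zero[of PF "D B"] additive_on_uminus[of PF "D B"]
      additive_on_diff[of PF "D B"] D_add_right; simp add: assms D_add_right)+

text \<open>The torsion of (\<gamma>X, \<beta>Y): the middle term vanishes since \<rho>\<gamma> = 0,
  and the projected bracket is \<open>dv X Y\<close>. In this form the lift has disappeared.\<close>

definition T where "T X Y = D (gam X) Y - dv X Y"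

lemma T_PF [simp]: "X \<in> PF \<Longrightarrow> Y \<in> PF \<Longrightarrow> T X Y \<in> PF"
  by (simp add: T_def)

lemma T_left [simp]:
  assumes "Z \<in> PF"
  shows "T 0 Z = 0" "X \<in> PF \<Longrightarrow> T (- X) Z = - T X Z"
    "X \<in> PF \<Longrightarrow> Y \<in> PF \<Longrightarrow> T (X - Y) Z = T X Z - T Y Z"
    "X \<in> PF \<Longrightarrow> Y \<in> PF \<Longrightarrow> T (X + Y) Z = T X Z + T Y Z"
  using assms by (simp_all add: T_def)

lemma T_right [simp]:
  assumes "Z \<in> PF"
  shows "T Z 0 = 0" "X \<in> PF \<Longrightarrow> T Z (- X) = - T Z X"
    "X \<in> PF \<Longrightarrow> Y \<in> PF \<Longrightarrow> T Z (X - Y) = T Z X - T Z Y"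
    "X \<in> PF \<Longrightarrow> Y \<in> PF \<Longrightarrow> T Z (X + Y) = T Z X + T Z Y"
  using assms by (simp_all add: T_def)

lemma D_gam: "X \<in> PF \<Longrightarrow> Y \<in> PF \<Longrightarrow> D (gam X) Y = T X Y + dv X Y"
  by (simp add: T_def)

lemma T_swap: "X \<in> PF \<Longrightarrow> Y \<in> PF \<Longrightarrow> Z \<in> PF \<Longrightarrow> g (T X Y) Z = g (T X Z) Y"
  using T_symmetry by (simp add: T_def)

lemma dvg_T:
  assumes "X \<in> PF" "Y \<in> PF" "Z \<in> PF"
  shows "dvg X Y Z = g (T X Y) Z + g (T X Y) Z"
proof -
  have "dvg X Y Z = g (T X Y) Z + g Y (T X Z)"
    using assms by (simp add: dvg_def T_def vertical_metric)
  then show ?thesis using T_swap[OF assms] g_sym[of Y "T X Z"] assms by simp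
qed

lemma T_sym:
  assumes "X \<in> PF" "Y \<in> PF"
  shows "T X Y = T Y X"
proof (rule g_eqI)
  fix Z assume "Z \<in> PF"
  then show "g (T X Y) Z = g (T Y X) Z"
    using dvg_T[of X Y Z] dvg_T[of Y X Z] dvg_sym12[of X Y Z] assms by (metis double_eq)
qed (use assms in simp_all)

lemma T_eta [simp]: assumes "X \<in> PF" shows "T eta X = 0" "T X eta = 0"
proof -
  have "T eta X = 0"
  proof (rule g_eqI)
    fix Z assume "Z \<in> PF"
    then have "g (T eta X) Z + g (T eta X) Z = 0"
      using dvg_T[of eta X Z] dvg_eta[of X Z] assms by simp
    then have "g (T eta X) Z = 0" by (rule double_zero)
    then show "g (T eta X) Z = g 0 Z" using \<open>Z \<in> PF\<close> by simp
  qed (use assms in simp_all)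
  then show "T eta X = 0" "T X eta = 0" using T_sym[of X eta] assms by simp_all
qed

lemma D_gam_eta [simp]: "X \<in> PF \<Longrightarrow> D (gam X) eta = X"
  by (simp add: D_gam)

lemma D_eta_direction [simp]: "X \<in> PF \<Longrightarrow> D (gam eta) X = dv eta X"
  by (simp add: D_gam)

text \<open>A field is determined by its projection and its image under K: the difference is some
  \<gamma>X, and X equals K(\<gamma>X) = 0. Identities between fields are proved below by comparing
  these two \<pi>-vector fields.\<close>

lemma VF_eqI:
  assumes "B \<in> VF" "C \<in> VF" "rho B = rho C" "D B eta = D C eta"
  shows "B = C"
proof -
  obtain X where X: "X \<in> PF" "B - C = gam X" using vertical[of "B - C"] assms by auto
  then have "X = D (B - C) eta" by simp
  also have "\<dots> = 0" using assms by simp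
  finally show ?thesis using X by simp
qed

lemma decomp: "B \<in> VF \<Longrightarrow> B = \<beta> (rho B) + gam (D B eta)"
  by (rule VF_eqI) simp_all

lemma beta_arith [simp]:
  shows "\<beta> 0 = 0" "X \<in> PF \<Longrightarrow> \<beta> (- X) = - \<beta> X"
    "X \<in> PF \<Longrightarrow> Y \<in> PF \<Longrightarrow> \<beta> (X - Y) = \<beta> X - \<beta> Y"
    "X \<in> PF \<Longrightarrow> Y \<in> PF \<Longrightarrow> \<beta> (X + Y) = \<beta> X + \<beta> Y"
  by (rule VF_eqI; simp)+

definition cur where "cur B C Z = - D B (D C Z) + D C (D B Z) + D (br B C) Z"

lemma cur_PF [simp]: "B \<in> VF \<Longrightarrow> C \<in> VF \<Longrightarrow> Z \<in> PF \<Longrightarrow> cur B C Z \<in> PF"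
  by (simp add: cur_def)

lemma cur_left [simp]:
  assumes "C \<in> VF" "Z \<in> PF"
  shows "cur 0 C Z = 0" "B \<in> VF \<Longrightarrow> cur (- B) C Z = - cur B C Z"
    "B \<in> VF \<Longrightarrow> B' \<in> VF \<Longrightarrow> cur (B - B') C Z = cur B C Z - cur B' C Z"
    "B \<in> VF \<Longrightarrow> B' \<in> VF \<Longrightarrow> cur (B + B') C Z = cur B C Z + cur B' C Z"
  using assms by (simp_all add: cur_def)

lemma cur_right [simp]:
  assumes "C \<in> VF" "Z \<in> PF"
  shows "cur C 0 Z = 0" "B \<in> VF \<Longrightarrow> cur C (- B) Z = - cur C B Z"
    "B \<in> VF \<Longrightarrow> B' \<in> VF \<Longrightarrow> cur C (B - B') Z = cur C B Z - cur C B' Z"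
    "B \<in> VF \<Longrightarrow> B' \<in> VF \<Longrightarrow> cur C (B + B') Z = cur C B Z + cur C B' Z"
  using assms by (simp_all add: cur_def)

lemma cur_antisym: "B \<in> VF \<Longrightarrow> C \<in> VF \<Longrightarrow> Z \<in> PF \<Longrightarrow> cur B C Z = - cur C B Z"
  using br_antisym[of B C] by (simp add: cur_def)

definition Rh where "Rh X Y = cur (\<beta> X) (\<beta> Y) eta"
definition Ph where "Ph X Y = cur (\<beta> X) (gam Y) eta"

lemma RPh_PF [simp]: "X \<in> PF \<Longrightarrow> Y \<in> PF \<Longrightarrow> Rh X Y \<in> PF" "X \<in> PF \<Longrightarrow> Y \<in> PF \<Longrightarrow> Ph X Y \<in> PF"
  by (simp_all add: Rh_def Ph_def)

lemma Ph_left [simp]: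
  assumes "Z \<in> PF"
  shows "X \<in> PF \<Longrightarrow> Y \<in> PF \<Longrightarrow> Ph (X - Y) Z = Ph X Z - Ph Y Z"
  using assms by (simp add: Ph_def)

lemma D_br_beta_beta: "X \<in> PF \<Longrightarrow> Y \<in> PF \<Longrightarrow> D (br (\<beta> X) (\<beta> Y)) eta = Rh X Y"
  by (simp add: Rh_def cur_def)

text \<open>The horizontal part is the condition Q = 0. The vertical part is the contracted
  curvature, whose iterated terms vanish because horizontal derivatives kill \<eta>.\<close>

lemma br_beta_beta:
  "X \<in> PF \<Longrightarrow> Y \<in> PF \<Longrightarrow> br (\<beta> X) (\<beta> Y) = \<beta> (D (\<beta> X) Y) - \<beta> (D (\<beta> Y) X) + gam (Rh X Y)"
  using decomp[of "br (\<beta> X) (\<beta> Y)"] by (simp add: D_br_beta_beta Q_zero[symmetric])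

lemma br_beta_gam:
  assumes "X \<in> PF" "Y \<in> PF"
  shows "br (\<beta> X) (gam Y) = - \<beta> (dv Y X) + gam (D (\<beta> X) Y) + gam (Ph X Y)"
proof -
  have "D (br (\<beta> X) (gam Y)) eta = D (\<beta> X) Y + Ph X Y" using assms by (simp add: Ph_def cur_def)
  moreover have "rho (br (\<beta> X) (gam Y)) = - dv Y X"
    using rho_br_gam[of Y "\<beta> X"] br_antisym[of "\<beta> X" "gam Y"] assms by simp
  ultimately show ?thesis using decomp[of "br (\<beta> X) (gam Y)"] assms by simp
qed

lemma br_gam_beta:
  assumes "X \<in> PF" "Y \<in> PF"
  shows "br (gam Y) (\<beta> X) = \<beta> (dv Y X) - gam (D (\<beta> X) Y) - gam (Ph X Y)"
  using br_beta_gam[OF assms] br_antisym[of "gam Y" "\<beta> X"] by simp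

text \<open>Expanding the curvatures, all triple products of D cancel and D of the Jacobi sum
  remains. Stated with brackets of fields instead of a covariant derivative of the curvature, the
  identity contains no torsion.\<close>

lemma second_bianchi:
  assumes "A \<in> VF" "B \<in> VF" "C \<in> VF" "W \<in> PF"
  shows "D A (cur B C W) - cur B C (D A W) + D B (cur C A W) - cur C A (D B W)
    + D C (cur A B W) - cur A B (D C W)
    + cur A (br B C) W + cur B (br C A) W + cur C (br A B) W = 0"
proof -
  have "D (br A (br B C) + br B (br C A) + br C (br A B)) W = 0"
    using jacobi[of A B C] assms by simp
  then show ?thesis using assms by (simp add: cur_def algebra_simps)
qed

text \<open>The projected Jacobi identity of three horizontal lifts. As Q vanishes, torsion arises
  only from the vertical parts \<gamma>\<open>Rh\<close> of the brackets.\<close>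

lemma first_bianchi:
  assumes X: "X \<in> PF" and Y: "Y \<in> PF" and Z: "Z \<in> PF"
  shows "cur (\<beta> X) (\<beta> Y) Z + cur (\<beta> Y) (\<beta> Z) X + cur (\<beta> Z) (\<beta> X) Y
    = T (Rh X Y) Z + T (Rh Y Z) X + T (Rh Z X) Y"
proof -
  have step: "- D (\<beta> X) (D (\<beta> Y) Z - D (\<beta> Z) Y) + D (br (\<beta> Y) (\<beta> Z)) X + rho (br (\<beta> X) (br (\<beta> Y) (\<beta> Z)))
      = T (Rh Y Z) X"
    if X: "X \<in> PF" and Y: "Y \<in> PF" and Z: "Z \<in> PF" for X Y Z
  proof -
    let ?U = "D (\<beta> Y) Z - D (\<beta> Z) Y"
    have U: "?U \<in> PF" using that by simp
    have b: "br (\<beta> Y) (\<beta> Z) = \<beta> ?U + gam (Rh Y Z)" using that by (simp add: br_beta_beta)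
    have r: "rho (br (\<beta> X) (gam (Rh Y Z))) = - dv (Rh Y Z) X"
      using rho_br_gam[of "Rh Y Z" "\<beta> X"] br_antisym[of "\<beta> X" "gam (Rh Y Z)"] that by simp
    have "D (br (\<beta> Y) (\<beta> Z)) X = D (\<beta> ?U) X + D (gam (Rh Y Z)) X"
      using b that D_left(4)[OF X beta_VF[OF U] gam_VF[OF RPh_PF(1)[OF Y Z]]] by simp
    moreover have "rho (br (\<beta> X) (br (\<beta> Y) (\<beta> Z))) = rho (br (\<beta> X) (\<beta> ?U)) - dv (Rh Y Z) X"
      using b r X Y Z U by (simp del: beta_arith D_right)
    moreover have "rho (br (\<beta> X) (\<beta> ?U)) = D (\<beta> X) ?U - D (\<beta> ?U) X"
      using Q_zero[OF X U] by simp
    ultimately show ?thesis using X Y Z by (simp add: T_def)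
  qed
  have "rho (br (\<beta> X) (br (\<beta> Y) (\<beta> Z))) + rho (br (\<beta> Y) (br (\<beta> Z) (\<beta> X))) + rho (br (\<beta> Z) (br (\<beta> X) (\<beta> Y))) = 0"
    using arg_cong[OF jacobi[of "\<beta> X" "\<beta> Y" "\<beta> Z"], of rho] assms by simp
  then have J: "rho (br (\<beta> Z) (br (\<beta> X) (\<beta> Y))) =
      - rho (br (\<beta> X) (br (\<beta> Y) (\<beta> Z))) - rho (br (\<beta> Y) (br (\<beta> Z) (\<beta> X)))"
    by (simp add: add_eq_0_iff algebra_simps)
  show ?thesis
    unfolding step[OF X Y Z, symmetric] step[OF Y Z X, symmetric] step[OF Z X Y, symmetric] J
    using assms by (simp add: cur_def algebra_simps)
qed

text \<open>The projected Jacobi identity of one vertical and two horizontal fields. Its use is at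
  \<open>Z = eta\<close>, where the left side begins with \<open>Ph X Y\<close>.\<close>

lemma mixed_bianchi:
  assumes X: "X \<in> PF" and Y: "Y \<in> PF" and Z: "Z \<in> PF"
  shows "cur (\<beta> X) (gam Y) Z - cur (\<beta> Z) (gam Y) X =
    - D (\<beta> X) (T Y Z) + D (\<beta> Z) (T Y X) + T Y (D (\<beta> X) Z - D (\<beta> Z) X)
    + T (Ph X Y + D (\<beta> X) Y) Z - T (Ph Z Y + D (\<beta> Z) Y) X"
proof -
  have r: "rho (br (\<beta> U) (gam V)) = - dv V U" if "U \<in> PF" "V \<in> PF" for U V
    using rho_br_gam[of V "\<beta> U"] br_antisym[of "\<beta> U" "gam V"] that by simp
  have q: "rho (br (\<beta> X) (\<beta> (dv Y Z))) = D (\<beta> X) (dv Y Z) - D (\<beta> (dv Y Z)) X"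
    "rho (br (\<beta> Z) (\<beta> (dv Y X))) = D (\<beta> Z) (dv Y X) - D (\<beta> (dv Y X)) Z"
    using Q_zero assms by simp_all
  have f1: "rho (br (gam Y) (br (\<beta> X) (\<beta> Z))) = dv Y (D (\<beta> X) Z - D (\<beta> Z) X)"
    using assms rho_br_gam[of Y "br (\<beta> X) (\<beta> Z)"] Q_zero[of X Z] by simp
  have f2: "rho (br (\<beta> X) (br (\<beta> Z) (gam Y))) =
     - rho (br (\<beta> X) (\<beta> (dv Y Z))) - dv (D (\<beta> Z) Y) X - dv (Ph Z Y) X"
    using assms by (simp add: br_beta_gam r)
  have f3: "rho (br (\<beta> Z) (br (gam Y) (\<beta> X))) =
     rho (br (\<beta> Z) (\<beta> (dv Y X))) + dv (D (\<beta> X) Y) Z + dv (Ph X Y) Z"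
    using assms by (simp add: br_gam_beta r)
  have "rho (br (gam Y) (br (\<beta> X) (\<beta> Z))) + rho (br (\<beta> X) (br (\<beta> Z) (gam Y))) + rho (br (\<beta> Z) (br (gam Y) (\<beta> X))) = 0"
    using arg_cong[OF jacobi[of "gam Y" "\<beta> X" "\<beta> Z"], of rho] assms by simp
  then have J: "dv Y (D (\<beta> X) Z) - dv Y (D (\<beta> Z) X) - D (\<beta> X) (dv Y Z) + D (\<beta> (dv Y Z)) X - dv (D (\<beta> Z) Y) X - dv (Ph Z Y) X
      + D (\<beta> Z) (dv Y X) - D (\<beta> (dv Y X)) Z + dv (D (\<beta> X) Y) Z + dv (Ph X Y) Z = 0"
    unfolding f1 f2 f3 q using assms by (simp add: algebra_simps)
  show ?thesis
    using J assms by (simp add: cur_def br_beta_gam D_gam algebra_simps)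
qed

text \<open>The Ricci identity for g: the curvature acts on g as the commutator of second covariant
  derivatives. The first derivative is kept as an arbitrary \<open>n\<close>, so that metric and
  non-metric connections are covered.\<close>

lemma cur_metric_defect:
  fixes n
  assumes n: "\<And>B Z W. n B Z W = act B (g Z W) - g (D B Z) W - g Z (D B W)"
    and BC: "B \<in> VF" "C \<in> VF" "Z \<in> PF" "W \<in> PF"
  shows "g (cur B C Z) W + g Z (cur B C W) =
    (act B (n C Z W) - n C (D B Z) W - n C Z (D B W)) - (act C (n B Z W) - n B (D C Z) W - n B Z (D C W))
    - n (br B C) Z W"
  using act_br[of B C "g Z W"] BC by (simp add: n cur_def algebra_simps)

text \<open>With G = \<beta>\<eta> + \<gamma>Y, the spray equation is evaluated on \<beta>Y.
  Conservation of E removes the terms differentiated along \<beta>Y, the second hypothesis cancels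
  those along \<beta>\<eta>, and exactly g(Y, Y) is left.\<close>

lemma beta_eta_eq_G:
  assumes E: "\<And>X. X \<in> PF \<Longrightarrow> act (\<beta> X) E = 0"
    and met: "\<And>X. X \<in> PF \<Longrightarrow> act (\<beta> eta) (g X eta) = g (D (\<beta> eta) X) eta"
  shows "\<beta> eta = G"
proof -
  obtain Y where Y: "Y \<in> PF" "G - \<beta> eta = gam Y" using vertical[of "G - \<beta> eta"] by auto
  then have G: "G = \<beta> eta + gam Y" by (metis diff_add_cancel add.commute)
  have r: "rho (br (\<beta> eta) (\<beta> Y)) = D (\<beta> eta) Y" using Q_zero[of eta Y] Y by simp
  have "act (\<beta> eta) (act (gam Y) E) = act (gam (D (\<beta> eta) Y)) E"
    using met[of Y] g_eta Y by simp
  moreover have "act G (act (gam Y) E) - act (gam (rho (br G (\<beta> Y)))) E = 0"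
    using spray[of "\<beta> Y"] Y E[of Y] by (simp add: act_eta_E)
  ultimately have "g Y Y = 0"
    using Y r by (simp add: g_formula rho_br_gam G)
  then have "Y = 0" using g_definite Y by blast
  then show ?thesis using Y by simp
qed

text \<open>For X = \<rho>B one has [\<gamma>X, G] = \<beta>X - \<gamma>(D_G X) and \<rho>[B, G] =
  KB - D_G X, so the derivative along G cancels and both sides have projection X and K-image
  -KB.\<close>

lemma barthel_eq:
  assumes G: "\<beta> eta = G" and P: "\<And>X. X \<in> PF \<Longrightarrow> Ph eta X = 0" and B: "B \<in> VF"
  shows "br (gam (rho B)) G - gam (rho (br B G)) = \<beta> (rho B) + \<beta> (rho B) - B"
proof (rule VF_eqI)
  let ?X = "rho B" and ?Y = "D B eta"
  have XY: "?X \<in> PF" "?Y \<in> PF" using B by simp_all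
  show "rho (br (gam ?X) G - gam (rho (br B G))) = rho (\<beta> ?X + \<beta> ?X - B)"
    using B by (simp add: rho_br_gam)
  have "br (gam ?X) G = \<beta> ?X - gam (D G ?X)"
    using br_gam_beta[of eta ?X] P[OF XY(1)] XY by (simp add: G)
  moreover have "rho (br B G) = ?Y - D G ?X"
  proof -
    have "br B G = br (\<beta> ?X) (\<beta> eta) + br (gam ?Y) G"
      using decomp[OF B] XY G br_left(4)[of G "\<beta> ?X" "gam ?Y"] by simp
    then show ?thesis
      using Q_zero[of ?X eta] XY by (simp add: rho_br_gam G)
  qed
  ultimately show "D (br (gam ?X) G - gam (rho (br B G))) eta = D (\<beta> ?X + \<beta> ?X - B) eta"
    using XY B by simp
qed (use B in simp_all)

text \<open>Split \<open>D (gam X)\<close> into \<open>T X\<close> and \<open>dv X\<close>. The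
  parts with \<open>dv\<close> alone cancel by flatness, those with T because T is homogeneous of
  degree -1.\<close>

lemma S_eta:
  assumes "X \<in> PF" "Z \<in> PF"
  shows "cur (gam X) (gam eta) Z = 0"
proof -
  have hom: "dv eta (T X Z) - T X (dv eta Z) = T (dv eta X) Z - T X Z"
  proof (rule g_eqI)
    fix W assume W: "W \<in> PF"
    show "g (dv eta (T X Z) - T X (dv eta Z)) W = g (T (dv eta X) Z - T X Z) W"
      by (rule double_eq)
        (use dvg_homogeneous[of X Z W] assms W in \<open>simp add: dvg_T act_eta_g algebra_simps\<close>)
  qed (use assms in simp_all)
  have "dv X (dv eta Z) - dv eta (dv X Z) = dv X Z - dv (dv eta X) Z"
    using dv_flat[of X eta Z] assms by simp
  then show ?thesis
    using assms hom by (simp add: cur_def D_gam br_gam_gam algebra_simps)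
qed

end

section \<open>The Cartan connection\<close>

locale finsler_cartan = finsler_connection +
  assumes metric: "B \<in> VF \<Longrightarrow> Y \<in> PF \<Longrightarrow> Z \<in> PF \<Longrightarrow> act B (g Y Z) = g (D B Y) Z + g Y (D B Z)"
begin

lemma cur_antisym_metric:
  assumes "B \<in> VF" "C \<in> VF" "Z \<in> PF" "W \<in> PF"
  shows "g (cur B C Z) W = - g Z (cur B C W)"
  using cur_metric_defect[OF refl assms] assms by (simp add: metric eq_neg_iff_add_eq_0)

text \<open>Since 2E = g(\<eta>, \<eta>), metricity and \<open>D_beta_eta\<close> suffice.\<close>

lemma beta_E:
  assumes X: "X \<in> PF"
  shows "act (\<beta> X) E = 0"
proof (rule double_zero)
  have "g eta eta = E + E" using g_eta[of eta] by (simp add: act_eta_E)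
  then have "act (\<beta> X) (E + E) = 0" using metric[of "\<beta> X" eta eta] X by simp
  then show "act (\<beta> X) E + act (\<beta> X) E = 0" using X by simp
qed

lemma beta_eta: "\<beta> eta = G"
  by (rule beta_eta_eq_G) (simp_all add: beta_E metric)

lemma T_eta_metric: "X \<in> PF \<Longrightarrow> Y \<in> PF \<Longrightarrow> g (T X Y) eta = 0"
  using T_swap[of X Y eta] by simp

lemma Ph_eta: assumes Y: "Y \<in> PF" shows "Ph eta Y = 0"
proof (rule g_eqI)
  fix X assume X: "X \<in> PF"
  have "g (Ph X Y) eta = - g eta (Ph X Y)"
    using cur_antisym_metric[of "\<beta> X" "gam Y" eta eta] X Y by (simp add: Ph_def)
  also have "g eta (Ph X Y) = g (Ph X Y) eta" by (rule g_sym) (use X Y in simp_all)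
  finally have "g (Ph X Y) eta = - g (Ph X Y) eta" .
  then have 1: "g (Ph X Y) eta = 0" by (rule_tac double_zero) (simp only: eq_neg_iff_add_eq_0)
  have 2: "g (D (\<beta> U) (T Y V)) eta = 0" if "U \<in> PF" "V \<in> PF" for U V
    using metric[of "\<beta> U" "T Y V" eta] that Y by (simp add: T_eta_metric)
  \<comment> \<open>At \<open>Z = eta\<close> every torsion term on the right is orthogonal to
    \<eta>. As \<open>Ph X Y\<close> is orthogonal to \<eta> too, so is P(\<eta>, Y)X; skewness
    turns this into g(X, Ph(\<eta>, Y)) = 0.\<close>
  have "g (cur (\<beta> X) (gam Y) eta - cur (\<beta> eta) (gam Y) X) eta = 0"
    unfolding mixed_bianchi[OF X Y eta_PF] using X Y by (simp add: 2 T_eta_metric)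
  then have "g (cur (\<beta> eta) (gam Y) X) eta = 0"
    using 1 X Y by (simp add: Ph_def)
  then show "g (Ph eta Y) X = g 0 X"
    using cur_antisym_metric[of "\<beta> eta" "gam Y" X eta] g_sym[of X "Ph eta Y"] X Y by (simp add: Ph_def)
qed (use Y in simp_all)

end

section \<open>The Hashiguchi connection\<close>

locale finsler_hashiguchi = finsler_connection +
  assumes Ph_zero: "X \<in> PF \<Longrightarrow> Y \<in> PF \<Longrightarrow> Ph X Y = 0"
    and conservative: "X \<in> PF \<Longrightarrow> act (\<beta> X) E = 0"
begin

text \<open>Horizontal metricity is missing here, but it is needed against \<eta> only. There g(X,
  \<eta>) is a derivative of E, and as horizontal fields kill E, commuting leaves the vertical part
  of [\<beta>\<eta>, \<gamma>X].\<close>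

lemma beta_eta: "\<beta> eta = G"
proof (rule beta_eta_eq_G[OF conservative])
  fix X assume X: "X \<in> PF"
  have "act (\<beta> eta) (g X eta) = act (br (\<beta> eta) (gam X)) E"
    using act_br[of "\<beta> eta" "gam X" E] X by (simp add: g_eta conservative)
  also have "\<dots> = g (D (\<beta> eta) X) eta"
    using X by (simp add: br_beta_gam Ph_zero conservative g_eta)
  finally show "act (\<beta> eta) (g X eta) = g (D (\<beta> eta) X) eta" .
qed

text \<open>Applying K to the Jacobi identity of \<gamma>\<eta>, \<beta>X and \<gamma>Z shows that
  horizontal differentiation is homogeneous of degree 0; with Ph = 0 the curvature is precisely this
  expression.\<close>

lemma P_eta:
  assumes X: "X \<in> PF" and Z: "Z \<in> PF"
  shows "cur (\<beta> X) (gam eta) Z = 0"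
proof -
  have k: "D (br (gam V) (\<beta> U)) eta = - D (\<beta> U) V" "D (br (\<beta> U) (gam V)) eta = D (\<beta> U) V"
    if "U \<in> PF" "V \<in> PF" for U V
    using that by (simp_all add: br_gam_beta br_beta_gam Ph_zero)
  have f1: "D (br (gam eta) (br (\<beta> X) (gam Z))) eta = dv eta (D (\<beta> X) Z) - D (\<beta> X) Z"
    using X Z by (simp add: br_beta_gam Ph_zero k br_gam_gam)
  have f2: "D (br (\<beta> X) (br (gam Z) (gam eta))) eta = D (\<beta> X) Z - D (\<beta> X) (dv eta Z)"
    using X Z by (simp add: br_gam_gam k)
  have f3: "D (br (gam Z) (br (gam eta) (\<beta> X))) eta = - D (\<beta> (dv eta X)) Z"
    using X Z by (simp add: br_gam_beta Ph_zero k)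
  have "D (br (gam eta) (br (\<beta> X) (gam Z))) eta + D (br (\<beta> X) (br (gam Z) (gam eta))) eta + D (br (gam Z) (br (gam eta) (\<beta> X))) eta = 0"
    using arg_cong[OF jacobi[of "gam eta" "\<beta> X" "gam Z"], of "\<lambda>B. D B eta"] X Z by simp
  then have "dv eta (D (\<beta> X) Z) - D (\<beta> X) (dv eta Z) - D (\<beta> (dv eta X)) Z = 0"
    unfolding f1 f2 f3 by (simp add: algebra_simps)
  then show ?thesis
    using X Z by (simp add: cur_def br_beta_gam Ph_zero algebra_simps)
qed

end

section \<open>Comparison of the two connections\<close>

locale finsler_pair = C: finsler_cartan VF PF FN br act gam rho dv eta E g G D \<beta>
  + H: finsler_hashiguchi VF PF FN br act gam rho dv eta E g G Ds \<beta>s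
  for VF PF FN br act gam rho dv eta E g G D \<beta> Ds \<beta>s
begin

text \<open>Both instances of \<open>barthel_eq\<close> at B = \<beta>X have the same left side, in
  which only G occurs.\<close>

lemma beta_eq:
  assumes X: "X \<in> PF"
  shows "\<beta>s X = \<beta> X"
proof (rule double_eq)
  have "\<beta> X = \<beta>s X + \<beta>s X - \<beta> X"
    using C.barthel_eq[OF C.beta_eta C.Ph_eta, of "\<beta> X"] H.barthel_eq[OF H.beta_eta H.Ph_zero, of "\<beta> X"] X
    by simp
  then show "\<beta>s X + \<beta>s X = \<beta> X + \<beta> X" by (simp add: algebra_simps)
qed

lemma T_eq:
  assumes "X \<in> PF" "Y \<in> PF"
  shows "H.T X Y = C.T X Y"
proof (rule C.g_eqI)
  fix Z assume "Z \<in> PF"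
  then show "g (H.T X Y) Z = g (C.T X Y) Z"
    using C.dvg_T[of X Y Z] H.dvg_T[of X Y Z] assms by (metis double_eq)
qed (use assms in simp_all)

lemma Ds_gam: "X \<in> PF \<Longrightarrow> Y \<in> PF \<Longrightarrow> Ds (gam X) Y = D (gam X) Y"
  by (simp add: C.D_gam H.D_gam T_eq)

lemma K_eq:
  assumes B: "B \<in> VF"
  shows "Ds B eta = D B eta"
proof (rule C.gam_inj)
  have "\<beta> (rho B) + gam (Ds B eta) = \<beta> (rho B) + gam (D B eta)"
    using C.decomp[OF B] H.decomp[OF B] beta_eq[of "rho B"] B by simp
  then show "gam (Ds B eta) = gam (D B eta)" by simp
qed (use B in simp_all)

lemma Ds_beta:
  assumes "X \<in> PF" "Y \<in> PF"
  shows "Ds (\<beta> X) Y = D (\<beta> X) Y + C.Ph X Y"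
proof (rule C.gam_inj)
  show "gam (Ds (\<beta> X) Y) = gam (D (\<beta> X) Y + C.Ph X Y)"
    using C.br_beta_gam[OF assms] H.br_beta_gam[OF assms] assms
    by (simp add: beta_eq H.Ph_zero)
qed (use assms beta_eq[OF assms(1)] in simp_all)

lemma Rh_eq: "X \<in> PF \<Longrightarrow> Y \<in> PF \<Longrightarrow> H.Rh X Y = C.Rh X Y"
  using H.D_br_beta_beta[of X Y] C.D_br_beta_beta[of X Y] K_eq[of "br (\<beta> X) (\<beta> Y)"] by (simp add: beta_eq)

text \<open>Q vanishes for both connections over the same lift, and their difference in horizontal
  directions is Ph.\<close>

lemma Ph_sym: "X \<in> PF \<Longrightarrow> Y \<in> PF \<Longrightarrow> C.Ph X Y = C.Ph Y X"
  using C.Q_zero[of X Y] H.Q_zero[of X Y] by (simp add: beta_eq Ds_beta algebra_simps)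

text \<open>\<open>P(\<eta>,Y)X\<close> is symmetric in \<open>X, Y\<close> by the Bianchi identity and skew in its last two slots by
  metricity, hence zero; the Bianchi identity then reads \<open>Ph = D\<^bsub>\<beta>\<eta>\<^esub> T\<close>.\<close>

lemma Ph_T:
  assumes X: "X \<in> PF" and Y: "Y \<in> PF"
  shows "C.Ph X Y = D G (C.T Y X) - C.T Y (D G X) - C.T (D G Y) X"
proof -
  let ?P = "\<lambda>Y X. C.cur (\<beta> eta) (gam Y) X"
  let ?T' = "\<lambda>Y X. D G (C.T Y X) - C.T Y (D G X) - C.T (D G Y) X"
  have P: "?P Y X = C.Ph X Y - ?T' Y X" if "X \<in> PF" "Y \<in> PF" for X Y
    using C.mixed_bianchi[of X Y eta] that
    by (simp add: C.Ph_def[symmetric] C.Ph_eta C.beta_eta algebra_simps)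
  have sym: "?P Y X = ?P X Y" if "X \<in> PF" "Y \<in> PF" for X Y
    unfolding P[OF that] P[OF that(2,1)]
    using that Ph_sym[OF that] C.T_sym[OF that] C.T_sym[of Y "D G X"] C.T_sym[of "D G Y" X]
    by (simp add: algebra_simps)
  define a where "a Y X W = g (?P Y X) W" for Y X W
  have s: "a Y X W = a X Y W" if "X \<in> PF" "Y \<in> PF" for X Y W using sym[OF that] by (simp add: a_def)
  have k: "a Y X W = - a Y W X" if "X \<in> PF" "Y \<in> PF" "W \<in> PF" for X Y W
    using C.cur_antisym_metric[of "\<beta> eta" "gam Y" X W] that C.g_sym[of X "?P Y W"] by (simp add: a_def)
  have "?P Y X = 0"
  proof (rule C.g_eqI)
    fix W assume W: "W \<in> PF"
    have "a Y X W = - a Y X W"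
      using s[OF X Y, of W] k[OF Y X W] s[OF W X, of Y] k[OF X W Y] s[OF Y W, of X] k[OF W Y X] by simp
    then have "a Y X W = 0" by (rule_tac double_zero) (simp only: eq_neg_iff_add_eq_0)
    then show "g (?P Y X) W = g 0 W" using W by (simp add: a_def)
  qed (use X Y in simp_all)
  then show ?thesis using P[OF X Y] by simp
qed

text \<open>By \<open>Ph_T\<close> and metricity, g(Ph(Y, X), Z) is the covariant derivative along G
  of the trilinear form g(T(X, Y), Z), so it inherits the symmetry of that form.\<close>

lemma Ph_swap:
  assumes X: "X \<in> PF" and Y: "Y \<in> PF" and Z: "Z \<in> PF"
  shows "g (C.Ph X Y) Z = g (C.Ph X Z) Y"
proof -
  have *: "g (C.Ph Y X) Z = act G (g (C.T X Y) Z) - g (C.T X Y) (D G Z) - g (C.T X Z) (D G Y) - g (C.T (D G X) Y) Z"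
    if Y: "Y \<in> PF" and Z: "Z \<in> PF" for Y Z
    using Ph_T[OF Y X] C.metric[of G "C.T X Y" Z] C.T_swap[of X "D G Y" Z] X Y Z by simp
  show ?thesis
    unfolding Ph_sym[OF X Y] Ph_sym[OF X Z] *[OF Y Z] *[OF Z Y]
    using C.T_swap[of X Y Z] C.T_swap[of "D G X" Y Z] X Y Z
    by (simp add: algebra_simps)
qed

lemma S_eq: "X \<in> PF \<Longrightarrow> Y \<in> PF \<Longrightarrow> Z \<in> PF \<Longrightarrow> H.cur (gam X) (gam Y) Z = C.cur (gam X) (gam Y) Z"
  by (simp add: C.cur_def H.cur_def C.br_gam_gam Ds_gam)

lemma hashiguchi_curvature_metric:
  assumes "X \<in> PF" "Y \<in> PF" "Z \<in> PF" "W \<in> PF"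
  defines "F \<equiv> \<lambda>X Y Z. g (C.Ph X Y) Z"
  defines "DF \<equiv> \<lambda>B X Y Z. act B (F X Y Z) - F (Ds B X) Y Z - F X (Ds B Y) Z - F X Y (Ds B Z)"
  shows "g (H.cur (\<beta> X) (\<beta> Y) Z) W + g (H.cur (\<beta> X) (\<beta> Y) W) Z
    = DF (\<beta> Y) X Z W - DF (\<beta> X) Y Z W + (DF (\<beta> Y) X Z W - DF (\<beta> X) Y Z W)"
proof -
  define n where "n B Z W = act B (g Z W) - g (Ds B Z) W - g Z (Ds B W)" for B Z W
  \<comment> \<open>\<open>Ds\<close> exceeds the metric connection by Ph once in each slot of g,
    and \<open>Ph_swap\<close> makes the two corrections equal.\<close>
  have nb: "n (\<beta> U) Z W = - F U Z W - F U Z W" if "U \<in> PF" "Z \<in> PF" "W \<in> PF" for U Z W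
    using that C.metric[of "\<beta> U" Z W] Ph_swap[of U Z W] C.g_sym[of Z "C.Ph U W"]
    by (simp add: n_def Ds_beta F_def algebra_simps)
  have ng: "n (gam U) Z W = 0" if "U \<in> PF" "Z \<in> PF" "W \<in> PF" for U Z W
    using that H.vertical_metric[of U Z W] by (simp add: n_def)
  have na: "n (B + C) Z W = n B Z W + n C Z W" if "B \<in> VF" "C \<in> VF" "Z \<in> PF" "W \<in> PF" for B C Z W
    using that by (simp add: n_def algebra_simps)
  let ?U = "Ds (\<beta> X) Y - Ds (\<beta> Y) X"
  \<comment> \<open>The vertical part does not contribute, by vertical metricity. The horizontal
    part supplies the terms of \<open>DF\<close> in which the first argument of \<open>F\<close> is
    differentiated.\<close>
  have "br (\<beta> X) (\<beta> Y) = \<beta> ?U + gam (C.Rh X Y)"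
    using H.br_beta_beta[of X Y] assms by (simp add: beta_eq Rh_eq)
  then have "n (br (\<beta> X) (\<beta> Y)) Z W = - F ?U Z W - F ?U Z W"
    using na[of "\<beta> ?U" "gam (C.Rh X Y)" Z W] nb[of ?U Z W] ng[of "C.Rh X Y" Z W] assms
    by (simp del: C.beta_arith)
  then have nU: "n (br (\<beta> X) (\<beta> Y)) Z W =
     - (F (Ds (\<beta> X) Y) Z W - F (Ds (\<beta> Y) X) Z W) - (F (Ds (\<beta> X) Y) Z W - F (Ds (\<beta> Y) X) Z W)"
    using assms by (simp add: F_def)
  have FF: "F U Z W \<in> FN" if "U \<in> PF" "Z \<in> PF" "W \<in> PF" for U Z W
    using that by (simp add: F_def)
  have "g (H.cur (\<beta> X) (\<beta> Y) Z) W + g Z (H.cur (\<beta> X) (\<beta> Y) W) =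
    (act (\<beta> X) (n (\<beta> Y) Z W) - n (\<beta> Y) (Ds (\<beta> X) Z) W - n (\<beta> Y) Z (Ds (\<beta> X) W))
    - (act (\<beta> Y) (n (\<beta> X) Z W) - n (\<beta> X) (Ds (\<beta> Y) Z) W - n (\<beta> X) Z (Ds (\<beta> Y) W))
    - n (br (\<beta> X) (\<beta> Y)) Z W"
    by (rule H.cur_metric_defect[OF n_def]) (use assms in simp_all)
  then show ?thesis
    using C.g_sym[of Z "H.cur (\<beta> X) (\<beta> Y) W"] assms(1-4)
    by (simp add: nb nU FF DF_def algebra_simps)
qed

lemma hashiguchi_first_bianchi:
  assumes "X \<in> PF" "Y \<in> PF" "Z \<in> PF"
  shows "(H.cur (\<beta> X) (\<beta> Y) Z - C.T (C.Rh X Y) Z) + (H.cur (\<beta> Y) (\<beta> Z) X - C.T (C.Rh Y Z) X)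
    + (H.cur (\<beta> Z) (\<beta> X) Y - C.T (C.Rh Z X) Y) = 0"
  using H.first_bianchi[OF assms] assms by (simp add: beta_eq Rh_eq T_eq algebra_simps)

text \<open>\<open>DR\<close> and \<open>DP\<close> are the covariant derivatives of the h- and
  hv-curvature of \<open>Ds\<close>, written with the lift of the Cartan connection.\<close>

definition DR where "DR B X Y W = Ds B (H.cur (\<beta> X) (\<beta> Y) W) - H.cur (\<beta> (Ds B X)) (\<beta> Y) W
    - H.cur (\<beta> X) (\<beta> (Ds B Y)) W - H.cur (\<beta> X) (\<beta> Y) (Ds B W)"
definition DP where "DP B X Y W = Ds B (H.cur (\<beta> X) (gam Y) W) - H.cur (\<beta> (Ds B X)) (gam Y) W
    - H.cur (\<beta> X) (gam (Ds B Y)) W - H.cur (\<beta> X) (gam Y) (Ds B W)"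

lemma br_bb: "X \<in> PF \<Longrightarrow> Y \<in> PF \<Longrightarrow> br (\<beta> X) (\<beta> Y) = \<beta> (Ds (\<beta> X) Y) - \<beta> (Ds (\<beta> Y) X) + gam (C.Rh X Y)"
  using H.br_beta_beta[of X Y] by (simp add: beta_eq Rh_eq)

text \<open>The fibre derivative is traded for a covariant one minus torsion, so that brackets
  supply exactly the correction terms in \<open>DR\<close> and \<open>DP\<close>.\<close>

lemma br_bg: "X \<in> PF \<Longrightarrow> Y \<in> PF \<Longrightarrow> br (\<beta> X) (gam Y) = \<beta> (C.T Y X) - \<beta> (Ds (gam Y) X) + gam (Ds (\<beta> X) Y)"
  using H.br_beta_gam[of X Y] by (simp add: beta_eq H.Ph_zero H.D_gam T_eq)

lemma br_gb: "X \<in> PF \<Longrightarrow> Y \<in> PF \<Longrightarrow> br (gam Y) (\<beta> X) = \<beta> (Ds (gam Y) X) - \<beta> (C.T Y X) - gam (Ds (\<beta> X) Y)"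
  using br_bg[of X Y] C.br_antisym[of "gam Y" "\<beta> X"] by (simp add: algebra_simps)

lemma hashiguchi_second_bianchi:
  assumes "X \<in> PF" "Y \<in> PF" "Z \<in> PF" "W \<in> PF"
  shows "(DR (\<beta> X) Y Z W + H.cur (\<beta> X) (gam (C.Rh Y Z)) W) + (DR (\<beta> Y) Z X W + H.cur (\<beta> Y) (gam (C.Rh Z X)) W)
    + (DR (\<beta> Z) X Y W + H.cur (\<beta> Z) (gam (C.Rh X Y)) W) = 0"
  using H.second_bianchi[of "\<beta> X" "\<beta> Y" "\<beta> Z" W] assms
    H.cur_antisym[of "\<beta> (Ds (\<beta> X) Y)" "\<beta> Z" W] H.cur_antisym[of "\<beta> (Ds (\<beta> Y) Z)" "\<beta> X" W]
    H.cur_antisym[of "\<beta> (Ds (\<beta> Z) X)" "\<beta> Y" W]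
  by (simp add: DR_def br_bb algebra_simps)

text \<open>The general identity for one vertical and two horizontal fields. T enters through the
  mixed brackets, S through the vertical part of [\<beta>Y, \<beta>Z]; the instances of
  \<open>cur_antisym\<close> only normalise the order of arguments.\<close>

lemma hashiguchi_mixed_bianchi:
  assumes "X \<in> PF" "Y \<in> PF" "Z \<in> PF" "W \<in> PF"
  shows "DR (gam X) Y Z W + DP (\<beta> Y) Z X W - DP (\<beta> Z) Y X W + H.cur (\<beta> (C.T X Y)) (\<beta> Z) W
    - C.cur (gam (C.Rh Y Z)) (gam X) W - H.cur (\<beta> (C.T X Z)) (\<beta> Y) W = 0"
  using H.second_bianchi[of "gam X" "\<beta> Y" "\<beta> Z" W] assms
    H.cur_antisym[of "gam X" "\<beta> Y" W] H.cur_antisym[of "gam X" "\<beta> Y" "Ds (\<beta> Z) W"]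
    H.cur_antisym[of "gam X" "\<beta> (Ds (\<beta> Y) Z)" W] H.cur_antisym[of "gam X" "\<beta> (Ds (\<beta> Z) Y)" W]
    H.cur_antisym[of "gam X" "gam (C.Rh Y Z)" W] H.cur_antisym[of "\<beta> Z" "\<beta> (Ds (gam X) Y)" W]
    H.cur_antisym[of "\<beta> Z" "\<beta> (C.T X Y)" W] H.cur_antisym[of "\<beta> Y" "\<beta> (C.T X Z)" W]
  by (simp add: DR_def DP_def br_bb br_bg br_gb S_eq[symmetric] algebra_simps)

text \<open>In the terms with derivatives of the hv-curvature the slot \<eta> survives
  differentiation, because horizontal derivatives of \<eta> vanish; hence these terms are 0 as
  well.\<close>

lemma hashiguchi_curvature_homogeneous:
  assumes "Y \<in> PF" "Z \<in> PF" "W \<in> PF"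
  shows "DR (gam eta) Y Z W = 0"
proof -
  have P: "H.cur (\<beta> U) (gam eta) V = 0" if "U \<in> PF" "V \<in> PF" for U V
    using H.P_eta[OF that] that by (simp add: beta_eq)
  have "Ds (\<beta> U) eta = 0" if "U \<in> PF" for U using H.D_beta_eta[OF that] that by (simp add: beta_eq)
  then show ?thesis
    using hashiguchi_mixed_bianchi[of eta Y Z W] assms by (simp add: DP_def P C.S_eta)
qed

end

section \<open>The Cartan and Hashiguchi connections\<close>

context manifold
begin

section \<open>From charts and sections to the algebraic setting\<close>

lemma act_energy:
  assumes L: "smooth_fun (slit_atlas A) L" and B: "B \<in> tm_fields A" and u: "u \<in> slit A"
  shows "slit.act B (energy L) u = L u * slit.act B L u"
proof -
  obtain c where c: "c \<in> A" "fst u \<in> fst c" using slit_chart_ex u by blast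
  note cu = sc_in[OF c(1)] in_sc[OF u c(2)]
  let ?L = "L \<circ> chart_inv (sc c)" and ?z = "snd (sc c) u"
  have d: "(?L has_derivative fderiv ?L ?z) (at ?z)"
    by (rule slit.smooth_fun_has_derivative[OF L cu(1)]) (use cu in simp)
  have "((\<lambda>z. (?L z * ?L z) / 2) has_derivative
      (\<lambda>v. (?L ?z * fderiv ?L ?z v + fderiv ?L ?z v * ?L ?z) / 2)) (at ?z)"
    by (rule bounded_linear.has_derivative[OF bounded_linear_divide has_derivative_mult[OF d d]])
  moreover have "(\<lambda>z. (?L z * ?L z) / 2) = energy L \<circ> chart_inv (sc c)"
    by (simp add: energy_def fun_eq_iff power2_eq_square)
  ultimately have "(energy L \<circ> chart_inv (sc c) has_derivative
      (\<lambda>v. (?L ?z * fderiv ?L ?z v + fderiv ?L ?z v * ?L ?z) / 2)) (at ?z)"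
    by simp
  from frechet_derivative_at[OF this, symmetric] show ?thesis
    using slit.act_chart[OF cu B L] slit.act_chart[OF cu B smooth_energy[OF L]] cu by simp
qed

text \<open>The definitions differentiate functions that are not cut off. Agreement on the slit
  bundle is enough, because its chart images are open.\<close>

lemma deriv_along_act:
  assumes "B \<in> tm_fields A" "f \<in> slit.smooth_funs" "u \<in> slit A" "\<And>u. u \<in> slit A \<Longrightarrow> k u = f u"
  shows "deriv_along A B k u = slit.act B f u"
proof -
  have "slit.act B f = slit.act B k"
    by (rule slit.act_cong[OF assms(1)]) (use assms in \<open>auto simp: slit.smooth_funs_def\<close>)
  then show ?thesis using assms(3) by (simp add: deriv_along_def slit.act_def)
qed

lemma met_slit: "u \<in> slit A \<Longrightarrow> metric_fun L X Y u = met L X Y u"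
  by (simp add: met_def on_slit_def)

lemma finsler_algebra_slit:
  assumes L: "smooth_fun (slit_atlas A) L"
    and hom: "\<And>u r. u \<in> tangent_bundle A \<Longrightarrow> r > 0 \<Longrightarrow> L (fst u, r *\<^sub>R snd u) = r * L u"
    and pos: "\<And>u x. u \<in> slit A \<Longrightarrow> x \<in> tangent_space A (fst u) \<Longrightarrow> x \<noteq> 0 \<Longrightarrow> finsler_metric L u x x > 0"
  shows "finsler_algebra (tm_fields A) (pi_fields A) slit.smooth_funs (bracket A) slit.act (gamma_field A)
    (rho_field A) dv (eta A) (E0 L) (met L)"
proof
  note E = smooth_energy[OF L]
  show "slit.act (gamma_field A (eta A)) (E0 L) = E0 L + E0 L"
    using act_eta_E0[OF E hom] by (simp add: scaleR_2)
  fix X assume X: "X \<in> pi_fields A" "met L X X = 0"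
  show "X = 0"
  proof
    fix u show "X u = 0 u"
    proof (cases "u \<in> slit A")
      case True
      have "met L X X u = 0" using X(2) by simp
      then have "finsler_metric L u (X u) (X u) = 0"
        using True by (simp add: met_def on_slit_def metric_fun_def)
      then show ?thesis using pos[OF True pf_tangent[OF X(1) True]] by (cases "X u = 0") auto
    qed (simp add: pf_zero[OF X(1)])
  qed
next
  fix B C :: "('a, 'e) tm_field"
  show "bracket A B C = - bracket A C B" by (rule slit.bracket_antisym)
next
  fix B assume "B \<in> tm_fields A" "rho_field A B = 0"
  then show "\<exists>X\<in>pi_fields A. B = gamma_field A X" using vertical_field by metis
qed (use smooth_energy[OF L] in \<open>simp_all add: slit.vf_add slit.vf_scale pf_add pf_scale slit.smooth_funs_add slit.smooth_funs_scale
      slit.vf_bracket slit.bracket_add slit.jacobi slit.act_closed slit.act_add_left slit.act_add_right slit.act_bracket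
      gamma_field_tm gamma_field_add gamma_field_inj rho_field_pf rho_field_add rho_gamma_field dv_pf dv_add_left
      dv_add_right eta_pf dv_eta rho_bracket_gamma bracket_gamma_gamma E0_smooth met_formula\<close>)

lemma cov_zero: "linear_connection A D \<Longrightarrow> B \<in> tm_fields A \<Longrightarrow> cov A D B 0 = 0"
  using cov_add_right[of D B 0 0] pf_0 by simp

lemma on_slit_eqI:
  assumes "\<And>u. u \<in> slit A \<Longrightarrow> f u = k u" "\<And>u. u \<notin> slit A \<Longrightarrow> f u = 0" "\<And>u. u \<notin> slit A \<Longrightarrow> k u = (0::real)"
  shows "f = k"
  using assms by (metis ext)

lemma act_off_slit: "u \<notin> slit A \<Longrightarrow> slit.act B f u = 0"
  by (simp add: slit.act_def)

lemma met_off_slit: "u \<notin> slit A \<Longrightarrow> met L X Y u = 0"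
  by (simp add: met_def on_slit_def)

end

text \<open>Here 2x - b stands for the Barthel image of b, so the two sides are its horizontal and
  vertical projections.\<close>

lemma half_barthel:
  fixes b x :: "'a::real_vector"
  shows "(1/2) *\<^sub>R (b + (x + x - b)) = x" "(1/2) *\<^sub>R (b - (x + x - b)) = b - x"
proof -
  have "b + (x + x - b) = 2 *\<^sub>R x" "b - (x + x - b) = 2 *\<^sub>R (b - x)"
    by (simp_all add: scaleR_2 algebra_simps)
  then show "(1/2) *\<^sub>R (b + (x + x - b)) = x" "(1/2) *\<^sub>R (b - (x + x - b)) = b - x"
    by simp_all
qed

locale finsler_spray_slit = manifold A +
  S: finsler_spray "tm_fields A" "pi_fields A" "atlas.smooth_funs (slit_atlas A)" "bracket A" "atlas.act (slit_atlas A)"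
    "gamma_field A" "rho_field A" dv "eta A" "E0 L" "met L" G
  for A :: "('a, 'e::euclidean_space) chart set" and L G
begin

lemma beta_props:
  assumes "regular_connection A D" "X \<in> pi_fields A"
  shows "beta_field A D X \<in> tm_fields A" "rho_field A (beta_field A D X) = X"
    "cov A D (beta_field A D X) (eta A) = 0"
  using beta_field_props[OF assms S.lift_VF[OF assms(2)] S.rho_lift[OF assms(2)]] by simp_all

lemma cov_metric_zero:
  assumes D: "regular_connection A D" and B: "B \<in> tm_fields A" and YZ: "Y \<in> pi_fields A" "Z \<in> pi_fields A"
    and 0: "\<And>u. u \<in> slit A \<Longrightarrow> cov_metric A L D B Y Z u = 0"
  shows "slit.act B (met L Y Z) = met L (cov A D B Y) Z + met L Y (cov A D B Z)"
proof (rule on_slit_eqI)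
  fix u assume u: "u \<in> slit A"
  have "deriv_along A B (metric_fun L Y Z) u = slit.act B (met L Y Z) u"
    by (rule deriv_along_act[OF B S.g_FN[OF YZ] u]) (rule met_slit)
  then show "slit.act B (met L Y Z) u = (met L (cov A D B Y) Z + met L Y (cov A D B Z)) u"
    using 0[OF u] by (simp add: cov_metric_def met_slit[OF u])
qed (simp_all add: act_off_slit met_off_slit)

lemma T_tor_eq:
  assumes D: "regular_connection A D" and XY: "X \<in> pi_fields A" "Y \<in> pi_fields A"
  shows "T_tor A D X Y = cov A D (gamma_field A X) Y - dv X Y"
proof -
  have lin: "linear_connection A D" using D by (simp add: regular_connection_def)
  show ?thesis
    using XY beta_props[OF D XY(2)] cov_zero[OF lin]
    by (simp add: T_tor_def torsion_def rho_bracket_gamma)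
qed

lemma connection:
  assumes D: "regular_connection A D"
    and vm: "\<And>X Y Z u. X \<in> pi_fields A \<Longrightarrow> Y \<in> pi_fields A \<Longrightarrow> Z \<in> pi_fields A \<Longrightarrow> u \<in> slit A \<Longrightarrow>
      cov_metric A L D (gamma_field A X) Y Z u = 0"
    and Ts: "T_symmetric A L D"
    and Q: "\<And>X Y. X \<in> pi_fields A \<Longrightarrow> Y \<in> pi_fields A \<Longrightarrow> Q_tor A D X Y = 0"
  shows "finsler_connection (tm_fields A) (pi_fields A) slit.smooth_funs (bracket A) slit.act (gamma_field A)
    (rho_field A) dv (eta A) (E0 L) (met L) G (cov A D) (beta_field A D)"
proof
  fix X Y assume XY: "X \<in> pi_fields A" "Y \<in> pi_fields A"
  show "cov A D (beta_field A D X) Y - cov A D (beta_field A D Y) X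
      = rho_field A (bracket A (beta_field A D X) (beta_field A D Y))"
    using Q[OF XY] beta_props[OF D] XY by (simp add: Q_tor_def torsion_def)
  fix Z assume Z: "Z \<in> pi_fields A"
  show "slit.act (gamma_field A X) (met L Y Z)
      = met L (cov A D (gamma_field A X) Y) Z + met L Y (cov A D (gamma_field A X) Z)"
    by (rule cov_metric_zero[OF D]) (use XY Z vm in simp_all)
  show "met L (cov A D (gamma_field A X) Y - dv X Y) Z = met L (cov A D (gamma_field A X) Z - dv X Z) Y"
  proof (rule on_slit_eqI)
    fix u assume u: "u \<in> slit A"
    then show "met L (cov A D (gamma_field A X) Y - dv X Y) Z u = met L (cov A D (gamma_field A X) Z - dv X Z) Y u"
      using Ts XY Z unfolding T_symmetric_def
      by (simp add: T_tor_eq[OF D] met_slit)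
  qed (simp_all add: met_off_slit)
next
  have lin: "linear_connection A D" using D by (simp add: regular_connection_def)
  fix B C Y Z assume "B \<in> tm_fields A" "Y \<in> pi_fields A"
  then show "cov A D B Y \<in> pi_fields A" using cov_pf[OF lin] by simp
  { assume "C \<in> tm_fields A" then show "cov A D (B + C) Y = cov A D B Y + cov A D C Y"
      using cov_add_left[OF lin] \<open>B \<in> tm_fields A\<close> \<open>Y \<in> pi_fields A\<close> by simp }
  { assume "Z \<in> pi_fields A" then show "cov A D B (Y + Z) = cov A D B Y + cov A D B Z"
      using cov_add_right[OF lin] \<open>B \<in> tm_fields A\<close> \<open>Y \<in> pi_fields A\<close> by simp }
next
  fix X assume "X \<in> pi_fields A"
  then show "beta_field A D X \<in> tm_fields A" "rho_field A (beta_field A D X) = X"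
    "cov A D (beta_field A D X) (eta A) = 0"
    using beta_props[OF D] by simp_all
qed

lemma cartan:
  assumes "cartan_connection A L D"
  shows "finsler_cartan (tm_fields A) (pi_fields A) slit.smooth_funs (bracket A) slit.act (gamma_field A)
    (rho_field A) dv (eta A) (E0 L) (met L) G (cov A D) (beta_field A D)"
proof -
  have D: "regular_connection A D" and Ts: "T_symmetric A L D"
    and m: "\<And>B Y Z u. B \<in> tm_fields A \<Longrightarrow> Y \<in> pi_fields A \<Longrightarrow> Z \<in> pi_fields A \<Longrightarrow> u \<in> slit A \<Longrightarrow> cov_metric A L D B Y Z u = 0"
    and Q: "\<And>X Y. X \<in> pi_fields A \<Longrightarrow> Y \<in> pi_fields A \<Longrightarrow> Q_tor A D X Y = 0"
    using assms unfolding cartan_connection_def by blast+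
  show ?thesis
  proof (intro finsler_cartan.intro finsler_cartan_axioms.intro)
    show "finsler_connection (tm_fields A) (pi_fields A) slit.smooth_funs (bracket A) slit.act (gamma_field A)
      (rho_field A) dv (eta A) (E0 L) (met L) G (cov A D) (beta_field A D)"
      by (rule connection[OF D _ Ts Q]) (simp_all add: m)
    show "slit.act B (met L Y Z) = met L (cov A D B Y) Z + met L Y (cov A D B Z)"
      if "B \<in> tm_fields A" "Y \<in> pi_fields A" "Z \<in> pi_fields A" for B Y Z
      by (rule cov_metric_zero[OF D that m[OF that]])
  qed
qed

lemma hashiguchi:
  assumes L: "smooth_fun (slit_atlas A) L" and Ds: "hashiguchi_connection A L D"
  shows "finsler_hashiguchi (tm_fields A) (pi_fields A) slit.smooth_funs (bracket A) slit.act (gamma_field A)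
    (rho_field A) dv (eta A) (E0 L) (met L) G (cov A D) (beta_field A D)"
proof -
  have D: "regular_connection A D" and Ts: "T_symmetric A L D"
    and m: "\<And>X Y Z u. X \<in> pi_fields A \<Longrightarrow> Y \<in> pi_fields A \<Longrightarrow> Z \<in> pi_fields A \<Longrightarrow> u \<in> slit A \<Longrightarrow>
      cov_metric A L D (gamma_field A X) Y Z u = 0"
    and Q: "\<And>X Y. X \<in> pi_fields A \<Longrightarrow> Y \<in> pi_fields A \<Longrightarrow> Q_tor A D X Y = 0"
    and P: "\<And>X Y. X \<in> pi_fields A \<Longrightarrow> Y \<in> pi_fields A \<Longrightarrow> P_hat A D X Y = 0"
    and c: "\<And>B u. B \<in> tm_fields A \<Longrightarrow> u \<in> slit A \<Longrightarrow> deriv_along A (beta_field A D (rho_field A B)) L u = 0"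
    using Ds unfolding hashiguchi_connection_def by blast+
  have con: "finsler_connection (tm_fields A) (pi_fields A) slit.smooth_funs (bracket A) slit.act (gamma_field A)
      (rho_field A) dv (eta A) (E0 L) (met L) G (cov A D) (beta_field A D)"
    by (rule connection[OF D m Ts Q])
  then interpret H: finsler_connection "tm_fields A" "pi_fields A" slit.smooth_funs "bracket A" slit.act "gamma_field A"
      "rho_field A" dv "eta A" "E0 L" "met L" G "cov A D" "beta_field A D" .
  show ?thesis
  proof (intro finsler_hashiguchi.intro finsler_hashiguchi_axioms.intro con)
    show "H.Ph X Y = 0" if "X \<in> pi_fields A" "Y \<in> pi_fields A" for X Y
      using P[OF that] by (simp add: H.Ph_def H.cur_def P_hat_def P_curv_def curvature_def)
    show "slit.act (beta_field A D X) (E0 L) = 0" if X: "X \<in> pi_fields A" for X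
    proof (rule on_slit_eqI)
      fix u assume u: "u \<in> slit A"
      have B: "beta_field A D X \<in> tm_fields A" using X by simp
      have "slit.act (beta_field A D X) L u = 0"
        using c[OF B u] X u by (simp add: slit.act_def deriv_along_def)
      then show "slit.act (beta_field A D X) (E0 L) u = 0 u"
        using act_energy[OF L B u] act_E0[OF smooth_energy[OF L] B] by simp
    qed (simp_all add: act_off_slit)
  qed
qed

end

lemma finsler_spray_slit:
  assumes F: "finsler_manifold M A L" and G: "canonical_spray A L G"
  shows "finsler_spray_slit A L G"
proof -
  have L: "smooth_fun (slit_atlas A) L"
    and hom: "\<And>u r. u \<in> tangent_bundle A \<Longrightarrow> r > 0 \<Longrightarrow> L (fst u, r *\<^sub>R snd u) = r * L u"
    and pos: "\<And>u x. u \<in> slit A \<Longrightarrow> x \<in> tangent_space A (fst u) \<Longrightarrow> x \<noteq> 0 \<Longrightarrow> finsler_metric L u x x > 0"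
    and M: "smooth_manifold M A"
    using F unfolding finsler_manifold_def by blast+
  interpret manifold A by (rule smooth_manifold_imp_manifold[OF M])
  interpret finsler_algebra "tm_fields A" "pi_fields A" slit.smooth_funs "bracket A" slit.act "gamma_field A"
    "rho_field A" dv "eta A" "E0 L" "met L"
    by (rule finsler_algebra_slit[OF L hom pos])
  have GV: "G \<in> tm_fields A" using G by (simp add: canonical_spray_def)
  have "slit.act G (slit.act (gamma_field A (rho_field A B)) (E0 L)) - slit.act B (slit.act (gamma_field A (rho_field A G)) (E0 L))
      - slit.act (gamma_field A (rho_field A (bracket A G B))) (E0 L) = - slit.act B (E0 L)" if B: "B \<in> tm_fields A" for B
  proof (rule on_slit_eqI)
    fix u assume u: "u \<in> slit A"
    have e: "deriv_along A C (energy L) u = slit.act C (E0 L) u" if "C \<in> tm_fields A" "u \<in> slit A" for C u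
      by (rule deriv_along_act[OF that(1) E_FN that(2)]) (simp add: E0_def on_slit_def)
    have dJ: "dJ_energy A L C u = slit.act (gamma_field A (rho_field A C)) (E0 L) u"
      if "C \<in> tm_fields A" "u \<in> slit A" for C u
      unfolding dJ_energy_def J_field_def by (rule e) (use that in simp_all)
    have ddJ: "deriv_along A C (dJ_energy A L C') u = slit.act C (slit.act (gamma_field A (rho_field A C')) (E0 L)) u"
      if "C \<in> tm_fields A" "C' \<in> tm_fields A" for C C'
      by (rule deriv_along_act[OF that(1) _ u]) (use that dJ in simp_all)
    have "ddJ_energy A L G B u = - deriv_along A B (energy L) u"
      using G B u by (simp add: canonical_spray_def)
    then show "(slit.act G (slit.act (gamma_field A (rho_field A B)) (E0 L)) - slit.act B (slit.act (gamma_field A (rho_field A G)) (E0 L))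
      - slit.act (gamma_field A (rho_field A (bracket A G B))) (E0 L)) u = (- slit.act B (E0 L)) u"
      by (simp add: ddJ_energy_def ddJ dJ e B GV u)
  qed (simp_all add: act_off_slit)
  then show ?thesis
    by (intro finsler_spray_slit.intro finsler_spray.intro finsler_spray_axioms.intro GV)
      (rule manifold_axioms finsler_algebra_axioms | simp)+
qed

theorem theorem6p7:
  fixes M :: "'a topology"
    and A :: "('a, 'e::euclidean_space) chart set"
    and L :: "('a, 'e) tm \<Rightarrow> real"
    and D Ds :: "('a, 'e) conn"
    and G :: "('a, 'e) tm_field"
    and X Y Z W :: "('a, 'e) pi_field"
  assumes "finsler_manifold M A L"
    and "cartan_connection A L D"
    and "hashiguchi_connection A L Ds"
    and "canonical_spray A L G"
    and "X \<in> pi_fields A" and "Y \<in> pi_fields A" and "Z \<in> pi_fields A" and "W \<in> pi_fields A"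
  shows
    "let g = metric_fun L;
         \<beta> = beta_field A D; \<gamma> = gamma_field A; K = K_field A D;
         T = T_tor A D; S = S_curv A D; Ph = P_hat A D; Rh = R_hat A D;
         Rs = R_curv A Ds; Ps = P_curv A Ds;
         Rs4 = (\<lambda>X Y Z W. g (Rs X Y Z) W);
         Ph3 = (\<lambda>X Y Z. g (Ph X Y) Z)
     in
       (\<comment> \<open>(a)\<close>
         \<forall>u\<in>slit A. Rs4 X Y Z W u = - Rs4 Y X Z W u) \<and>
       (\<comment> \<open>(b)\<close>
         \<forall>u\<in>slit A. Rs4 X Y Z W u + Rs4 X Y W Z u
           = 2 * alt_sum (\<lambda>X Y. cov_scalar3 A Ds (\<beta> Y) Ph3 X Z W u) X Y) \<and>
       (\<comment> \<open>(c)\<close>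
         R_hat A Ds X Y = Rh X Y \<and> Rh X Y = - K (barthel_curvature A G (\<beta> X) (\<beta> Y))) \<and>
       (\<comment> \<open>(d)\<close>
         cyclic_sum (\<lambda>X Y Z. Rs X Y Z - T (Rh X Y) Z) X Y Z = 0) \<and>
       (\<comment> \<open>(e)\<close>
         cyclic_sum (\<lambda>X Y Z. cov_vector3 A Ds (\<beta> X) Rs Y Z W + Ps X (Rh Y Z) W) X Y Z = 0) \<and>
       (\<comment> \<open>(f)\<close>
         cov_vector3 A Ds (\<gamma> X) Rs Y Z W + cov_vector3 A Ds (\<beta> Y) Ps Z X W
           - cov_vector3 A Ds (\<beta> Z) Ps Y X W + Rs (T X Y) Z W
           - S (Rh Y Z) X W - Rs (T X Z) Y W = 0) \<and>
       (\<comment> \<open>(g)\<close>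
         cov_vector3 A Ds (\<gamma> (eta A)) Rs X Y Z = 0)"
proof -
  have L: "smooth_fun (slit_atlas A) L" using assms(1) by (simp add: finsler_manifold_def)
  interpret finsler_spray_slit A L G by (rule finsler_spray_slit[OF assms(1,4)])
  interpret finsler_pair "tm_fields A" "pi_fields A" slit.smooth_funs "bracket A" slit.act "gamma_field A"
    "rho_field A" dv "eta A" "E0 L" "met L" G "cov A D" "beta_field A D" "cov A Ds" "beta_field A Ds"
    by (rule finsler_pair.intro[OF cartan[OF assms(2)] hashiguchi[OF L assms(3)]])
  note XYZW = assms(5-8)
  have reg: "regular_connection A D" using assms(2) by (simp add: cartan_connection_def)
  have curD: "curvature A D = C.cur" by (simp add: curvature_def C.cur_def fun_eq_iff)
  have curDs: "curvature A Ds = H.cur" by (simp add: curvature_def H.cur_def fun_eq_iff)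
  \<comment> \<open>The curvatures of \<open>Ds\<close> are defined with its own lift, whereas the
    statement differentiates along the lift of \<open>D\<close>; \<open>beta_eq\<close> identifies
    the two.\<close>
  have Rs: "R_curv A Ds U V Q = H.cur (beta_field A D U) (beta_field A D V) Q"
    if "U \<in> pi_fields A" "V \<in> pi_fields A" for U V Q
    using that by (simp add: R_curv_def curDs beta_eq)
  have Ps: "P_curv A Ds U V Q = H.cur (beta_field A D U) (gamma_field A V) Q"
    if "U \<in> pi_fields A" for U V Q
    using that by (simp add: P_curv_def curDs beta_eq)
  have Rh: "R_hat A D U V = C.Rh U V" for U V by (simp add: R_hat_def R_curv_def curD C.Rh_def)
  have Ph: "P_hat A D U V = C.Ph U V" for U V by (simp add: P_hat_def P_curv_def curD C.Ph_def)
  have T: "T_tor A D U V = C.T U V" if "U \<in> pi_fields A" "V \<in> pi_fields A" for U V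
    using that by (simp add: T_tor_eq[OF reg] C.T_def)
  have S: "S_curv A D U V Q = C.cur (gamma_field A U) (gamma_field A V) Q" for U V Q
    by (simp add: S_curv_def curD)
  have DR: "cov_vector3 A Ds B (R_curv A Ds) U V Q = DR B U V Q"
    if "B \<in> tm_fields A" "U \<in> pi_fields A" "V \<in> pi_fields A" "Q \<in> pi_fields A" for B U V Q
    using that by (simp add: cov_vector3_def DR_def Rs)
  have DP: "cov_vector3 A Ds B (P_curv A Ds) U V Q = DP B U V Q"
    if "B \<in> tm_fields A" "U \<in> pi_fields A" "V \<in> pi_fields A" "Q \<in> pi_fields A" for B U V Q
    using that by (simp add: cov_vector3_def DP_def Ps)
  have a: "metric_fun L (R_curv A Ds X Y Z) W u = - metric_fun L (R_curv A Ds Y X Z) W u" if "u \<in> slit A" for u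
    using that XYZW H.cur_antisym[of "beta_field A D X" "beta_field A D Y" Z] by (simp add: Rs met_slit)
  have b: "metric_fun L (R_curv A Ds X Y Z) W u + metric_fun L (R_curv A Ds X Y W) Z u
      = 2 * alt_sum (\<lambda>X Y. cov_scalar3 A Ds (beta_field A D Y) (\<lambda>X Y. metric_fun L (P_hat A D X Y)) X Z W u) X Y"
    if u: "u \<in> slit A" for u
  proof -
    have c3: "cov_scalar3 A Ds (beta_field A D V) (\<lambda>X Y. metric_fun L (P_hat A D X Y)) U Z W u =
      (slit.act (beta_field A D V) (met L (C.Ph U Z) W) - met L (C.Ph (cov A Ds (beta_field A D V) U) Z) W
        - met L (C.Ph U (cov A Ds (beta_field A D V) Z)) W - met L (C.Ph U Z) (cov A Ds (beta_field A D V) W)) u"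
      if "U \<in> pi_fields A" "V \<in> pi_fields A" for U V
    proof -
      have "deriv_along A (beta_field A D V) (metric_fun L (C.Ph U Z) W) u = slit.act (beta_field A D V) (met L (C.Ph U Z) W) u"
        by (rule deriv_along_act[OF _ _ u met_slit]) (use that XYZW in simp_all)
      then show ?thesis by (simp add: cov_scalar3_def Ph met_slit[OF u])
    qed
    show ?thesis
      using fun_cong[OF hashiguchi_curvature_metric[OF XYZW], of u] XYZW
      by (simp add: alt_sum_def c3 Rs met_slit[OF u])
  qed
  have K: "K_field A D B = cov A D B (eta A)" for B by (simp add: K_field_def K_map_def cov_def)
  have bar: "barthel A G B = beta_field A D (rho_field A B) + beta_field A D (rho_field A B) - B"
    if "B \<in> tm_fields A" for B
    using C.barthel_eq[OF C.beta_eta C.Ph_eta that] by (simp add: barthel_def J_field_def)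
  have c1: "R_hat A Ds X Y = R_hat A D X Y"
    using Rh_eq[of X Y] XYZW by (simp add: Rh) (simp add: R_hat_def R_curv_def curDs H.Rh_def)
  have c2: "R_hat A D X Y = - K_field A D (barthel_curvature A G (beta_field A D X) (beta_field A D Y))"
  proof -
    let ?B = "bracket A (beta_field A D X) (beta_field A D Y)"
    \<comment> \<open>The Barthel connection is twice the horizontal projection minus the identity,
      so horizontal lifts are fixed.\<close>
    have h: "barthel_h A G (beta_field A D U) = beta_field A D U" if "U \<in> pi_fields A" for U
      unfolding barthel_h_def bar[OF C.beta_VF[OF that]] half_barthel using that by simp
    have B: "?B \<in> tm_fields A" using XYZW by simp
    \<comment> \<open>Minus the vertical part of the bracket. K ignores the horizontal part and
      takes the bracket itself to \<open>C.Rh X Y\<close>.\<close>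
    have "barthel_curvature A G (beta_field A D X) (beta_field A D Y) = - (?B - beta_field A D (rho_field A ?B))"
      unfolding barthel_curvature_def h[OF XYZW(1)] h[OF XYZW(2)] barthel_v_def bar[OF B] half_barthel ..
    moreover have "cov A D (- (?B - beta_field A D (rho_field A ?B))) (eta A) = - C.Rh X Y"
      using B C.D_br_beta_beta[OF XYZW(1,2)] by (simp del: C.beta_arith minus_diff_eq)
    ultimately show ?thesis by (simp add: K Rh)
  qed
  have d: "cyclic_sum (\<lambda>X Y Z. R_curv A Ds X Y Z - T_tor A D (R_hat A D X Y) Z) X Y Z = 0"
    using hashiguchi_first_bianchi[OF XYZW(1-3)] XYZW by (simp add: cyclic_sum_def Rs Rh T)
  have e: "cyclic_sum (\<lambda>X Y Z. cov_vector3 A Ds (beta_field A D X) (R_curv A Ds) Y Z W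
      + P_curv A Ds X (R_hat A D Y Z) W) X Y Z = 0"
    using hashiguchi_second_bianchi[OF XYZW] XYZW by (simp add: cyclic_sum_def DR Ps Rh)
  have f: "cov_vector3 A Ds (gamma_field A X) (R_curv A Ds) Y Z W + cov_vector3 A Ds (beta_field A D Y) (P_curv A Ds) Z X W
      - cov_vector3 A Ds (beta_field A D Z) (P_curv A Ds) Y X W + R_curv A Ds (T_tor A D X Y) Z W
      - S_curv A D (R_hat A D Y Z) X W - R_curv A Ds (T_tor A D X Z) Y W = 0"
    using hashiguchi_mixed_bianchi[OF XYZW] XYZW by (simp add: DR DP Rs Rh T S)
  have g: "cov_vector3 A Ds (gamma_field A (eta A)) (R_curv A Ds) X Y Z = 0"
    using hashiguchi_curvature_homogeneous[OF XYZW(1-3)] XYZW by (simp add: DR)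
  show ?thesis
    unfolding Let_def using a b c1 c2 d e f g by blast
qed

end
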